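(* Let $Z$ be a centered random variable with support $(a,b)$, $-\infty\le a<b\le+\infty$, whose density $\rho_*$ is continuous on $\mathbf{R}$ and twice differentiable on $(a,b)$. Let $g_*(z)=\frac{\int_z^\infty y\rho_*(y)\,dy}{\rho_*(z)}\mathbf{1}_{(a,b)}(z)$, $Q(z)=z^2-zg_*'(z)+g_*(z)$ and $\Phi_*(z)=\mathbf{P}[Z>z]$. Suppose that $g_*''(x)<2$ for all $x\in(a,b)$, and that $\frac{x-g_*'(x)}{Q(x)}$ has a finite limit as $x\to a$ and as $x\to b$. Assume moreover that there exists $c<1$ such that $\limsup_{z\to b}g_*(z)/Q(z)<c$. Let $X\in\mathbf{D}^{1,2}$ be a centered random variable with a density, whose support is contained in $(a,b)$, and let $G=\langle DX;-DL^{-1}X\rangle_H$. If $G\le g_*(X)$ almost surely, then there exists $z_0<b$ such that for all $z$ with $z_0<z<b$, $$\mathbf{P}[X>z]\ \le\ \frac{1}{1-c}\,\Phi_*(z).$$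
   Context: Saying that $Z$ has support $(a,b)$ means that $\rho_*>0$ on $(a,b)$ and $\rho_*=0$ outside $(a,b)$; "centered" means integrable with mean zero. The limit $z\to b$ is taken from inside $(a,b)$. Malliavin calculus: let $W$ be an isonormal Gaussian process over a real separable Hilbert space $H$, on a probability space $(\Omega,\mathcal{F},\mathbf{P})$ with $\mathcal{F}$ generated by $W$ (one may take $H=L^2([0,1])$ and $W$ the white noise of a standard Brownian motion). Every $X\in L^2(\Omega,\mathcal{F},\mathbf{P})$ has a unique Wiener chaos decomposition $X=\sum_{n\ge0}I_n(f_n)$, with $f_n$ symmetric in $H^{\otimes n}$, $I_n$ the $n$-th multiple Wiener integral, $I_0(f_0)=f_0=\mathbf{E}[X]$. $\mathbf{D}^{1,2}$ is the set of such $X$ with $\sum_{n\ge1}n\,n!\|f_n\|^2_{H^{\otimes n}}<\infty$. The Malliavin derivative of $X\in\mathbf{D}^{1,2}$ is the $H$-valued random variable $DX=\sum_{n\ge1}nI_{n-1}(f_n(r,\cdot))$ (as a function of $r$). The pseudo-inverse of the Ornstein–Uhlenbeck generator is $-L^{-1}X=\sum_{n\ge1}\frac1nI_n(f_n)$. *)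

theory Defs
  imports "HOL-Probability.Probability"
begin

subsection \<open>Isonormal Gaussian processes\<close>

text \<open>The degenerate law (variance zero) counts as Gaussian.\<close>

definition centered_gaussian :: "'w measure \<Rightarrow> ('w \<Rightarrow> real) \<Rightarrow> bool" where
  "centered_gaussian M Y \<longleftrightarrow> Y \<in> borel_measurable M \<and>
     ((AE \<omega> in M. Y \<omega> = 0) \<or>
      (\<exists>\<sigma>>0. distributed M lborel Y (\<lambda>x. ennreal (normal_density 0 \<sigma> x))))"

definition isonormal_process :: "'w measure \<Rightarrow> ('h::real_inner \<Rightarrow> 'w \<Rightarrow> real) \<Rightarrow> bool" where
  "isonormal_process M W \<longleftrightarrow> prob_space M \<and>
     (\<forall>S c. finite S \<longrightarrow> centered_gaussian M (\<lambda>\<omega>. \<Sum>h\<in>S. c h * W h \<omega>)) \<and>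
     (\<forall>h k. (\<integral>\<omega>. W h \<omega> * W k \<omega> \<partial>M) = h \<bullet> k)"

text \<open>The \<open>\<sigma>\<close>-algebra of \<open>M\<close> is generated by \<open>W\<close>. Equality is required up to null sets
  only, so that \<open>M\<close> may or may not be completed.\<close>

definition generated_by :: "'w measure \<Rightarrow> ('h \<Rightarrow> 'w \<Rightarrow> real) \<Rightarrow> bool" where
  "generated_by M W \<longleftrightarrow> (\<forall>h. W h \<in> borel_measurable M) \<and>
     (\<forall>A\<in>sets M. \<exists>B\<in>sigma_sets (space M) {W h -` S \<inter> space M | h S. S \<in> sets borel}.
        (A - B) \<union> (B - A) \<in> null_sets M)"

definition orthonormal_basis :: "'h::real_inner set \<Rightarrow> bool" where
  "orthonormal_basis E \<longleftrightarrow>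
     (\<forall>e\<in>E. norm e = 1) \<and> pairwise orthogonal E \<and> closure (span E) = UNIV"

subsection \<open>Kernels and multiple Wiener integrals\<close>

text \<open>Let \<open>E\<close> be an orthonormal basis of the Hilbert space \<open>H\<close>. The tensors
  \<open>e\<^sub>1 \<otimes> \<dots> \<otimes> e\<^sub>n\<close> with \<open>e\<^sub>i \<in> E\<close> form an orthonormal basis of the \<open>n\<close>-fold Hilbert tensor power
  of \<open>H\<close>; an element of that power is represented by its coefficients
  \<open>f [e\<^sub>1, \<dots>, e\<^sub>n] = \<langle>f, e\<^sub>1 \<otimes> \<dots> \<otimes> e\<^sub>n\<rangle>\<close>, a square-summable family. Values of \<open>f\<close> outside
  \<open>basis_tuples E n\<close> are irrelevant.\<close>

definition basis_tuples :: "'h set \<Rightarrow> nat \<Rightarrow> 'h list set" where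
  "basis_tuples E n = {es. set es \<subseteq> E \<and> length es = n}"

definition kernel :: "'h set \<Rightarrow> nat \<Rightarrow> ('h list \<Rightarrow> real) \<Rightarrow> bool" where
  "kernel E n f \<longleftrightarrow> (\<lambda>es. (f es)\<^sup>2) summable_on basis_tuples E n"

definition symmetric_kernel :: "'h set \<Rightarrow> nat \<Rightarrow> ('h list \<Rightarrow> real) \<Rightarrow> bool" where
  "symmetric_kernel E n f \<longleftrightarrow> kernel E n f \<and>
     (\<forall>es\<in>basis_tuples E n. \<forall>es'\<in>basis_tuples E n. mset es = mset es' \<longrightarrow> f es = f es')"

definition kernel_norm2 :: "'h set \<Rightarrow> nat \<Rightarrow> ('h list \<Rightarrow> real) \<Rightarrow> real" where
  "kernel_norm2 E n f = (\<Sum>\<^sub>\<infinity>es\<in>basis_tuples E n. (f es)\<^sup>2)"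

text \<open>Probabilists' Hermite polynomials.\<close>

fun hermite :: "nat \<Rightarrow> real \<Rightarrow> real" where
  "hermite 0 x = 1"
| "hermite (Suc 0) x = x"
| "hermite (Suc (Suc n)) x = x * hermite (Suc n) x - real (Suc n) * hermite n x"

text \<open>The multiple Wiener integral of a basis tensor \<open>e\<^sub>1 \<otimes> \<dots> \<otimes> e\<^sub>n\<close>: each distinct basis vector
  occurring \<open>k\<close> times contributes the \<open>k\<close>-th Hermite polynomial.\<close>

definition basis_integral :: "('h \<Rightarrow> 'w \<Rightarrow> real) \<Rightarrow> 'h list \<Rightarrow> 'w \<Rightarrow> real" where
  "basis_integral W es \<omega> = (\<Prod>e\<in>set es. hermite (count_list es e) (W e \<omega>))"

text \<open>Mean-square convergence. It is expressed by the nonnegative integral because the Bochner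
  integral of a non-integrable function is \<open>0\<close>.\<close>

definition L2_lim ::
  "'w measure \<Rightarrow> ('i \<Rightarrow> 'w \<Rightarrow> 'b::real_normed_vector) \<Rightarrow> ('w \<Rightarrow> 'b) \<Rightarrow> 'i filter \<Rightarrow> bool" where
  "L2_lim M Ys Y F \<longleftrightarrow> (\<forall>i. Ys i \<in> borel_measurable M) \<and> Y \<in> borel_measurable M \<and>
     ((\<lambda>i. \<integral>\<^sup>+\<omega>. ennreal ((norm (Ys i \<omega> - Y \<omega>))\<^sup>2) \<partial>M) \<longlongrightarrow> 0) F"

text \<open>\<open>Y = I\<^sub>n(f)\<close> almost surely. For square-summable \<open>f\<close> the net of finite partial sums
  converges in mean square, and \<open>E[I\<^sub>n(f)\<^sup>2] = n! \<parallel>f\<parallel>\<^sup>2\<close> if \<open>f\<close> is symmetric.\<close>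

definition multiple_wiener_integral ::
  "'w measure \<Rightarrow> ('h \<Rightarrow> 'w \<Rightarrow> real) \<Rightarrow> 'h set \<Rightarrow> nat \<Rightarrow> ('h list \<Rightarrow> real) \<Rightarrow> ('w \<Rightarrow> real) \<Rightarrow> bool"
where
  "multiple_wiener_integral M W E n f Y \<longleftrightarrow> kernel E n f \<and>
     L2_lim M (\<lambda>T \<omega>. \<Sum>es\<in>T. f es * basis_integral W es \<omega>) Y
       (finite_subsets_at_top (basis_tuples E n))"

subsection \<open>Malliavin calculus\<close>

text \<open>The random variables determined below are unique only up to almost sure equality, hence
  the relational definitions. In \<open>chaos_expansion\<close>, \<open>J n\<close> is (a version of) \<open>I\<^sub>n(f\<^sub>n)\<close>.\<close>

definition chaos_expansion ::
  "'w measure \<Rightarrow> ('h \<Rightarrow> 'w \<Rightarrow> real) \<Rightarrow> 'h set \<Rightarrow> ('w \<Rightarrow> real) \<Rightarrow>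
   (nat \<Rightarrow> 'h list \<Rightarrow> real) \<Rightarrow> (nat \<Rightarrow> 'w \<Rightarrow> real) \<Rightarrow> bool"
where
  "chaos_expansion M W E X f J \<longleftrightarrow>
     (\<forall>n. symmetric_kernel E n (f n) \<and> multiple_wiener_integral M W E n (f n) (J n)) \<and>
     L2_lim M (\<lambda>N \<omega>. \<Sum>n\<le>N. J n \<omega>) X sequentially"

definition malliavin_D12 ::
  "'w measure \<Rightarrow> ('h \<Rightarrow> 'w \<Rightarrow> real) \<Rightarrow> 'h set \<Rightarrow> ('w \<Rightarrow> real) set"
where
  "malliavin_D12 M W E = {X. X \<in> borel_measurable M \<and> integrable M (\<lambda>\<omega>. (X \<omega>)\<^sup>2) \<and>
     (\<exists>f J. chaos_expansion M W E X f J \<and>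
        summable (\<lambda>n. real n * fact n * kernel_norm2 E n (f n)))}"

text \<open>\<open>U n\<close> is the \<open>H\<close>-valued random variable \<open>I\<^bsub>n-1\<^esub>(f\<^sub>n(r, \<cdot>))\<close> (as a function of \<open>r\<close>): its
  coordinate along a basis vector \<open>e\<close> is the integral of the contraction of \<open>f\<^sub>n\<close> with \<open>e\<close>.\<close>

definition malliavin_derivative ::
  "'w measure \<Rightarrow> ('h::real_inner \<Rightarrow> 'w \<Rightarrow> real) \<Rightarrow> 'h set \<Rightarrow> ('w \<Rightarrow> real) \<Rightarrow> ('w \<Rightarrow> 'h) \<Rightarrow> bool"
where
  "malliavin_derivative M W E X DX \<longleftrightarrow> X \<in> malliavin_D12 M W E \<and>
     (\<exists>f J U. chaos_expansion M W E X f J \<and>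
        (\<forall>n\<ge>1. \<forall>e\<in>E.
           multiple_wiener_integral M W E (n - 1) (\<lambda>es. f n (e # es)) (\<lambda>\<omega>. U n \<omega> \<bullet> e)) \<and>
        L2_lim M (\<lambda>N \<omega>. \<Sum>n=1..N. real n *\<^sub>R U n \<omega>) DX sequentially)"

text \<open>\<open>Y = - L\<^bsup>-1\<^esup> X\<close> for the Ornstein-Uhlenbeck generator \<open>L\<close>.\<close>

definition neg_OU_pseudo_inverse ::
  "'w measure \<Rightarrow> ('h \<Rightarrow> 'w \<Rightarrow> real) \<Rightarrow> 'h set \<Rightarrow> ('w \<Rightarrow> real) \<Rightarrow> ('w \<Rightarrow> real) \<Rightarrow> bool"
where
  "neg_OU_pseudo_inverse M W E X Y \<longleftrightarrow>
     (\<exists>f J. chaos_expansion M W E X f J \<and>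
        L2_lim M (\<lambda>N \<omega>. \<Sum>n=1..N. (1 / real n) * J n \<omega>) Y sequentially)"

subsection \<open>The reference law\<close>

definition open_interval :: "ereal \<Rightarrow> ereal \<Rightarrow> real set" where
  "open_interval a b = {x. a < ereal x \<and> ereal x < b}"

definition gstar :: "ereal \<Rightarrow> ereal \<Rightarrow> (real \<Rightarrow> real) \<Rightarrow> real \<Rightarrow> real" where
  "gstar a b \<rho> z = (LBINT y:{z..}. y * \<rho> y) / \<rho> z * indicator (open_interval a b) z"

definition Qstar :: "ereal \<Rightarrow> ereal \<Rightarrow> (real \<Rightarrow> real) \<Rightarrow> real \<Rightarrow> real" where
  "Qstar a b \<rho> z = z\<^sup>2 - z * deriv (gstar a b \<rho>) z + gstar a b \<rho> z"

end

theory Submission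
  imports Defs "HOL-Combinatorics.Multiset_Permutations"
begin

text \<open>Malliavin integration by parts, \<open>E[X \<phi>(X)] = E[\<phi>'(X) G]\<close>, follows from Gaussian integration by
  parts for polynomials in finitely many basis coordinates. The passage to the limit works because
  the chaos coefficient of \<open>DX \<bullet> e\<close> at a multi-index \<open>\<beta>\<close> is that of \<open>X\<close> at \<open>\<beta> + e\<close>, so the gradients of
  the truncated expansions of \<open>X\<close> are orthogonal projections of \<open>DX\<close>.

  Write \<open>A(z)\<close> for the integral of \<open>y \<rho>(y)\<close> over \<open>y \<ge> z\<close>, so that \<open>g A' = - z A\<close>, and \<open>\<Phi>\<close> for the tail of
  \<open>Z\<close>. The function \<open>F = (1 - \<Phi>) / A\<close> is nondecreasing and satisfies Stein's equation
  \<open>g F' = 1 + x F\<close>. Inserting \<open>F\<close>, stopped at \<open>z\<close>, into the integration by parts and using \<open>G \<le> g(X)\<close>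
  gives \<open>F(z) E[X; X > z] \<le> P[X \<le> z]\<close>. On the other side, \<open>\<Phi> / A\<close> is nonincreasing on the positive
  half of the interval and \<open>\<Phi> - A (x - g') / Q\<close> decreases to \<open>0\<close> at \<open>b\<close>, whence
  \<open>x \<Phi>(x) / A(x) \<ge> 1 - g(x) / Q(x) \<ge> 1 - c\<close> and \<open>(1 - c) P[X > z] \<le> \<Phi>(z) / A(z) E[X; X > z]\<close>.
  Eliminating \<open>E[X; X > z]\<close> yields the bound.\<close>

subsection \<open>Gaussian integration by parts\<close>

text \<open>\<open>F\<close> is one branch of a Stein solution. For h the indicator of the half line
  up to z, the equation g f' - x f = h - E[h(Z)] is solved to the left of z by \<Phi>(z) F and to
  the right of z by (1 - \<Phi>(z)) \<Phi> / A. The hypothesis on G can be inserted only where f' is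
  nonnegative. This fits the left branch, but the right branch decreases on the positive half, where
  the hypothesis would point the wrong way. Hence \<open>F\<close> is frozen at z, E[X; X > z] is
  carried along as an unknown, and the right branch enters only through pointwise bounds on \<Phi> /
  A.

  The definitions describe \<open>DX\<close> by chaos coefficients and give no chain rule for
  \<phi>(X). The chain rule is therefore applied to polynomials in finitely many coordinates, where
  it is elementary, and \<open>DX \<omega> \<bullet> DY \<omega>\<close> is reached by mean-square
  approximation. Likewise an isonormal process prescribes only the laws of linear combinations, so
  independence of the coordinates \<open>W e\<close> has to be extracted from characteristic
  functions before Fubini can isolate one of them.\<close>

lemma integral_deriv_eq_0:
  fixes u u' :: "real \<Rightarrow> real"
  assumes deriv: "\<And>x. (u has_real_derivative u' x) (at x)"
    and cont: "continuous_on UNIV u'"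
    and u: "integrable lborel u" and u': "integrable lborel u'"
  shows "(\<integral>x. u' x \<partial>lborel) = 0"
proof (rule ccontr)
  define I where "I = (\<integral>x. u' x \<partial>lborel)"
  \<comment> \<open>The boundary term of u' over [-T, T]. No decay of u is assumed: the term tends
    to the integral \<open>I\<close>, so a nonzero \<open>I\<close> would keep it away from 0 near
    infinity, against the integrability of u.\<close>
  define w where "w T = u T - u (- T)" for T
  assume "(\<integral>x. u' x \<partial>lborel) \<noteq> 0"
  then have I: "\<bar>I\<bar> > 0" by (simp add: I_def)
  have FTC: "(\<integral>x. u' x * indicator {-T..T} x \<partial>lborel) = w T" if "T \<ge> 0" for T
    unfolding w_def
    by (rule integral_FTC_Icc_real)
      (use that deriv cont in \<open>auto simp: continuous_on_eq_continuous_at\<close>)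
  have "((\<lambda>T. \<integral>x. u' x * indicator {-T..T} x \<partial>lborel) \<longlongrightarrow> I) at_top"
    unfolding I_def
  proof (rule integral_dominated_convergence_at_top[where w="\<lambda>x. \<bar>u' x\<bar>"])
    show "AE x in lborel. ((\<lambda>T. u' x * indicator {- T..T} x) \<longlongrightarrow> u' x) at_top"
    proof (intro AE_I2 tendsto_eventually)
      fix x :: real
      show "\<forall>\<^sub>F T in at_top. u' x * indicator {- T..T} x = u' x"
        using eventually_ge_at_top[of "\<bar>x\<bar>"] by eventually_elim (auto simp: indicator_def abs_le_iff)
    qed
  qed (use u' in \<open>auto intro!: always_eventually simp: indicator_def\<close>)
  then have "(w \<longlongrightarrow> I) at_top"
    by (rule Lim_transform_eventually)
      (use eventually_ge_at_top[of 0] in eventually_elim, simp add: FTC)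
  then have "((\<lambda>T. \<bar>w T\<bar>) \<longlongrightarrow> \<bar>I\<bar>) at_top" by (rule tendsto_rabs)
  moreover have "\<bar>I\<bar> / 2 < \<bar>I\<bar>" using I by simp
  ultimately have "eventually (\<lambda>T. \<bar>w T\<bar> > \<bar>I\<bar> / 2) at_top"
    by (rule order_tendstoD)
  then obtain T0 where T0: "\<And>T. T \<ge> T0 \<Longrightarrow> \<bar>w T\<bar> > \<bar>I\<bar> / 2"
    by (auto simp: eventually_at_top_linorder)
  have T0': "\<bar>I\<bar> < \<bar>w T\<bar> * 2" if "T0 \<le> T" for T
    using T0[OF that] by simp
  have "integrable lborel (\<lambda>x. u (0 + (-1) * x))"
    by (rule lborel_integrable_real_affine[OF u]) simp
  then have w: "integrable lborel w" using u by (simp add: w_def[abs_def])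
  have "(\<integral>\<^sup>+x. ennreal (\<bar>I\<bar> / 2) * indicator {T0..} x \<partial>lborel) \<le> (\<integral>\<^sup>+x. ennreal (norm (w x)) \<partial>lborel)"
    by (intro nn_integral_mono) (auto simp: indicator_def intro!: ennreal_leI less_imp_le T0')
  moreover have "(\<integral>\<^sup>+x. ennreal (\<bar>I\<bar> / 2) * indicator {T0..} x \<partial>lborel) = \<infinity>"
  proof -
    have "emeasure lborel {T0..} = \<infinity>"
    proof (rule ccontr)
      assume "emeasure lborel {T0..} \<noteq> \<infinity>"
      then obtain r where r: "emeasure lborel {T0..} = ennreal r" "r \<ge> 0"
        by (cases "emeasure lborel {T0..}") auto
      have "emeasure lborel {T0..T0 + (r + 1)} \<le> emeasure lborel {T0..}"
        by (intro emeasure_mono) auto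
      then show False using r by (simp add: ennreal_le_iff)
    qed
    then show ?thesis using I by (simp add: nn_integral_cmult ennreal_mult_eq_top_iff)
  qed
  ultimately show False using w by (auto simp: integrable_iff_bounded)
qed

declare hermite.simps(3) [simp del]

text \<open>At n = 0 the index \<open>n - 1\<close> truncates to 0, but its coefficient is 0, so a
  single recursion serves all degrees.\<close>

lemma hermite_Suc: "hermite (Suc n) x = x * hermite n x - real n * hermite (n - 1) x"
  by (cases n) (auto simp: hermite.simps(3))

lemma hermite_has_real_derivative:
  "(hermite n has_real_derivative real n * hermite (n - 1) x) (at x)"
proof (induction n rule: less_induct)
  case (less n)
  consider "n = 0" | "n = 1" | k where "n = Suc (Suc k)"
    by (metis One_nat_def not0_implies_Suc)
  then show ?case
  proof cases
    case 1
    then have "hermite n = (\<lambda>x. 1)" by auto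
    then show ?thesis using 1 by simp
  next
    case 2
    then have "hermite n = (\<lambda>x. x)" by auto
    then show ?thesis using 2 by simp
  next
    case 3
    have eq: "hermite n = (\<lambda>x. x * hermite (Suc k) x - real (Suc k) * hermite k x)"
      using 3 by (auto simp: fun_eq_iff hermite.simps(3))
    have d1: "(hermite (Suc k) has_real_derivative real (Suc k) * hermite k x) (at x)"
      using less[of "Suc k"] 3 by simp
    have d2: "(hermite k has_real_derivative real k * hermite (k - 1) x) (at x)"
      using less[of k] 3 by simp
    show ?thesis unfolding eq
      apply (rule derivative_eq_intros d1 d2 refl)+
      using 3 by (simp add: hermite_Suc algebra_simps)
  qed
qed

lemma continuous_on_hermite [continuous_intros]:
  "continuous_on S f \<Longrightarrow> continuous_on S (\<lambda>x. hermite n (f x))"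
  using continuous_on_compose2[of UNIV "hermite n" S f] hermite_has_real_derivative
  by (metis DERIV_continuous_on has_field_derivative_at_within subset_UNIV)

lemma borel_measurable_hermite [measurable]: "hermite n \<in> borel_measurable borel"
  by (intro borel_measurable_continuous_onI continuous_on_hermite continuous_on_id)

lemma std_normal_density_has_real_derivative:
  "(std_normal_density has_real_derivative - x * std_normal_density x) (at x)"
  unfolding std_normal_density_def[abs_def]
  by (rule derivative_eq_intros refl | simp add: field_simps)+

text \<open>The powers of x absorb the factor x produced by the recursion. The weight f is left free
  so that the lemma can be applied twice, first with f = 1 and then with f a Hermite
  polynomial.\<close>

lemma integrable_hermite_mult_power:
  assumes f: "\<And>j. integrable std_normal_distribution (\<lambda>x. f x * x ^ j)"
  shows "integrable std_normal_distribution (\<lambda>x. hermite n x * f x * x ^ j)"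
proof (induction n arbitrary: j rule: less_induct)
  case (less n)
  show ?case
  proof (cases n)
    case (Suc k)
    have "integrable std_normal_distribution
        (\<lambda>x. hermite k x * f x * x ^ Suc j - real k * (hermite (k - 1) x * f x * x ^ j))"
      using less[of k "Suc j"] less[of "k - 1" j] Suc by auto
    then show ?thesis using Suc by (simp add: hermite_Suc algebra_simps)
  qed (use f in simp)
qed

lemma integrable_hermite_mult:
  "integrable std_normal_distribution (\<lambda>x. hermite m x * hermite n x)"
proof -
  have "integrable std_normal_distribution (\<lambda>x. 1 * x ^ j)" for j
    using integrable_std_normal_moment[of j]
    by (simp add: integrable_density normal_density_nonneg)
  then have "integrable std_normal_distribution (\<lambda>x. hermite n x * x ^ j)" for j
    using integrable_hermite_mult_power[of "\<lambda>_. 1"] by simp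
  then show ?thesis using integrable_hermite_mult_power[of "hermite n" m 0] by simp
qed

text \<open>The difference of the two integrands, weighted by the density, is the derivative of
  \<open>\<psi> x * hermite k x * std_normal_density x\<close> up to sign, because each Hermite
  polynomial is x times its predecessor minus the predecessor's derivative. The second integrability
  hypothesis is the one for this product.\<close>

lemma hermite_integration_by_parts:
  fixes \<psi> \<psi>' :: "real \<Rightarrow> real"
  assumes deriv: "\<And>x. (\<psi> has_real_derivative \<psi>' x) (at x)"
    and cont: "continuous_on UNIV \<psi>'"
    and int: "integrable std_normal_distribution (\<lambda>x. \<psi> x * hermite (Suc k) x)"
      "integrable std_normal_distribution (\<lambda>x. \<psi> x * hermite k x)"
      "integrable std_normal_distribution (\<lambda>x. \<psi>' x * hermite k x)"
  shows "(\<integral>x. \<psi> x * hermite (Suc k) x \<partial>std_normal_distribution) =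
    (\<integral>x. \<psi>' x * hermite k x \<partial>std_normal_distribution)"
proof -
  let ?n = "std_normal_density"
  have c\<psi>: "continuous_on UNIV \<psi>"
    using deriv by (meson DERIV_isCont continuous_at_imp_continuous_on)
  have [measurable]: "\<psi> \<in> borel_measurable borel" "\<psi>' \<in> borel_measurable borel"
    using c\<psi> cont by (auto intro: borel_measurable_continuous_onI)
  have cn: "continuous_on UNIV ?n"
    using std_normal_density_has_real_derivative
    by (meson DERIV_isCont continuous_at_imp_continuous_on)
  define u' where "u' x = \<psi>' x * hermite k x * ?n x - \<psi> x * hermite (Suc k) x * ?n x" for x
  have i: "integrable lborel (\<lambda>x. \<psi> x * hermite (Suc k) x * ?n x)"
    "integrable lborel (\<lambda>x. \<psi> x * hermite k x * ?n x)"
    "integrable lborel (\<lambda>x. \<psi>' x * hermite k x * ?n x)"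
    using int by (auto simp: integrable_density normal_density_nonneg mult.commute)
  have "(\<integral>x. u' x \<partial>lborel) = 0"
  proof (rule integral_deriv_eq_0)
    show "((\<lambda>x. \<psi> x * hermite k x * ?n x) has_real_derivative u' x) (at x)" for x
      unfolding u'_def
      apply (rule derivative_eq_intros deriv hermite_has_real_derivative
          std_normal_density_has_real_derivative refl)+
      by (simp add: hermite_Suc algebra_simps)
    show "continuous_on UNIV u'" unfolding u'_def
      by (intro continuous_intros c\<psi> cont cn)
  qed (use i in \<open>auto simp: u'_def\<close>)
  then show ?thesis using i
    by (simp add: u'_def integral_density normal_density_nonneg mult.commute)
qed

subsection \<open>The joint law of a Gaussian family\<close>

text \<open>Under the probability measure with density h / E[h], the hypothesis \<open>char\<close>
  says that Y has the characteristic function of the standard normal law. If E[h] = 0, there is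
  nothing to normalise and both sides vanish.\<close>

lemma (in prob_space) indicator_expectation_normal:
  fixes h Y :: "'a \<Rightarrow> real"
  assumes [measurable]: "h \<in> borel_measurable M" "Y \<in> borel_measurable M"
    and h: "\<And>\<omega>. 0 \<le> h \<omega>" "\<And>\<omega>. h \<omega> \<le> C"
    and char: "\<And>s. (\<integral>\<omega>. complex_of_real (h \<omega>) * iexp (s * Y \<omega>) \<partial>M) =
      complex_of_real ((\<integral>\<omega>. h \<omega> \<partial>M) * exp (- s\<^sup>2 / 2))"
    and A [measurable]: "A \<in> sets borel"
  shows "(\<integral>\<omega>. h \<omega> * indicator A (Y \<omega>) \<partial>M) =
    (\<integral>\<omega>. h \<omega> \<partial>M) * measure std_normal_distribution A"
proof -
  have int: "integrable M h"
    by (rule integrable_const_bound[of _ C]) (use h in auto)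
  define m where "m = (\<integral>\<omega>. h \<omega> \<partial>M)"
  have m0: "m \<ge> 0" unfolding m_def using h by simp
  show ?thesis
  proof (cases "m = 0")
    case True
    then have "AE \<omega> in M. h \<omega> = 0"
      using int h unfolding m_def by (simp add: integral_nonneg_eq_0_iff_AE)
    then have "AE \<omega> in M. h \<omega> * indicator A (Y \<omega>) = (0::real)" by eventually_elim simp
    then have "(\<integral>\<omega>. h \<omega> * indicator A (Y \<omega>) \<partial>M) = 0"
      by (subst integral_cong_AE[where g = "\<lambda>_. 0"]) auto
    then show ?thesis using True by (simp add: m_def)
  next
    case False
    with m0 have m: "m > 0" by simp
    define D where "D = density M (\<lambda>\<omega>. ennreal (h \<omega> / m))"
    have int': "integrable M (\<lambda>\<omega>. h \<omega> / m)" using int by simp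
    have sp[simp]: "space D = space M" and st[measurable_cong, simp]: "sets D = sets M"
      by (auto simp: D_def)
    have "emeasure D (space D) = (\<integral>\<^sup>+\<omega>. ennreal (h \<omega> / m) \<partial>M)"
      by (simp add: D_def emeasure_density cong: nn_integral_cong)
    also have "\<dots> = ennreal (\<integral>\<omega>. h \<omega> / m \<partial>M)"
      by (rule nn_integral_eq_integral) (use int' h m in auto)
    also have "(\<integral>\<omega>. h \<omega> / m \<partial>M) = 1" using m by (simp add: m_def)
    finally have "prob_space D" by (intro prob_spaceI) simp
    then interpret D: prob_space D .
    have YD: "D.random_variable borel Y" by simp
    have "real_distribution (distr D borel Y)"
      by (rule D.real_distribution_distr[OF YD])
    moreover have "char (distr D borel Y) = char std_normal_distribution"
    proof
      fix s
      have "char (distr D borel Y) s = (\<integral>\<omega>. iexp (s * Y \<omega>) \<partial>D)"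
        unfolding char_def by (subst integral_distr) auto
      also have "\<dots> = (\<integral>\<omega>. (h \<omega> / m) *\<^sub>R iexp (s * Y \<omega>) \<partial>M)"
        unfolding D_def by (subst integral_density) (use h m in auto)
      also have "\<dots> = (\<integral>\<omega>. (complex_of_real (h \<omega>) * iexp (s * Y \<omega>)) / m \<partial>M)"
        by (intro Bochner_Integration.integral_cong) (auto simp: scaleR_conv_of_real)
      also have "\<dots> = (\<integral>\<omega>. complex_of_real (h \<omega>) * iexp (s * Y \<omega>) \<partial>M) / m"
        by simp
      also have "\<dots> = exp (- s\<^sup>2 / 2)" using m by (subst char) (simp add: m_def)
      finally show "char (distr D borel Y) s = char std_normal_distribution s"
        by (simp add: char_std_normal_distribution)
    qed
    ultimately have eq: "distr D borel Y = std_normal_distribution"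
      by (intro Levy_uniqueness real_dist_normal_dist)
    have "(\<integral>\<omega>. h \<omega> * indicator A (Y \<omega>) \<partial>M) / m = (\<integral>\<omega>. (h \<omega> / m) *\<^sub>R indicator A (Y \<omega>) \<partial>M)"
      by simp
    also have "\<dots> = (\<integral>\<omega>. indicator A (Y \<omega>) \<partial>D)"
      unfolding D_def by (subst integral_density) (use h m in auto)
    also have "\<dots> = (\<integral>y. indicator A y \<partial>distr D borel Y)"
      by (subst integral_distr) auto
    also have "\<dots> = measure std_normal_distribution A" using eq by simp
    finally show ?thesis using m by (simp add: m_def field_simps)
  qed
qed

text \<open>\<open>char_W\<close> encodes that the variables \<open>W e\<close> are independent and
  standard normal. It is put in terms of characteristic functions because an isonormal process
  supplies the law of each finite linear combination.\<close>

locale gaussian_family = prob_space M for M :: "'w measure" +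
  fixes W :: "'h \<Rightarrow> 'w \<Rightarrow> real" and E :: "'h set"
  assumes W_measurable [measurable]: "\<And>e. e \<in> E \<Longrightarrow> W e \<in> borel_measurable M"
    and char_W: "\<And>S t. finite S \<Longrightarrow> S \<subseteq> E \<Longrightarrow>
      (\<integral>\<omega>. iexp (\<Sum>e\<in>S. t e * W e \<omega>) \<partial>M) = complex_of_real (\<Prod>e\<in>S. exp (- (t e)\<^sup>2 / 2))"
begin

text \<open>Indicators are introduced one coordinate at a time. The weights \<open>1 + cos \<theta>\<close> and \<open>1 + sin \<theta>\<close> are
  nonnegative, so Levy's uniqueness theorem, which is about probability measures, applies to them.\<close>

lemma indicator_iexp_expectation:
  assumes "finite S" "S \<subseteq> E" "finite S'" "S' \<subseteq> E" "S \<inter> S' = {}"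
    and "\<And>e. e \<in> S \<Longrightarrow> A e \<in> sets borel"
  shows "(\<integral>\<omega>. complex_of_real (\<Prod>e\<in>S. indicator (A e) (W e \<omega>)) *
      iexp (\<Sum>e\<in>S'. t e * W e \<omega>) \<partial>M) =
    complex_of_real ((\<Prod>e\<in>S. measure std_normal_distribution (A e)) *
      (\<Prod>e\<in>S'. exp (- (t e)\<^sup>2 / 2)))"
  using assms
proof (induction S arbitrary: S' t rule: finite_induct)
  case empty
  then show ?case using char_W[of S' t] by simp
next
  case (insert e S)
  define h0 where "h0 \<omega> = (\<Prod>e\<in>S. indicator (A e) (W e \<omega>) :: real)" for \<omega>
  define \<theta> where "\<theta> \<omega> = (\<Sum>e\<in>S'. t e * W e \<omega>)" for \<omega>
  define k where "k = (\<Prod>e\<in>S. measure std_normal_distribution (A e))"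
  define q where "q = (\<Prod>e\<in>S'. exp (- (t e)\<^sup>2 / 2))"
  let ?Y = "W e"
  have eE: "e \<in> E" and SE: "S \<subseteq> E" and eS': "e \<notin> S'" and dis: "S \<inter> S' = {}"
    using insert.prems by auto
  have A [measurable]: "A e \<in> sets borel" "\<And>i. i \<in> S \<Longrightarrow> A i \<in> sets borel"
    using insert.prems by auto
  have Y [measurable]: "?Y \<in> borel_measurable M" using eE by measurable
  have h0m [measurable]: "h0 \<in> borel_measurable M"
    unfolding h0_def[abs_def]
    by (intro borel_measurable_prod borel_measurable_indicator' measurable_sets) 
       (use SE in auto)
  have \<theta>m [measurable]: "\<theta> \<in> borel_measurable M"
    unfolding \<theta>_def[abs_def] by (intro borel_measurable_sum) (use insert.prems in auto)
  have h0: "0 \<le> h0 \<omega>" "h0 \<omega> \<le> 1" for \<omega>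
    unfolding h0_def by (auto intro!: prod_nonneg prod_le_1)
  have ie: "integrable M (\<lambda>\<omega>. complex_of_real (h0 \<omega>) * iexp (f \<omega>))"
    if [measurable]: "f \<in> borel_measurable M" for f
    by (rule integrable_const_bound[of _ 1]) (use h0 in \<open>auto simp: norm_mult\<close>)
  have IH0: "(\<integral>\<omega>. complex_of_real (h0 \<omega>) * iexp (s * ?Y \<omega>) \<partial>M) =
      complex_of_real (k * exp (- s\<^sup>2 / 2))" for s
    using insert.IH[of "{e}" "\<lambda>_. s"] SE eE insert.hyps A by (simp add: h0_def k_def)
  \<comment> \<open>The coordinate e joins \<open>S'\<close> with its own frequency s. Reversing the
    sign of the phase \<theta> leaves the right side unchanged, as it is even in each
    frequency.\<close>
  have IH: "(\<integral>\<omega>. complex_of_real (h0 \<omega>) * iexp (r * \<theta> \<omega> + s * ?Y \<omega>) \<partial>M) =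
      complex_of_real (k * q * exp (- s\<^sup>2 / 2))" if r: "r\<^sup>2 = 1" for r s
  proof -
    let ?t = "(\<lambda>i. r * t i)(e := s)"
    have "(\<Sum>i\<in>insert e S'. ?t i * W i \<omega>) = r * \<theta> \<omega> + s * ?Y \<omega>" for \<omega>
    proof -
      have "(\<Sum>i\<in>S'. ?t i * W i \<omega>) = (\<Sum>i\<in>S'. r * (t i * W i \<omega>))"
        using eS' by (intro sum.cong) auto
      then show ?thesis
        using eS' insert.prems(2) by (simp add: \<theta>_def sum_distrib_left)
    qed
    moreover have "(\<Prod>i\<in>insert e S'. exp (- (?t i)\<^sup>2 / 2)) = q * exp (- s\<^sup>2 / 2)"
    proof -
      have "(\<Prod>i\<in>S'. exp (- (?t i)\<^sup>2 / 2)) = q"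
        unfolding q_def using eS' r by (intro prod.cong) (auto simp: power_mult_distrib)
      then show ?thesis using eS' insert.prems(2) by simp
    qed
    ultimately show ?thesis
      using insert.IH[of "insert e S'" ?t] SE eE insert.hyps insert.prems dis A
      by (simp add: h0_def k_def mult.assoc)
  qed
  have IHp: "(\<integral>\<omega>. complex_of_real (h0 \<omega>) * iexp (\<theta> \<omega> + s * ?Y \<omega>) \<partial>M) =
      complex_of_real (k * q * exp (- s\<^sup>2 / 2))" for s
    using IH[of 1 s] by simp
  have IHm: "(\<integral>\<omega>. complex_of_real (h0 \<omega>) * iexp (- \<theta> \<omega> + s * ?Y \<omega>) \<partial>M) =
      complex_of_real (k * q * exp (- s\<^sup>2 / 2))" for s
    using IH[of "-1" s] by simp
  have from_char: "(\<integral>\<omega>. h \<omega> * indicator (A e) (?Y \<omega>) \<partial>M) = m * measure std_normal_distribution (A e)"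
    if hm [measurable]: "h \<in> borel_measurable M" and h: "\<And>\<omega>. 0 \<le> h \<omega>" "\<And>\<omega>. h \<omega> \<le> 2"
      and char: "\<And>s. (\<integral>\<omega>. complex_of_real (h \<omega>) * iexp (s * ?Y \<omega>) \<partial>M) =
        complex_of_real (m * exp (- s\<^sup>2 / 2))" for h m
  proof -
    have "complex_of_real (\<integral>\<omega>. h \<omega> \<partial>M) = complex_of_real m"
      using char[of 0] by simp
    then have m: "(\<integral>\<omega>. h \<omega> \<partial>M) = m" using of_real_eq_iff by blast
    show ?thesis
      using indicator_expectation_normal[of h ?Y 2 "A e"] h char by (simp add: m)
  qed
  have expand: "iexp x = of_real (cos x) + \<i> * of_real (sin x)" for x
    by (simp add: exp_eq_polar cis.ctr complex_eq_iff)
  have c1: "(\<integral>\<omega>. h0 \<omega> * indicator (A e) (?Y \<omega>) \<partial>M) = k * measure std_normal_distribution (A e)"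
    by (rule from_char) (use h0 IH0 in \<open>auto intro: order_trans[OF h0(2)]\<close>)
  \<comment> \<open>Averaging the signs r = 1 and r = -1 turns the phase into cos \<theta>. The
    summand 1 of the weight contributes the first k, which \<open>c1\<close> removes again in
    \<open>d2\<close>.\<close>
  have c2: "(\<integral>\<omega>. h0 \<omega> * (1 + cos (\<theta> \<omega>)) * indicator (A e) (?Y \<omega>) \<partial>M) =
    (k + k * q) * measure std_normal_distribution (A e)"
  proof (rule from_char)
    show "0 \<le> h0 \<omega> * (1 + cos (\<theta> \<omega>))" for \<omega>
      using h0[of \<omega>] cos_ge_minus_one[of "\<theta> \<omega>"] by (intro mult_nonneg_nonneg) linarith+
    show "h0 \<omega> * (1 + cos (\<theta> \<omega>)) \<le> 2" for \<omega>
      using mult_mono[of "h0 \<omega>" 1 "1 + cos (\<theta> \<omega>)" 2] h0[of \<omega>] cos_ge_minus_one[of "\<theta> \<omega>"]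
        cos_le_one[of "\<theta> \<omega>"] by simp
    fix s
    have "complex_of_real (h0 \<omega> * (1 + cos (\<theta> \<omega>))) * iexp (s * ?Y \<omega>) =
        complex_of_real (h0 \<omega>) * iexp (s * ?Y \<omega>) +
        (complex_of_real (h0 \<omega>) * iexp (\<theta> \<omega> + s * ?Y \<omega>) +
         complex_of_real (h0 \<omega>) * iexp (- \<theta> \<omega> + s * ?Y \<omega>)) / 2" for \<omega>
      unfolding expand by (simp add: complex_eq_iff cos_add sin_add cos_diff sin_diff algebra_simps)
    then show "(\<integral>\<omega>. complex_of_real (h0 \<omega> * (1 + cos (\<theta> \<omega>))) * iexp (s * ?Y \<omega>) \<partial>M) =
        complex_of_real ((k + k * q) * exp (- s\<^sup>2 / 2))"
      using IH0[of s] IHp[of s] IHm[of s] ie[of "\<lambda>\<omega>. s * ?Y \<omega>"]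
        ie[of "\<lambda>\<omega>. \<theta> \<omega> + s * ?Y \<omega>"] ie[of "\<lambda>\<omega>. - \<theta> \<omega> + s * ?Y \<omega>"]
      by (simp add: distrib_right)
  qed measurable
  \<comment> \<open>For sin \<theta> the two signs are subtracted, and their equal expectations
    cancel.\<close>
  have c3: "(\<integral>\<omega>. h0 \<omega> * (1 + sin (\<theta> \<omega>)) * indicator (A e) (?Y \<omega>) \<partial>M) =
    k * measure std_normal_distribution (A e)"
  proof (rule from_char)
    show "0 \<le> h0 \<omega> * (1 + sin (\<theta> \<omega>))" for \<omega>
      using h0[of \<omega>] sin_ge_minus_one[of "\<theta> \<omega>"] by (intro mult_nonneg_nonneg) linarith+
    show "h0 \<omega> * (1 + sin (\<theta> \<omega>)) \<le> 2" for \<omega>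
      using mult_mono[of "h0 \<omega>" 1 "1 + sin (\<theta> \<omega>)" 2] h0[of \<omega>] sin_ge_minus_one[of "\<theta> \<omega>"]
        sin_le_one[of "\<theta> \<omega>"] by simp
    fix s
    have "complex_of_real (h0 \<omega> * (1 + sin (\<theta> \<omega>))) * iexp (s * ?Y \<omega>) =
        complex_of_real (h0 \<omega>) * iexp (s * ?Y \<omega>) +
        (- \<i> / 2) * (complex_of_real (h0 \<omega>) * iexp (\<theta> \<omega> + s * ?Y \<omega>) -
         complex_of_real (h0 \<omega>) * iexp (- \<theta> \<omega> + s * ?Y \<omega>))" for \<omega>
      unfolding expand by (simp add: complex_eq_iff cos_add sin_add cos_diff sin_diff algebra_simps)
    then show "(\<integral>\<omega>. complex_of_real (h0 \<omega> * (1 + sin (\<theta> \<omega>))) * iexp (s * ?Y \<omega>) \<partial>M) =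
        complex_of_real (k * exp (- s\<^sup>2 / 2))"
      using IH0[of s] IHp[of s] IHm[of s] ie[of "\<lambda>\<omega>. s * ?Y \<omega>"]
        ie[of "\<lambda>\<omega>. \<theta> \<omega> + s * ?Y \<omega>"] ie[of "\<lambda>\<omega>. - \<theta> \<omega> + s * ?Y \<omega>"]
      by simp
  qed measurable
  let ?I = "\<lambda>\<omega>. indicator (A e) (?Y \<omega>) :: real"
  have b: "integrable M (\<lambda>\<omega>. h0 \<omega> * f \<omega> * ?I \<omega>)"
    if [measurable]: "f \<in> borel_measurable M" and "\<And>\<omega>. \<bar>f \<omega>\<bar> \<le> 1" for f
    by (rule integrable_const_bound[of _ 1])
      (use h0 that in \<open>auto simp: abs_mult indicator_def intro!: mult_le_one\<close>)
  have i0: "integrable M (\<lambda>\<omega>. h0 \<omega> * ?I \<omega>)" using b[of "\<lambda>_. 1"] by simp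
  have i1: "integrable M (\<lambda>\<omega>. h0 \<omega> * cos (\<theta> \<omega>) * ?I \<omega>)" by (rule b) auto
  have i2: "integrable M (\<lambda>\<omega>. h0 \<omega> * sin (\<theta> \<omega>) * ?I \<omega>)" by (rule b) auto
  have d2: "(\<integral>\<omega>. h0 \<omega> * cos (\<theta> \<omega>) * ?I \<omega> \<partial>M) = k * q * measure std_normal_distribution (A e)"
    using c1 c2 i0 i1 by (simp add: distrib_left distrib_right)
  have d3: "(\<integral>\<omega>. h0 \<omega> * sin (\<theta> \<omega>) * ?I \<omega> \<partial>M) = 0"
    using c1 c3 i0 i2 by (simp add: distrib_left distrib_right)
  have "(\<integral>\<omega>. complex_of_real (\<Prod>e\<in>insert e S. indicator (A e) (W e \<omega>)) * iexp (\<theta> \<omega>) \<partial>M) =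
    (\<integral>\<omega>. complex_of_real (h0 \<omega> * cos (\<theta> \<omega>) * ?I \<omega>) +
      \<i> * complex_of_real (h0 \<omega> * sin (\<theta> \<omega>) * ?I \<omega>) \<partial>M)"
    using insert.hyps unfolding expand
    by (intro Bochner_Integration.integral_cong refl) (simp add: h0_def algebra_simps)
  also have "\<dots> = complex_of_real (\<integral>\<omega>. h0 \<omega> * cos (\<theta> \<omega>) * ?I \<omega> \<partial>M) +
      \<i> * complex_of_real (\<integral>\<omega>. h0 \<omega> * sin (\<theta> \<omega>) * ?I \<omega> \<partial>M)"
    using i1 i2 by (subst Bochner_Integration.integral_add) (auto simp del: of_real_mult)
  also have "\<dots> = complex_of_real (k * q * measure std_normal_distribution (A e))"
    using d2 d3 by simp
  finally show ?case using insert.hyps by (simp add: \<theta>_def k_def q_def mult_ac)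
qed

text \<open>With \<open>S'\<close> empty the previous lemma gives the probability of every
  rectangle, and rectangles determine a measure on a finite product. From here on independence is
  available in the form needed for Fubini.\<close>

lemma distr_W:
  assumes S: "finite S" "S \<subseteq> E"
  shows "distr M (\<Pi>\<^sub>M e\<in>S. borel) (\<lambda>\<omega>. \<lambda>e\<in>S. W e \<omega>) = (\<Pi>\<^sub>M e\<in>S. std_normal_distribution)"
proof -
  interpret P: product_prob_space "\<lambda>_::'h. std_normal_distribution"
    by (auto simp: product_prob_space_def product_prob_space_axioms_def product_sigma_finite_def
        prob_space_normal_density intro!: prob_space_imp_sigma_finite)
  have m [measurable]: "(\<lambda>\<omega>. \<lambda>e\<in>S. W e \<omega>) \<in> M \<rightarrow>\<^sub>M (\<Pi>\<^sub>M e\<in>S. borel)"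
    by (rule measurable_restrict) (use S in auto)
  show ?thesis
  proof (rule P.PiM_eqI[OF S(1)])
    show "sets (distr M (\<Pi>\<^sub>M e\<in>S. borel) (\<lambda>\<omega>. \<lambda>e\<in>S. W e \<omega>)) = sets (\<Pi>\<^sub>M e\<in>S. std_normal_distribution)"
      by (simp cong: sets_PiM_cong)
    fix A assume "\<And>e. e \<in> S \<Longrightarrow> A e \<in> sets std_normal_distribution"
    then have A [measurable]: "\<And>e. e \<in> S \<Longrightarrow> A e \<in> sets borel" by simp
    have AP: "Pi\<^sub>E S A \<in> sets (\<Pi>\<^sub>M e\<in>S. borel)" using S A by (intro sets_PiM_I_finite) auto
    let ?B = "(\<lambda>\<omega>. \<lambda>e\<in>S. W e \<omega>) -` Pi\<^sub>E S A \<inter> space M"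
    have Bm: "?B \<in> sets M" using AP by measurable
    have "complex_of_real (\<integral>\<omega>. indicator ?B \<omega> \<partial>M) =
        complex_of_real (\<integral>\<omega>. (\<Prod>e\<in>S. indicator (A e) (W e \<omega>)) \<partial>M)"
    proof (intro arg_cong[where f = complex_of_real] Bochner_Integration.integral_cong refl)
      fix \<omega> assume "\<omega> \<in> space M"
      then show "indicat_real ?B \<omega> = (\<Prod>e\<in>S. indicator (A e) (W e \<omega>))"
        using S by (auto simp: indicator_def PiE_iff prod_zero_iff)
    qed
    also have "\<dots> = complex_of_real (\<Prod>e\<in>S. measure std_normal_distribution (A e))"
      using indicator_iexp_expectation[of S "{}" A] S A by (simp del: of_real_prod)
    finally have "measure M ?B = (\<Prod>e\<in>S. measure std_normal_distribution (A e))"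
      using Bm by (simp del: of_real_prod)
    then have "emeasure M ?B = (\<Prod>e\<in>S. emeasure std_normal_distribution (A e))"
      by (simp add: emeasure_eq_measure P.M.emeasure_eq_measure prod_ennreal)
    then show "emeasure (distr M (\<Pi>\<^sub>M e\<in>S. borel) (\<lambda>\<omega>. \<lambda>e\<in>S. W e \<omega>)) (Pi\<^sub>E S A) =
        (\<Prod>e\<in>S. emeasure std_normal_distribution (A e))"
      by (subst emeasure_distr[OF m AP])
  qed
qed

end

subsection \<open>Products of Hermite polynomials\<close>

text \<open>Multisets of basis vectors serve as multi-indices.\<close>

definition hermite_prod :: "'h multiset \<Rightarrow> ('h \<Rightarrow> real) \<Rightarrow> real" where
  "hermite_prod \<alpha> v = (\<Prod>e\<in>set_mset \<alpha>. hermite (count \<alpha> e) (v e))"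

text \<open>The factorial of a multi-index. It turns out to be the second moment of the
  corresponding Hermite product.\<close>

definition mset_fact :: "'h multiset \<Rightarrow> real" where
  "mset_fact \<alpha> = (\<Prod>e\<in>set_mset \<alpha>. fact (count \<alpha> e))"

lemma hermite_prod_superset:
  assumes "finite S" "set_mset \<alpha> \<subseteq> S"
  shows "hermite_prod \<alpha> v = (\<Prod>e\<in>S. hermite (count \<alpha> e) (v e))"
  unfolding hermite_prod_def using assms
  by (intro prod.mono_neutral_left) (auto simp: not_in_iff)

lemma mset_fact_superset:
  assumes "finite S" "set_mset \<alpha> \<subseteq> S"
  shows "mset_fact \<alpha> = (\<Prod>e\<in>S. fact (count \<alpha> e))"
  unfolding mset_fact_def using assms
  by (intro prod.mono_neutral_left) (auto simp: not_in_iff)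

lemma mset_fact_pos: "mset_fact \<alpha> > 0"
  unfolding mset_fact_def by (intro prod_pos) auto

text \<open>This includes the case that e does not occur in \<alpha>, where the split-off factor has
  degree 0 and equals 1. The other factor is constant in the coordinate e.\<close>

lemma hermite_prod_split:
  "hermite_prod \<alpha> v = hermite (count \<alpha> e) (v e) * hermite_prod (filter_mset (\<lambda>x. x \<noteq> e) \<alpha>) v"
proof -
  have "hermite_prod \<alpha> v = (\<Prod>x\<in>insert e (set_mset \<alpha>). hermite (count \<alpha> x) (v x))"
    by (rule hermite_prod_superset) auto
  also have "\<dots> = hermite (count \<alpha> e) (v e) * (\<Prod>x\<in>set_mset \<alpha> - {e}. hermite (count \<alpha> x) (v x))"
    by (rule prod.insert_remove) simp
  also have "(\<Prod>x\<in>set_mset \<alpha> - {e}. hermite (count \<alpha> x) (v x)) =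
      hermite_prod (filter_mset (\<lambda>x. x \<noteq> e) \<alpha>) v"
    unfolding hermite_prod_def by (intro prod.cong) auto
  finally show ?thesis .
qed

lemma filter_mset_neq_remove: "filter_mset (\<lambda>x. x \<noteq> e) (\<alpha> - {#e#}) = filter_mset (\<lambda>x. x \<noteq> e) \<alpha>"
  by (rule multiset_eqI) simp

lemma hermite_prod_remove_split:
  "hermite_prod (\<alpha> - {#e#}) v =
    hermite (count \<alpha> e - 1) (v e) * hermite_prod (filter_mset (\<lambda>x. x \<noteq> e) \<alpha>) v"
  using hermite_prod_split[of "\<alpha> - {#e#}" v e] by (simp add: filter_mset_neq_remove)

lemma hermite_prod_cong:
  "(\<And>e. e \<in># \<alpha> \<Longrightarrow> v e = w e) \<Longrightarrow> hermite_prod \<alpha> v = hermite_prod \<alpha> w"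
  unfolding hermite_prod_def by (intro prod.cong) auto

lemma hermite_prod_filter_upd [simp]:
  "hermite_prod (filter_mset (\<lambda>x. x \<noteq> e) \<alpha>) (v(e := y)) = hermite_prod (filter_mset (\<lambda>x. x \<noteq> e) \<alpha>) v"
  by (rule hermite_prod_cong) auto

lemma hermite_prod_has_real_derivative:
  "((\<lambda>y. hermite_prod \<alpha> (v(e := y))) has_real_derivative
    real (count \<alpha> e) * hermite_prod (\<alpha> - {#e#}) (v(e := y))) (at y)"
  unfolding hermite_prod_split[of \<alpha> _ e] hermite_prod_remove_split
  by (auto intro!: derivative_eq_intros hermite_has_real_derivative)

lemma continuous_on_hermite_prod_upd:
  "continuous_on S (\<lambda>y. hermite_prod \<alpha> (v(e := y)))"
  using hermite_prod_has_real_derivative[of \<alpha> v e]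
  by (meson DERIV_isCont continuous_at_imp_continuous_on)

lemma mset_fact_add_mset: "mset_fact (add_mset e \<alpha>) = real (Suc (count \<alpha> e)) * mset_fact \<alpha>"
proof -
  let ?S = "insert e (set_mset \<alpha>)"
  have "mset_fact (add_mset e \<alpha>) = (\<Prod>x\<in>?S. fact (count (add_mset e \<alpha>) x))"
    by (rule mset_fact_superset) auto
  also have "\<dots> = fact (Suc (count \<alpha> e)) * (\<Prod>x\<in>?S - {e}. fact (count (add_mset e \<alpha>) x))"
    by (subst prod.remove[of _ e]) auto
  also have "(\<Prod>x\<in>?S - {e}. fact (count (add_mset e \<alpha>) x)) = (\<Prod>x\<in>?S - {e}. fact (count \<alpha> x) :: real)"
    by (intro prod.cong) auto
  also have "fact (Suc (count \<alpha> e)) * (\<Prod>x\<in>?S - {e}. fact (count \<alpha> x)) =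
      real (Suc (count \<alpha> e)) * (\<Prod>x\<in>?S. fact (count \<alpha> x))"
    by (subst prod.remove[of ?S e]) (auto simp: algebra_simps)
  also have "(\<Prod>x\<in>?S. fact (count \<alpha> x)) = mset_fact \<alpha>"
    by (rule mset_fact_superset[symmetric]) auto
  finally show ?thesis .
qed

context gaussian_family
begin

text \<open>Fubini freezes the coordinates in S, and the one-dimensional formula acts on coordinate
  e. The hypotheses \<open>loc\<close> bridge a gap of types: the product measure lives on functions
  that are undefined off \<open>insert e S\<close>, whereas \<open>\<lambda>i. W i \<omega>\<close>
  has values everywhere.\<close>

lemma integration_by_parts_coord:
  fixes F F' :: "('h \<Rightarrow> real) \<Rightarrow> real"
  assumes S: "finite S" "S \<subseteq> E" "e \<in> E" "e \<notin> S"
    and F [measurable]: "F \<in> borel_measurable (\<Pi>\<^sub>M i\<in>insert e S. borel)"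
    and F' [measurable]: "F' \<in> borel_measurable (\<Pi>\<^sub>M i\<in>insert e S. borel)"
    and deriv: "\<And>v y. ((\<lambda>y. F (v(e := y))) has_real_derivative F' (v(e := y))) (at y)"
    and cont: "\<And>v. continuous_on UNIV (\<lambda>y. F' (v(e := y)))"
    and loc: "\<And>v. F (restrict v (insert e S)) = F v" "\<And>v. F' (restrict v (insert e S)) = F' v"
    and int: "integrable M (\<lambda>\<omega>. F (\<lambda>i. W i \<omega>) * hermite (Suc k) (W e \<omega>))"
      "integrable M (\<lambda>\<omega>. F (\<lambda>i. W i \<omega>) * hermite k (W e \<omega>))"
      "integrable M (\<lambda>\<omega>. F' (\<lambda>i. W i \<omega>) * hermite k (W e \<omega>))"
  shows "(\<integral>\<omega>. F (\<lambda>i. W i \<omega>) * hermite (Suc k) (W e \<omega>) \<partial>M) =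
    (\<integral>\<omega>. F' (\<lambda>i. W i \<omega>) * hermite k (W e \<omega>) \<partial>M)"
proof -
  let ?\<gamma> = "std_normal_distribution"
  let ?S = "insert e S"
  let ?P = "\<Pi>\<^sub>M i\<in>S. ?\<gamma>"
  let ?PS = "\<Pi>\<^sub>M i\<in>?S. ?\<gamma>"
  let ?\<xi> = "\<lambda>\<omega>. \<lambda>i\<in>?S. W i \<omega>"
  interpret g: prob_space ?\<gamma> by (rule prob_space_normal_density) simp
  interpret P: product_prob_space "\<lambda>_::'h. ?\<gamma>" S
    by (auto simp: product_prob_space_def product_prob_space_axioms_def product_sigma_finite_def
        prob_space_normal_density intro!: prob_space_imp_sigma_finite)
  interpret PS: pair_sigma_finite ?\<gamma> ?P
    by (simp add: pair_sigma_finite_def prob_space_imp_sigma_finite g.prob_space_axioms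
        P.prob_space_axioms)
  have sets_eq: "sets ?PS = sets (\<Pi>\<^sub>M i\<in>?S. borel)" by (intro sets_PiM_cong) auto
  have \<xi> [measurable]: "?\<xi> \<in> M \<rightarrow>\<^sub>M (\<Pi>\<^sub>M i\<in>?S. borel)"
    by (rule measurable_restrict) (use S in auto)
  have d: "distr M (\<Pi>\<^sub>M i\<in>?S. borel) ?\<xi> = ?PS" using distr_W[of ?S] S by simp
  have upd [measurable]: "(\<lambda>(y, v). v(e := y)) \<in> ?\<gamma> \<Otimes>\<^sub>M ?P \<rightarrow>\<^sub>M (\<Pi>\<^sub>M i\<in>?S. borel)"
  proof -
    have "(\<lambda>(y, v). v(e := y)) \<in> ?\<gamma> \<Otimes>\<^sub>M ?P \<rightarrow>\<^sub>M ?PS" by measurable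
    then show ?thesis using sets_eq measurable_cong_sets by blast
  qed
  have d2: "distr (?\<gamma> \<Otimes>\<^sub>M ?P) (\<Pi>\<^sub>M i\<in>?S. borel) (\<lambda>(y, v). v(e := y)) = ?PS"
  proof -
    have "distr (?\<gamma> \<Otimes>\<^sub>M ?P) ?PS (\<lambda>(y, v). v(e := y)) = ?PS"
      by (rule distr_pair_PiM_eq_PiM) (auto intro: g.prob_space_axioms)
    then show ?thesis by (simp cong: distr_cong add: sets_eq)
  qed
  \<comment> \<open>Two changes of variables: from M to the product law on
    \<open>insert e S\<close>, and from there to the pair formed by coordinate e and the remaining
    ones.\<close>
  have transfer: "integrable (?\<gamma> \<Otimes>\<^sub>M ?P) (\<lambda>(y, v). A (v(e := y)) * hermite n y)"
    "(\<integral>\<omega>. A (\<lambda>i. W i \<omega>) * hermite n (W e \<omega>) \<partial>M) = (\<integral>v. (\<integral>y. A (v(e := y)) * hermite n y \<partial>?\<gamma>) \<partial>?P)"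
    if A [measurable]: "A \<in> borel_measurable (\<Pi>\<^sub>M i\<in>?S. borel)"
      and loc: "\<And>v. A (restrict v ?S) = A v"
      and int: "integrable M (\<lambda>\<omega>. A (\<lambda>i. W i \<omega>) * hermite n (W e \<omega>))" for A n
  proof -
    let ?B = "\<lambda>v. A v * hermite n (v e)"
    have ce: "(\<lambda>v. v e) \<in> borel_measurable (\<Pi>\<^sub>M i\<in>?S. borel)"
      by (rule measurable_component_singleton) simp
    have B [measurable]: "?B \<in> borel_measurable (\<Pi>\<^sub>M i\<in>?S. borel)"
      using ce by measurable
    have "integrable (distr M (\<Pi>\<^sub>M i\<in>?S. borel) ?\<xi>) ?B"
      using int by (subst integrable_distr_eq[OF \<xi> B]) (simp add: loc)
    then have iB: "integrable ?PS ?B" by (simp add: d)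
    then have "integrable (distr (?\<gamma> \<Otimes>\<^sub>M ?P) (\<Pi>\<^sub>M i\<in>?S. borel) (\<lambda>(y, v). v(e := y))) ?B"
      by (simp add: d2)
    then show i: "integrable (?\<gamma> \<Otimes>\<^sub>M ?P) (\<lambda>(y, v). A (v(e := y)) * hermite n y)"
      by (subst (asm) integrable_distr_eq[OF upd B]) (simp add: case_prod_unfold)
    have "(\<integral>\<omega>. A (\<lambda>i. W i \<omega>) * hermite n (W e \<omega>) \<partial>M) = (\<integral>v. ?B v \<partial>?PS)"
      unfolding d[symmetric] by (subst integral_distr[OF \<xi> B]) (simp add: loc)
    also have "\<dots> = (\<integral>(y, v). A (v(e := y)) * hermite n y \<partial>(?\<gamma> \<Otimes>\<^sub>M ?P))"
      unfolding d2[symmetric] by (subst integral_distr[OF upd B]) (simp add: case_prod_unfold)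
    also have "\<dots> = (\<integral>v. (\<integral>y. A (v(e := y)) * hermite n y \<partial>?\<gamma>) \<partial>?P)"
      by (rule PS.integral_snd[OF i, symmetric])
    finally show "(\<integral>\<omega>. A (\<lambda>i. W i \<omega>) * hermite n (W e \<omega>) \<partial>M) =
        (\<integral>v. (\<integral>y. A (v(e := y)) * hermite n y \<partial>?\<gamma>) \<partial>?P)" .
  qed
  note t1 = transfer[OF F loc(1) int(1)] and t2 = transfer[OF F loc(1) int(2)]
    and t3 = transfer[OF F' loc(2) int(3)]
  have "AE v in ?P. (\<integral>y. F (v(e := y)) * hermite (Suc k) y \<partial>?\<gamma>) =
      (\<integral>y. F' (v(e := y)) * hermite k y \<partial>?\<gamma>)"
    using PS.AE_integrable_snd[OF t1(1)] PS.AE_integrable_snd[OF t2(1)] PS.AE_integrable_snd[OF t3(1)]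
    by eventually_elim (rule hermite_integration_by_parts[OF deriv cont])
  then have "(\<integral>v. (\<integral>y. F (v(e := y)) * hermite (Suc k) y \<partial>?\<gamma>) \<partial>?P) =
      (\<integral>v. (\<integral>y. F' (v(e := y)) * hermite k y \<partial>?\<gamma>) \<partial>?P)"
    using PS.integrable_snd[OF t1(1)] PS.integrable_snd[OF t3(1)]
    by (intro integral_cong_AE) auto
  then show ?thesis by (simp only: t1(2) t3(2))
qed

definition herm :: "'h multiset \<Rightarrow> 'w \<Rightarrow> real" where
  "herm \<alpha> \<omega> = hermite_prod \<alpha> (\<lambda>e. W e \<omega>)"

lemma borel_measurable_herm [measurable]: "set_mset \<alpha> \<subseteq> E \<Longrightarrow> herm \<alpha> \<in> borel_measurable M"
  unfolding herm_def[abs_def] hermite_prod_def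
  by (intro borel_measurable_prod measurable_compose[OF W_measurable borel_measurable_hermite]) auto

lemma integrable_herm_square:
  assumes "set_mset \<alpha> \<subseteq> E"
  shows "integrable M (\<lambda>\<omega>. (herm \<alpha> \<omega>)\<^sup>2)"
proof -
  let ?S = "set_mset \<alpha>"
  let ?\<xi> = "\<lambda>\<omega>. \<lambda>i\<in>?S. W i \<omega>"
  interpret P: product_prob_space "\<lambda>_::'h. std_normal_distribution" ?S
    by (auto simp: product_prob_space_def product_prob_space_axioms_def product_sigma_finite_def
        prob_space_normal_density intro!: prob_space_imp_sigma_finite)
  have \<xi> [measurable]: "?\<xi> \<in> M \<rightarrow>\<^sub>M (\<Pi>\<^sub>M i\<in>?S. borel)"
    by (rule measurable_restrict) (use assms in auto)
  let ?B = "\<lambda>v::'h \<Rightarrow> real. \<Prod>i\<in>?S. hermite (count \<alpha> i) (v i) * hermite (count \<alpha> i) (v i)"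
  have B: "?B \<in> borel_measurable (\<Pi>\<^sub>M i\<in>?S. borel)"
    by measurable
  have "integrable (\<Pi>\<^sub>M i\<in>?S. std_normal_distribution) ?B"
    by (intro P.product_integrable_prod integrable_hermite_mult) simp
  then have "integrable (distr M (\<Pi>\<^sub>M i\<in>?S. borel) ?\<xi>) ?B"
    using distr_W[of ?S] assms by simp
  then show ?thesis
    by (subst (asm) integrable_distr_eq[OF \<xi> B])
      (simp add: herm_def hermite_prod_def power2_eq_square prod.distrib)
qed

end

subsection \<open>Square-integrable random variables and chaos coefficients\<close>

definition square_integrable :: "'a measure \<Rightarrow> ('a \<Rightarrow> real) \<Rightarrow> bool" where
  "square_integrable M f \<longleftrightarrow> f \<in> borel_measurable M \<and> integrable M (\<lambda>x. (f x)\<^sup>2)"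

lemma square_integrable_measurable [measurable_dest]:
  "square_integrable M f \<Longrightarrow> f \<in> borel_measurable M"
  by (simp add: square_integrable_def)

lemma square_integrable_mult_integrable:
  assumes "square_integrable M f" "square_integrable M g"
  shows "integrable M (\<lambda>x. f x * g x)"
proof (rule Bochner_Integration.integrable_bound)
  show "integrable M (\<lambda>x. (f x)\<^sup>2 + (g x)\<^sup>2)"
    using assms by (simp add: square_integrable_def)
  show "(\<lambda>x. f x * g x) \<in> borel_measurable M"
    using assms by (auto simp: square_integrable_def)
  have "\<bar>x * y\<bar> \<le> x\<^sup>2 + y\<^sup>2" for x y :: real
  proof -
    have "2 * (\<bar>x\<bar> * \<bar>y\<bar>) \<le> \<bar>x\<bar>\<^sup>2 + \<bar>y\<bar>\<^sup>2" using sum_squares_bound[of "\<bar>x\<bar>" "\<bar>y\<bar>"] by simp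
    moreover have "0 \<le> \<bar>x\<bar> * \<bar>y\<bar>" by simp
    ultimately have "\<bar>x\<bar> * \<bar>y\<bar> \<le> x\<^sup>2 + y\<^sup>2" unfolding power2_abs by linarith
    then show ?thesis by (simp add: abs_mult)
  qed
  then show "AE x in M. norm (f x * g x) \<le> norm ((f x)\<^sup>2 + (g x)\<^sup>2)" by auto
qed

lemma square_integrable_add:
  assumes "square_integrable M f" "square_integrable M g"
  shows "square_integrable M (\<lambda>x. f x + g x)"
proof -
  have "integrable M (\<lambda>x. (f x)\<^sup>2 + (g x)\<^sup>2 + 2 * (f x * g x))"
    using assms square_integrable_mult_integrable[OF assms] by (auto simp: square_integrable_def)
  then show ?thesis
    using assms by (auto simp: square_integrable_def power2_sum mult.assoc)
qed

lemma square_integrable_cmult: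
  "square_integrable M f \<Longrightarrow> square_integrable M (\<lambda>x. c * f x)"
  by (auto simp: square_integrable_def power_mult_distrib)

lemma square_integrable_zero [simp]: "square_integrable M (\<lambda>x. 0)"
  by (auto simp: square_integrable_def)

lemma square_integrable_diff:
  assumes "square_integrable M f" "square_integrable M g"
  shows "square_integrable M (\<lambda>x. f x - g x)"
  using square_integrable_add[OF assms(1) square_integrable_cmult[OF assms(2), of "-1"]] by simp

lemma square_integrable_sum:
  "(\<And>i. i \<in> I \<Longrightarrow> square_integrable M (f i)) \<Longrightarrow> square_integrable M (\<lambda>x. \<Sum>i\<in>I. f i x)"
  by (induction I rule: infinite_finite_induct) (auto intro: square_integrable_add)

lemma square_integrable_bounded_mult:
  assumes f: "square_integrable M f" and [measurable]: "g \<in> borel_measurable M"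
    and g: "\<And>x. \<bar>g x\<bar> \<le> C"
  shows "square_integrable M (\<lambda>x. g x * f x)"
proof -
  have [measurable]: "f \<in> borel_measurable M" using f by measurable
  have "integrable M (\<lambda>x. C\<^sup>2 * (f x)\<^sup>2)" using f by (auto simp: square_integrable_def)
  then have "integrable M (\<lambda>x. (g x * f x)\<^sup>2)"
  proof (rule Bochner_Integration.integrable_bound)
    have "(g x)\<^sup>2 \<le> C\<^sup>2" for x using g[of x] by (metis abs_ge_zero power2_abs power_mono)
    then show "AE x in M. norm ((g x * f x)\<^sup>2) \<le> norm (C\<^sup>2 * (f x)\<^sup>2)"
      by (auto simp: power_mult_distrib intro!: mult_right_mono)
  qed measurable
  then show ?thesis by (auto simp: square_integrable_def)
qed

lemma integral_Cauchy_Schwarz: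
  assumes f: "square_integrable M f" and g: "square_integrable M g"
  shows "(\<integral>x. f x * g x \<partial>M)\<^sup>2 \<le> (\<integral>x. (f x)\<^sup>2 \<partial>M) * (\<integral>x. (g x)\<^sup>2 \<partial>M)"
proof -
  define a b c where "a = (\<integral>x. (f x)\<^sup>2 \<partial>M)" and "b = (\<integral>x. f x * g x \<partial>M)" and "c = (\<integral>x. (g x)\<^sup>2 \<partial>M)"
  have i: "integrable M (\<lambda>x. (f x)\<^sup>2)" "integrable M (\<lambda>x. (g x)\<^sup>2)" "integrable M (\<lambda>x. f x * g x)"
    using f g square_integrable_mult_integrable[OF f g] by (auto simp: square_integrable_def)
  have q: "0 \<le> s\<^sup>2 * a - 2 * s * t * b + t\<^sup>2 * c" for s t
  proof -
    have "0 \<le> (\<integral>x. (s * f x - t * g x)\<^sup>2 \<partial>M)" by simp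
    also have "\<dots> = (\<integral>x. s\<^sup>2 * (f x)\<^sup>2 - (2 * s * t) * (f x * g x) + t\<^sup>2 * (g x)\<^sup>2 \<partial>M)"
      by (intro Bochner_Integration.integral_cong) (auto simp: power2_eq_square algebra_simps)
    also have "\<dots> = s\<^sup>2 * a - 2 * s * t * b + t\<^sup>2 * c"
      using i by (simp add: a_def b_def c_def)
    finally show ?thesis .
  qed
  have a0: "a \<ge> 0" and c0: "c \<ge> 0" by (auto simp: a_def c_def)
  have "b\<^sup>2 \<le> a * c"
  proof (cases "c = 0")
    case True
    \<comment> \<open>For c = 0 the quadratic form at s = b, t = a + 1 equals - b * b * (a + 2),
      which forces b = 0.\<close>
    have "2 * b * b * (a + 1) \<le> b * b * a"
      using q[of b "a + 1"] True by (simp add: power2_eq_square algebra_simps)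
    then have "b * b * (a + 2) \<le> 0" by (simp add: algebra_simps)
    then have "b = 0" using a0 by (auto simp: mult_le_0_iff zero_le_mult_iff not_le)
    then show ?thesis using True by simp
  next
    case False
    \<comment> \<open>At s = c, t = b the form equals c times the difference of a * c and the square
      of b.\<close>
    have "c * (b\<^sup>2) \<le> c * (a * c)" using q[of c b] by (simp add: power2_eq_square algebra_simps)
    then show ?thesis using False c0 by simp
  qed
  then show ?thesis by (simp add: a_def b_def c_def)
qed

lemma tendsto_integral_mult:
  assumes f: "\<forall>\<^sub>F i in A. square_integrable M (f i)"
    and F: "square_integrable M F" and g: "square_integrable M g"
    and lim: "((\<lambda>i. \<integral>x. (f i x - F x)\<^sup>2 \<partial>M) \<longlongrightarrow> 0) A"
  shows "((\<lambda>i. \<integral>x. f i x * g x \<partial>M) \<longlongrightarrow> (\<integral>x. F x * g x \<partial>M)) A"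
proof -
  have "((\<lambda>i. (\<integral>x. (f i x - F x) * g x \<partial>M)\<^sup>2) \<longlongrightarrow> 0) A"
  proof (rule tendsto_sandwich[OF _ _ tendsto_const])
    show "((\<lambda>i. (\<integral>x. (f i x - F x)\<^sup>2 \<partial>M) * (\<integral>x. (g x)\<^sup>2 \<partial>M)) \<longlongrightarrow> 0) A"
      using tendsto_mult_right[OF lim] by simp
    show "\<forall>\<^sub>F i in A. (\<integral>x. (f i x - F x) * g x \<partial>M)\<^sup>2 \<le>
        (\<integral>x. (f i x - F x)\<^sup>2 \<partial>M) * (\<integral>x. (g x)\<^sup>2 \<partial>M)"
      using f by eventually_elim (intro integral_Cauchy_Schwarz square_integrable_diff F g)
  qed simp
  then have "((\<lambda>i. (\<integral>x. (f i x - F x) * g x \<partial>M)) \<longlongrightarrow> 0) A"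
    by (metis (no_types, lifting) ext power_zero_numeral real_sqrt_abs tendsto_rabs_zero_iff tendsto_real_sqrt real_sqrt_zero)
  then have "((\<lambda>i. (\<integral>x. (f i x - F x) * g x \<partial>M) + (\<integral>x. F x * g x \<partial>M)) \<longlongrightarrow> 0 + (\<integral>x. F x * g x \<partial>M)) A"
    by (intro tendsto_intros)
  then have "((\<lambda>i. (\<integral>x. (f i x - F x) * g x \<partial>M) + (\<integral>x. F x * g x \<partial>M)) \<longlongrightarrow> (\<integral>x. F x * g x \<partial>M)) A"
    by simp
  moreover have "\<forall>\<^sub>F i in A. (\<integral>x. (f i x - F x) * g x \<partial>M) + (\<integral>x. F x * g x \<partial>M) = (\<integral>x. f i x * g x \<partial>M)"
    using f
  proof eventually_elim
    case (elim i)
    show ?case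
      using square_integrable_mult_integrable[OF elim g] square_integrable_mult_integrable[OF F g]
      by (simp add: left_diff_distrib)
  qed
  ultimately show ?thesis by (rule Lim_transform_eventually)
qed

text \<open>\<open>L2_lim\<close> does not presuppose a square-integrable limit. One approximant at
  finite mean-square distance from Y is enough, and afterwards the nonnegative integrals can be
  replaced by Bochner integrals.\<close>

lemma L2_lim_square_integrable:
  fixes Y :: "'a \<Rightarrow> real"
  assumes lim: "L2_lim M Ys Y F" and "F \<noteq> bot" and Ys: "\<forall>\<^sub>F i in F. square_integrable M (Ys i)"
  shows "square_integrable M Y" "((\<lambda>i. \<integral>x. (Ys i x - Y x)\<^sup>2 \<partial>M) \<longlongrightarrow> 0) F"
proof -
  have [measurable]: "\<And>i. Ys i \<in> borel_measurable M" "Y \<in> borel_measurable M"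
    and l: "((\<lambda>i. \<integral>\<^sup>+x. ennreal ((Ys i x - Y x)\<^sup>2) \<partial>M) \<longlongrightarrow> 0) F"
    using lim by (auto simp: L2_lim_def)
  have "\<forall>\<^sub>F i in F. (\<integral>\<^sup>+x. ennreal ((Ys i x - Y x)\<^sup>2) \<partial>M) < 1"
    using order_tendstoD(2)[OF l] by simp
  then obtain i where "(\<integral>\<^sup>+x. ennreal ((Ys i x - Y x)\<^sup>2) \<partial>M) < 1" and i: "square_integrable M (Ys i)"
    using eventually_happens'[OF \<open>F \<noteq> bot\<close> eventually_conj[OF _ Ys]] by blast
  then have "integrable M (\<lambda>x. (Ys i x - Y x)\<^sup>2)"
    by (intro integrableI_bounded) (auto intro: less_trans)
  then have "square_integrable M (\<lambda>x. Ys i x - Y x)" by (simp add: square_integrable_def)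
  then show Y: "square_integrable M Y"
    using square_integrable_diff[OF i] by force
  have "\<forall>\<^sub>F i in F. (\<integral>\<^sup>+x. ennreal ((Ys i x - Y x)\<^sup>2) \<partial>M) = ennreal (\<integral>x. (Ys i x - Y x)\<^sup>2 \<partial>M)"
    using Ys
  proof eventually_elim
    case (elim i)
    show ?case using square_integrable_diff[OF elim Y]
      by (intro nn_integral_eq_integral) (auto simp: square_integrable_def)
  qed
  with l have "((\<lambda>i. ennreal (\<integral>x. (Ys i x - Y x)\<^sup>2 \<partial>M)) \<longlongrightarrow> ennreal 0) F"
    by (auto intro: Lim_transform_eventually)
  then show "((\<lambda>i. \<integral>x. (Ys i x - Y x)\<^sup>2 \<partial>M) \<longlongrightarrow> 0) F"
    by (subst (asm) tendsto_ennreal_iff) auto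
qed

section \<open>Gaussian integration by parts for Hermite products, and their orthogonality\<close>

context gaussian_family
begin

lemma square_integrable_herm: "set_mset \<alpha> \<subseteq> E \<Longrightarrow> square_integrable M (herm \<alpha>)"
  by (simp add: square_integrable_def integrable_herm_square)

lemma herm_empty [simp]: "herm {#} \<omega> = 1"
  by (simp add: herm_def hermite_prod_def)

lemma remove_subset: "set_mset \<alpha> \<subseteq> E \<Longrightarrow> set_mset (\<alpha> - {#e#}) \<subseteq> E"
  by (auto dest: in_diffD)

text \<open>The factor of \<open>herm \<alpha>\<close> in direction e is split off as
  \<open>hermite (Suc k)\<close>. What remains of \<open>herm \<alpha>\<close> is constant in that
  coordinate and joins \<open>\<phi> (P \<omega>)\<close> in the function \<open>F\<close> to be
  differentiated; \<open>dP\<close> is the partial derivative of \<open>P\<close>.\<close>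

lemma herm_integration_by_parts:
  fixes \<phi> \<psi> :: "real \<Rightarrow> real" and e :: 'h and T :: "'h multiset set" and c :: "'h multiset \<Rightarrow> real"
  defines "P \<equiv> \<lambda>\<omega>. \<Sum>\<beta>\<in>T. c \<beta> * herm \<beta> \<omega>"
    and "dP \<equiv> \<lambda>\<omega>. \<Sum>\<beta>\<in>T. c \<beta> * (real (count \<beta> e) * herm (\<beta> - {#e#}) \<omega>)"
  assumes T: "finite T" "\<And>\<beta>. \<beta> \<in> T \<Longrightarrow> set_mset \<beta> \<subseteq> E"
    and \<alpha>: "set_mset \<alpha> \<subseteq> E" "e \<in># \<alpha>"
    and deriv: "\<And>x. (\<phi> has_real_derivative \<psi> x) (at x)" and cont: "continuous_on UNIV \<psi>"
    and int: "integrable M (\<lambda>\<omega>. \<phi> (P \<omega>) * herm \<alpha> \<omega>)"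
      "integrable M (\<lambda>\<omega>. \<phi> (P \<omega>) * herm (\<alpha> - {#e#}) \<omega>)"
      "integrable M (\<lambda>\<omega>. \<psi> (P \<omega>) * dP \<omega> * herm (\<alpha> - {#e#}) \<omega>)"
  shows "(\<integral>\<omega>. \<phi> (P \<omega>) * herm \<alpha> \<omega> \<partial>M) = (\<integral>\<omega>. \<psi> (P \<omega>) * dP \<omega> * herm (\<alpha> - {#e#}) \<omega> \<partial>M)"
proof -
  define S where "S = ((\<Union>\<beta>\<in>T. set_mset \<beta>) \<union> set_mset \<alpha>) - {e}"
  have S: "finite S" "S \<subseteq> E" "e \<in> E" "e \<notin> S" using T \<alpha> by (auto simp: S_def)
  have sub: "set_mset \<beta> \<subseteq> insert e S" if "\<beta> \<in> T" for \<beta> using that by (auto simp: S_def)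
  have sub': "set_mset (\<beta> - {#e#}) \<subseteq> insert e S" if "\<beta> \<in> T" for \<beta>
    using sub[OF that] by (auto dest: in_diffD)
  let ?\<alpha> = "filter_mset (\<lambda>x. x \<noteq> e) \<alpha>"
  have sub\<alpha>: "set_mset ?\<alpha> \<subseteq> insert e S" by (auto simp: S_def)
  define Q where "Q v = (\<Sum>\<beta>\<in>T. c \<beta> * hermite_prod \<beta> v)" for v
  define dQ where "dQ v = (\<Sum>\<beta>\<in>T. c \<beta> * (real (count \<beta> e) * hermite_prod (\<beta> - {#e#}) v))" for v
  define F where "F v = \<phi> (Q v) * hermite_prod ?\<alpha> v" for v
  define F' where "F' v = \<psi> (Q v) * dQ v * hermite_prod ?\<alpha> v" for v
  obtain k where k: "count \<alpha> e = Suc k" using \<alpha>(2) by (metis count_eq_zero_iff not0_implies_Suc)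
  have c\<phi>: "continuous_on UNIV \<phi>" using deriv by (meson DERIV_isCont continuous_at_imp_continuous_on)
  have [measurable]: "\<phi> \<in> borel_measurable borel" "\<psi> \<in> borel_measurable borel"
    using cont c\<phi> by (auto intro: borel_measurable_continuous_onI)
  have comp: "(\<lambda>v::'h \<Rightarrow> real. hermite n (v i)) \<in> borel_measurable (\<Pi>\<^sub>M i\<in>insert e S. borel)"
    if "i \<in> insert e S" for i n
  proof -
    have [measurable]: "(\<lambda>v::'h \<Rightarrow> real. v i) \<in> borel_measurable (\<Pi>\<^sub>M i\<in>insert e S. borel)"
      using that by (rule measurable_component_singleton)
    show ?thesis by measurable
  qed
  have hm: "hermite_prod \<beta> \<in> borel_measurable (\<Pi>\<^sub>M i\<in>insert e S. borel)"
    if "set_mset \<beta> \<subseteq> insert e S" for \<beta>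
    unfolding hermite_prod_def[abs_def]
    by (intro borel_measurable_prod comp) (use that in auto)
  have hr: "hermite_prod \<beta> (restrict v (insert e S)) = hermite_prod \<beta> v"
    if "set_mset \<beta> \<subseteq> insert e S" for \<beta> v
    by (rule hermite_prod_cong) (use that in auto)
  have [measurable]: "Q \<in> borel_measurable (\<Pi>\<^sub>M i\<in>insert e S. borel)"
    "dQ \<in> borel_measurable (\<Pi>\<^sub>M i\<in>insert e S. borel)"
    "hermite_prod ?\<alpha> \<in> borel_measurable (\<Pi>\<^sub>M i\<in>insert e S. borel)"
    unfolding Q_def[abs_def] dQ_def[abs_def]
    by (intro borel_measurable_sum borel_measurable_times borel_measurable_const hm sub sub' sub\<alpha>;
        assumption)+
  have dQ: "((\<lambda>y. Q (v(e := y))) has_real_derivative dQ (v(e := y))) (at y)" for v y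
    unfolding Q_def dQ_def
    by (intro DERIV_sum DERIV_cmult hermite_prod_has_real_derivative)
  have cQ: "continuous_on UNIV (\<lambda>y. Q (v(e := y)))" for v
    unfolding Q_def by (intro continuous_intros continuous_on_hermite_prod_upd)
  have PQ: "P \<omega> = Q (\<lambda>i. W i \<omega>)" "dP \<omega> = dQ (\<lambda>i. W i \<omega>)" for \<omega>
    by (auto simp: P_def Q_def dP_def dQ_def herm_def)
  have "(\<integral>\<omega>. F (\<lambda>i. W i \<omega>) * hermite (Suc k) (W e \<omega>) \<partial>M) =
    (\<integral>\<omega>. F' (\<lambda>i. W i \<omega>) * hermite k (W e \<omega>) \<partial>M)"
  proof (rule integration_by_parts_coord[OF S])
    show "((\<lambda>y. F (v(e := y))) has_real_derivative F' (v(e := y))) (at y)" for v y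
      unfolding F_def F'_def hermite_prod_filter_upd
      by (intro DERIV_cmult_right DERIV_chain2[OF deriv dQ])
    show "continuous_on UNIV (\<lambda>y. F' (v(e := y)))" for v
      unfolding F'_def dQ_def
      by (intro continuous_intros continuous_on_hermite_prod_upd continuous_on_compose2[OF cont cQ]) auto
    show "F (restrict v (insert e S)) = F v" for v
      unfolding F_def Q_def by (simp add: hr sub hr[OF sub\<alpha>])
    show "F' (restrict v (insert e S)) = F' v" for v
      unfolding F'_def Q_def dQ_def by (simp add: hr sub sub' hr[OF sub\<alpha>])
  qed (use int in \<open>auto simp: F_def F'_def PQ herm_def hermite_prod_split[of \<alpha> _ e]
        hermite_prod_remove_split[of \<alpha> e] k mult_ac, measurable?\<close>)
  then show ?thesis
    by (simp add: F_def F'_def PQ herm_def hermite_prod_split[of \<alpha> _ e]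
        hermite_prod_remove_split[of \<alpha> e] k mult_ac)
qed

lemma herm_ibp_herm:
  assumes "set_mset \<alpha> \<subseteq> E" "set_mset \<beta> \<subseteq> E" "e \<in># \<alpha>"
  shows "(\<integral>\<omega>. herm \<beta> \<omega> * herm \<alpha> \<omega> \<partial>M) =
    real (count \<beta> e) * (\<integral>\<omega>. herm (\<beta> - {#e#}) \<omega> * herm (\<alpha> - {#e#}) \<omega> \<partial>M)"
proof -
  have i: "integrable M (\<lambda>\<omega>. herm \<gamma> \<omega> * herm \<delta> \<omega>)" if "set_mset \<gamma> \<subseteq> E" "set_mset \<delta> \<subseteq> E" for \<gamma> \<delta>
    using that by (intro square_integrable_mult_integrable square_integrable_herm)
  show ?thesis
    using herm_integration_by_parts[of "{\<beta>}" \<alpha> e "\<lambda>x. x" "\<lambda>_. 1" "\<lambda>_. 1"] assms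
      remove_subset[OF assms(1), of e] remove_subset[OF assms(2), of e] i
    by (simp add: mult.assoc)
qed

text \<open>Integration by parts with the identity for \<phi> lowers both indices by a common e, so
  induction on \<alpha> applies. When \<alpha> is empty and \<beta> is not, the roles are exchanged:
  an e is taken from \<beta>, and its multiplicity in the empty index is 0.\<close>

lemma herm_orthogonal:
  assumes "set_mset \<alpha> \<subseteq> E" "set_mset \<beta> \<subseteq> E"
  shows "(\<integral>\<omega>. herm \<beta> \<omega> * herm \<alpha> \<omega> \<partial>M) = (if \<alpha> = \<beta> then mset_fact \<alpha> else 0)"
  using assms
proof (induction \<alpha> arbitrary: \<beta>)
  case empty
  show ?case
  proof (cases "\<beta> = {#}")
    case True
    then show ?thesis by (simp add: mset_fact_def prob_space)
  next
    case False
    then obtain e where "e \<in># \<beta>" by blast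
    then show ?thesis
      using herm_ibp_herm[of \<beta> "{#}" e] empty False by (simp add: mult.commute)
  qed
next
  case (add e \<alpha>)
  have "(\<integral>\<omega>. herm \<beta> \<omega> * herm (add_mset e \<alpha>) \<omega> \<partial>M) =
      real (count \<beta> e) * (\<integral>\<omega>. herm (\<beta> - {#e#}) \<omega> * herm \<alpha> \<omega> \<partial>M)"
    using herm_ibp_herm[of "add_mset e \<alpha>" \<beta> e] add.prems by simp
  also have "\<dots> = real (count \<beta> e) * (if \<alpha> = \<beta> - {#e#} then mset_fact \<alpha> else 0)"
    using add.IH[of "\<beta> - {#e#}"] add.prems remove_subset[OF add.prems(2)] by simp
  also have "\<dots> = (if add_mset e \<alpha> = \<beta> then mset_fact (add_mset e \<alpha>) else 0)"
  proof (cases "e \<in># \<beta>")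
    case True
    then obtain \<gamma> where "\<beta> = add_mset e \<gamma>" by (metis insert_DiffM)
    then show ?thesis by (auto simp: mset_fact_add_mset)
  next
    case False
    then show ?thesis by (auto simp: not_in_iff)
  qed
  finally show ?case .
qed

end

lemma integral_square_triangle:
  assumes "square_integrable M f" "square_integrable M g" "square_integrable M h"
  shows "(\<integral>x. (f x - g x)\<^sup>2 \<partial>M) \<le> 2 * (\<integral>x. (f x - h x)\<^sup>2 \<partial>M) + 2 * (\<integral>x. (h x - g x)\<^sup>2 \<partial>M)"
proof -
  have i: "integrable M (\<lambda>x. (f x - g x)\<^sup>2)" "integrable M (\<lambda>x. (f x - h x)\<^sup>2)" "integrable M (\<lambda>x. (h x - g x)\<^sup>2)"
    using square_integrable_diff assms by (auto simp: square_integrable_def)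
  have "(\<integral>x. (f x - g x)\<^sup>2 \<partial>M) \<le> (\<integral>x. 2 * (f x - h x)\<^sup>2 + 2 * (h x - g x)\<^sup>2 \<partial>M)"
  proof (rule integral_mono)
    fix x
    have "0 \<le> ((f x - h x) - (h x - g x))\<^sup>2" by simp
    then show "(f x - g x)\<^sup>2 \<le> 2 * (f x - h x)\<^sup>2 + 2 * (h x - g x)\<^sup>2"
      by (simp add: power2_eq_square algebra_simps)
  qed (use i in auto)
  then show ?thesis using i by simp
qed

lemma mset_fact_nonzero: "mset_fact \<alpha> \<noteq> 0"
  using mset_fact_pos[of \<alpha>] by simp

section \<open>Orthogonal projections onto the span of finitely many Hermite products\<close>

context gaussian_family
begin

definition indices :: "'h multiset set" where
  "indices = {\<alpha>. set_mset \<alpha> \<subseteq> E}"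

text \<open>An inner product, not yet divided by the squared norm \<open>mset_fact \<alpha>\<close>;
  unnormalised coefficients make the shift rule for \<open>DX\<close> free of constants.\<close>

definition coef :: "('w \<Rightarrow> real) \<Rightarrow> 'h multiset \<Rightarrow> real" where
  "coef V \<alpha> = (\<integral>\<omega>. V \<omega> * herm \<alpha> \<omega> \<partial>M)"

definition herm_sum :: "('h multiset \<Rightarrow> real) \<Rightarrow> 'h multiset set \<Rightarrow> 'w \<Rightarrow> real" where
  "herm_sum c D \<omega> = (\<Sum>\<alpha>\<in>D. c \<alpha> * herm \<alpha> \<omega>)"

text \<open>The orthogonal projection of V onto the span of the Hermite products indexed by
  D.\<close>

definition partial_sum :: "('w \<Rightarrow> real) \<Rightarrow> 'h multiset set \<Rightarrow> 'w \<Rightarrow> real" where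
  "partial_sum V = herm_sum (\<lambda>\<alpha>. coef V \<alpha> / mset_fact \<alpha>)"

text \<open>Membership in the closed linear span of the Hermite products. For such V the projections
  converge to V, which Bessel's inequality alone would not give.\<close>

definition chaos_approx :: "('w \<Rightarrow> real) \<Rightarrow> bool" where
  "chaos_approx V \<longleftrightarrow> square_integrable M V \<and>
    (\<forall>\<epsilon>>0. \<exists>D c. finite D \<and> D \<subseteq> indices \<and> (\<integral>\<omega>. (herm_sum c D \<omega> - V \<omega>)\<^sup>2 \<partial>M) < \<epsilon>)"

lemma square_integrable_herm_sum: "D \<subseteq> indices \<Longrightarrow> square_integrable M (herm_sum c D)"
  unfolding herm_sum_def[abs_def]
  by (intro square_integrable_sum square_integrable_cmult square_integrable_herm) (auto simp: indices_def)

lemma inner_herm_sum: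
  assumes "finite D" "D \<subseteq> indices" "square_integrable M V"
  shows "(\<integral>\<omega>. herm_sum c D \<omega> * V \<omega> \<partial>M) = (\<Sum>\<alpha>\<in>D. c \<alpha> * coef V \<alpha>)"
proof -
  have "(\<integral>\<omega>. herm_sum c D \<omega> * V \<omega> \<partial>M) = (\<integral>\<omega>. (\<Sum>\<alpha>\<in>D. c \<alpha> * (V \<omega> * herm \<alpha> \<omega>)) \<partial>M)"
    by (simp add: herm_sum_def sum_distrib_right sum_distrib_left mult_ac)
  also have "\<dots> = (\<Sum>\<alpha>\<in>D. \<integral>\<omega>. c \<alpha> * (V \<omega> * herm \<alpha> \<omega>) \<partial>M)"
    by (intro Bochner_Integration.integral_sum integrable_mult_right square_integrable_mult_integrable
        assms(3) square_integrable_herm) (use assms in \<open>auto simp: indices_def\<close>)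
  finally show ?thesis by (simp add: coef_def)
qed

lemma coef_herm: "\<alpha> \<in> indices \<Longrightarrow> \<beta> \<in> indices \<Longrightarrow>
    coef (herm \<beta>) \<alpha> = (if \<alpha> = \<beta> then mset_fact \<alpha> else 0)"
  unfolding coef_def by (rule herm_orthogonal) (auto simp: indices_def)

lemma coef_herm_sum:
  assumes "finite D" "D \<subseteq> indices" "\<alpha> \<in> indices"
  shows "coef (herm_sum c D) \<alpha> = (if \<alpha> \<in> D then c \<alpha> * mset_fact \<alpha> else 0)"
proof -
  have "coef (herm_sum c D) \<alpha> = (\<Sum>\<beta>\<in>D. c \<beta> * coef (herm \<alpha>) \<beta>)"
    unfolding coef_def[of "herm_sum c D"]
    using assms by (intro inner_herm_sum square_integrable_herm) (auto simp: indices_def)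
  also have "\<dots> = (\<Sum>\<beta>\<in>D. if \<beta> = \<alpha> then c \<alpha> * mset_fact \<alpha> else 0)"
    using assms by (intro sum.cong) (auto simp: coef_herm subset_eq)
  finally show ?thesis using assms by simp
qed

lemma norm_herm_sum:
  assumes "finite D" "D \<subseteq> indices"
  shows "(\<integral>\<omega>. (herm_sum c D \<omega>)\<^sup>2 \<partial>M) = (\<Sum>\<alpha>\<in>D. (c \<alpha>)\<^sup>2 * mset_fact \<alpha>)"
  unfolding power2_eq_square inner_herm_sum[OF assms square_integrable_herm_sum[OF assms(2)]]
  by (intro sum.cong) (use assms in \<open>auto simp: coef_herm_sum subset_eq\<close>)

text \<open>Completing the square in each coefficient. The last sum is nonnegative and vanishes for
  \<open>partial_sum\<close>, so the projection is the best approximation and its error is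
  explicit.\<close>

lemma projection_error:
  assumes D: "finite D" "D \<subseteq> indices" and V: "square_integrable M V"
  shows "(\<integral>\<omega>. (herm_sum c D \<omega> - V \<omega>)\<^sup>2 \<partial>M) = (\<integral>\<omega>. (V \<omega>)\<^sup>2 \<partial>M)
    - (\<Sum>\<alpha>\<in>D. (coef V \<alpha>)\<^sup>2 / mset_fact \<alpha>)
    + (\<Sum>\<alpha>\<in>D. mset_fact \<alpha> * (c \<alpha> - coef V \<alpha> / mset_fact \<alpha>)\<^sup>2)"
proof -
  let ?P = "herm_sum c D"
  have i: "integrable M (\<lambda>\<omega>. (?P \<omega>)\<^sup>2)" "integrable M (\<lambda>\<omega>. (V \<omega>)\<^sup>2)" "integrable M (\<lambda>\<omega>. ?P \<omega> * V \<omega>)"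
    using square_integrable_herm_sum[OF D(2), of c] V square_integrable_mult_integrable[OF _ V]
    by (auto simp: square_integrable_def)
  have "(\<integral>\<omega>. (?P \<omega> - V \<omega>)\<^sup>2 \<partial>M) = (\<integral>\<omega>. (?P \<omega>)\<^sup>2 + (V \<omega>)\<^sup>2 - 2 * (?P \<omega> * V \<omega>) \<partial>M)"
    by (intro Bochner_Integration.integral_cong) (auto simp: power2_eq_square algebra_simps)
  also have "\<dots> = (\<integral>\<omega>. (?P \<omega>)\<^sup>2 \<partial>M) + (\<integral>\<omega>. (V \<omega>)\<^sup>2 \<partial>M) - 2 * (\<integral>\<omega>. ?P \<omega> * V \<omega> \<partial>M)"
    using i by simp
  also have "\<dots> = (\<integral>\<omega>. (V \<omega>)\<^sup>2 \<partial>M) +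
      (\<Sum>\<alpha>\<in>D. (c \<alpha>)\<^sup>2 * mset_fact \<alpha> - 2 * (c \<alpha> * coef V \<alpha>))"
    by (simp add: norm_herm_sum[OF D] inner_herm_sum[OF D V] sum_subtractf sum_distrib_left)
  also have "(\<Sum>\<alpha>\<in>D. (c \<alpha>)\<^sup>2 * mset_fact \<alpha> - 2 * (c \<alpha> * coef V \<alpha>)) =
      (\<Sum>\<alpha>\<in>D. mset_fact \<alpha> * (c \<alpha> - coef V \<alpha> / mset_fact \<alpha>)\<^sup>2 - (coef V \<alpha>)\<^sup>2 / mset_fact \<alpha>)"
    by (intro sum.cong) (auto simp: power2_eq_square field_simps mset_fact_nonzero)
  finally show ?thesis by (simp add: sum_subtractf)
qed

text \<open>The projection onto the span of \<open>D0\<close> is at least as good as any given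
  combination over \<open>D0\<close>, and enlarging the index set can only decrease the
  error.\<close>

lemma partial_sum_tendsto:
  assumes V: "chaos_approx V"
  shows "((\<lambda>D. \<integral>\<omega>. (partial_sum V D \<omega> - V \<omega>)\<^sup>2 \<partial>M) \<longlongrightarrow> 0) (finite_subsets_at_top indices)"
proof (rule tendstoI)
  have V2: "square_integrable M V" using V by (simp add: chaos_approx_def)
  fix \<epsilon> :: real assume "\<epsilon> > 0"
  with V obtain D0 c where D0: "finite D0" "D0 \<subseteq> indices"
    and less: "(\<integral>\<omega>. (herm_sum c D0 \<omega> - V \<omega>)\<^sup>2 \<partial>M) < \<epsilon>"
    unfolding chaos_approx_def by blast
  have "(\<integral>\<omega>. (partial_sum V D \<omega> - V \<omega>)\<^sup>2 \<partial>M) < \<epsilon>"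
    if D: "finite D" "D0 \<subseteq> D" "D \<subseteq> indices" for D
  proof -
    have "(\<integral>\<omega>. (partial_sum V D \<omega> - V \<omega>)\<^sup>2 \<partial>M) =
        (\<integral>\<omega>. (V \<omega>)\<^sup>2 \<partial>M) - (\<Sum>\<alpha>\<in>D. (coef V \<alpha>)\<^sup>2 / mset_fact \<alpha>)"
      unfolding partial_sum_def by (subst projection_error[OF D(1,3) V2]) simp
    also have "\<dots> \<le> (\<integral>\<omega>. (V \<omega>)\<^sup>2 \<partial>M) - (\<Sum>\<alpha>\<in>D0. (coef V \<alpha>)\<^sup>2 / mset_fact \<alpha>)"
      using D by (intro diff_left_mono sum_mono2) (auto intro: divide_nonneg_pos mset_fact_pos)
    also have "\<dots> \<le> (\<integral>\<omega>. (herm_sum c D0 \<omega> - V \<omega>)\<^sup>2 \<partial>M)"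
      unfolding projection_error[OF D0 V2]
      using sum_nonneg[of D0 "\<lambda>\<alpha>. mset_fact \<alpha> * (c \<alpha> - coef V \<alpha> / mset_fact \<alpha>)\<^sup>2"]
      by (simp add: mset_fact_pos less_imp_le)
    finally show ?thesis using less by simp
  qed
  then show "\<forall>\<^sub>F D in finite_subsets_at_top indices.
      dist (\<integral>\<omega>. (partial_sum V D \<omega> - V \<omega>)\<^sup>2 \<partial>M) 0 < \<epsilon>"
    unfolding eventually_finite_subsets_at_top using D0 by (intro exI[of _ D0]) auto
qed

lemma chaos_approx_limit:
  assumes "\<forall>\<^sub>F i in F. chaos_approx (V i)" "square_integrable M V'" "F \<noteq> bot"
    and lim: "((\<lambda>i. \<integral>\<omega>. (V i \<omega> - V' \<omega>)\<^sup>2 \<partial>M) \<longlongrightarrow> 0) F"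
  shows "chaos_approx V'"
  unfolding chaos_approx_def
proof (intro conjI allI impI assms(2))
  fix \<epsilon> :: real assume "\<epsilon> > 0"
  \<comment> \<open>A quarter of \<epsilon> for each of two errors, because
    \<open>integral_square_triangle\<close> doubles both.\<close>
  then have "\<forall>\<^sub>F i in F. (\<integral>\<omega>. (V i \<omega> - V' \<omega>)\<^sup>2 \<partial>M) < \<epsilon> / 4"
    by (intro order_tendstoD(2)[OF lim]) simp
  then obtain i where i: "(\<integral>\<omega>. (V i \<omega> - V' \<omega>)\<^sup>2 \<partial>M) < \<epsilon> / 4" "chaos_approx (V i)"
    using eventually_happens'[OF assms(3) eventually_conj[OF _ assms(1)]] by blast
  then obtain D c where D: "finite D" "D \<subseteq> indices" "(\<integral>\<omega>. (herm_sum c D \<omega> - V i \<omega>)\<^sup>2 \<partial>M) < \<epsilon> / 4"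
    using \<open>\<epsilon> > 0\<close> unfolding chaos_approx_def by (meson zero_less_divide_iff zero_less_numeral)
  have "(\<integral>\<omega>. (herm_sum c D \<omega> - V' \<omega>)\<^sup>2 \<partial>M) < \<epsilon>"
    using integral_square_triangle[OF square_integrable_herm_sum[OF D(2), of c] assms(2), of "V i"] i D
    by (auto simp: chaos_approx_def)
  then show "\<exists>D c. finite D \<and> D \<subseteq> indices \<and> (\<integral>\<omega>. (herm_sum c D \<omega> - V' \<omega>)\<^sup>2 \<partial>M) < \<epsilon>"
    using D by blast
qed

lemma chaos_approx_herm_sum:
  assumes "finite D" "D \<subseteq> indices"
  shows "chaos_approx (herm_sum c D)"
  unfolding chaos_approx_def
  using assms by (auto intro!: square_integrable_herm_sum exI[of _ D] exI[of _ c])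

text \<open>Projecting both variables onto the same D keeps the combination of the approximants a
  single \<open>herm_sum\<close>.\<close>

lemma chaos_approx_cmult_add:
  assumes V: "chaos_approx V" and V': "chaos_approx V'"
  shows "chaos_approx (\<lambda>\<omega>. V \<omega> + r * V' \<omega>)"
proof (rule chaos_approx_limit)
  let ?F = "finite_subsets_at_top indices"
  let ?V = "\<lambda>D \<omega>. partial_sum V D \<omega> + r * partial_sum V' D \<omega>"
  have V2: "square_integrable M V" "square_integrable M V'" using V V' by (auto simp: chaos_approx_def)
  show s: "square_integrable M (\<lambda>\<omega>. V \<omega> + r * V' \<omega>)"
    by (intro square_integrable_add square_integrable_cmult V2)
  have ps: "square_integrable M (partial_sum U D)" if "D \<subseteq> indices" for U D
    unfolding partial_sum_def by (rule square_integrable_herm_sum[OF that])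
  have eq: "?V D = herm_sum (\<lambda>\<alpha>. coef V \<alpha> / mset_fact \<alpha> + r * (coef V' \<alpha> / mset_fact \<alpha>)) D" for D
    by (simp add: partial_sum_def herm_sum_def fun_eq_iff distrib_right sum.distrib sum_distrib_left mult.assoc)
  show "\<forall>\<^sub>F D in ?F. chaos_approx (?V D)"
    unfolding eq by (auto simp: eventually_finite_subsets_at_top intro!: chaos_approx_herm_sum)
  show "((\<lambda>D. \<integral>\<omega>. (?V D \<omega> - (V \<omega> + r * V' \<omega>))\<^sup>2 \<partial>M) \<longlongrightarrow> 0) ?F"
  proof (rule tendsto_sandwich[OF _ _ tendsto_const])
    let ?u = "\<lambda>D. 2 * (\<integral>\<omega>. (partial_sum V D \<omega> - V \<omega>)\<^sup>2 \<partial>M) + 2 * (r\<^sup>2 * (\<integral>\<omega>. (partial_sum V' D \<omega> - V' \<omega>)\<^sup>2 \<partial>M))"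
    show "(?u \<longlongrightarrow> 0) ?F"
      using tendsto_add[OF tendsto_mult_left[OF partial_sum_tendsto[OF V], of 2]
          tendsto_mult_left[OF tendsto_mult_left[OF partial_sum_tendsto[OF V'], of "r\<^sup>2"], of 2]] by simp
    have "(\<integral>\<omega>. (?V D \<omega> - (V \<omega> + r * V' \<omega>))\<^sup>2 \<partial>M) \<le> ?u D" if D: "D \<subseteq> indices" for D
    proof -
      have "(\<integral>\<omega>. (?V D \<omega> - (V \<omega> + r * V' \<omega>))\<^sup>2 \<partial>M) \<le>
          2 * (\<integral>\<omega>. (?V D \<omega> - (V \<omega> + r * partial_sum V' D \<omega>))\<^sup>2 \<partial>M) +
          2 * (\<integral>\<omega>. ((V \<omega> + r * partial_sum V' D \<omega>) - (V \<omega> + r * V' \<omega>))\<^sup>2 \<partial>M)"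
        by (intro integral_square_triangle square_integrable_add square_integrable_cmult V2 ps D)
      also have "\<dots> = 2 * (\<integral>\<omega>. (partial_sum V D \<omega> - V \<omega>)\<^sup>2 \<partial>M) +
          2 * (\<integral>\<omega>. r\<^sup>2 * (partial_sum V' D \<omega> - V' \<omega>)\<^sup>2 \<partial>M)"
        by (simp flip: right_diff_distrib power_mult_distrib)
      finally show ?thesis by simp
    qed
    then show "\<forall>\<^sub>F D in ?F. (\<integral>\<omega>. (?V D \<omega> - (V \<omega> + r * V' \<omega>))\<^sup>2 \<partial>M) \<le> ?u D"
      unfolding eventually_finite_subsets_at_top by blast
  qed simp
qed simp

lemma chaos_approx_zero: "chaos_approx (\<lambda>_. 0)"
  using chaos_approx_herm_sum[of "{}"] by (simp add: herm_sum_def[abs_def])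

lemma chaos_approx_sum:
  "(\<And>i. i \<in> I \<Longrightarrow> chaos_approx (V i)) \<Longrightarrow> chaos_approx (\<lambda>\<omega>. \<Sum>i\<in>I. c i * V i \<omega>)"
proof (induction I rule: infinite_finite_induct)
  case (insert i I)
  then have "chaos_approx (\<lambda>\<omega>. (\<Sum>i\<in>I. c i * V i \<omega>) + c i * V i \<omega>)"
    by (intro chaos_approx_cmult_add) auto
  then show ?case using insert by (simp add: add.commute)
qed (auto intro: chaos_approx_zero)

lemma coef_sum:
  assumes "\<And>i. i \<in> I \<Longrightarrow> square_integrable M (V i)" "\<alpha> \<in> indices"
  shows "coef (\<lambda>\<omega>. \<Sum>i\<in>I. c i * V i \<omega>) \<alpha> = (\<Sum>i\<in>I. c i * coef (V i) \<alpha>)"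
proof -
  have "coef (\<lambda>\<omega>. \<Sum>i\<in>I. c i * V i \<omega>) \<alpha> = (\<integral>\<omega>. (\<Sum>i\<in>I. c i * (V i \<omega> * herm \<alpha> \<omega>)) \<partial>M)"
    by (simp add: coef_def sum_distrib_right mult.assoc)
  also have "\<dots> = (\<Sum>i\<in>I. \<integral>\<omega>. c i * (V i \<omega> * herm \<alpha> \<omega>) \<partial>M)"
    by (intro Bochner_Integration.integral_sum integrable_mult_right square_integrable_mult_integrable
        assms square_integrable_herm) (use assms in \<open>auto simp: indices_def\<close>)
  finally show ?thesis by (simp add: coef_def)
qed

lemma L2_lim_chaos:
  assumes lim: "L2_lim M Ys Y F" and F: "F \<noteq> bot" and Ys: "\<forall>\<^sub>F i in F. chaos_approx (Ys i)"
  shows "chaos_approx Y" "\<alpha> \<in> indices \<Longrightarrow> ((\<lambda>i. coef (Ys i) \<alpha>) \<longlongrightarrow> coef Y \<alpha>) F"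
proof -
  have s: "\<forall>\<^sub>F i in F. square_integrable M (Ys i)"
    using Ys by eventually_elim (simp add: chaos_approx_def)
  note l = L2_lim_square_integrable[OF lim F s]
  show "chaos_approx Y" by (rule chaos_approx_limit[OF Ys l(1) F l(2)])
  show "((\<lambda>i. coef (Ys i) \<alpha>) \<longlongrightarrow> coef Y \<alpha>) F" if "\<alpha> \<in> indices"
    unfolding coef_def
    by (rule tendsto_integral_mult[OF s l(1) square_integrable_herm l(2)])
      (use that in \<open>auto simp: indices_def\<close>)
qed

section \<open>Chaos coefficients of multiple integrals, expansions and the pseudo-inverse\<close>

lemma basis_integral_eq_herm: "basis_integral W es \<omega> = herm (mset es) \<omega>"
  by (simp add: basis_integral_def herm_def hermite_prod_def count_mset)

lemma mset_basis_tuples: "es \<in> basis_tuples E n \<Longrightarrow> mset es \<in> indices"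
  by (auto simp: basis_tuples_def indices_def)

text \<open>Writing \<alpha> for \<open>mset es\<close>, there are n! / \<alpha>! orderings of
  \<alpha>, and each contributes f times \<alpha>!, whence the factor n!. Once the finite set T
  contains all of them, the coefficient no longer changes. Symmetry is assumed pointwise so that the
  lemma also covers the contraction of a symmetric kernel with a basis vector.\<close>

lemma multiple_wiener_integral_coef:
  assumes I: "multiple_wiener_integral M W E n f I"
    and sym: "\<And>es es'. es \<in> basis_tuples E n \<Longrightarrow> es' \<in> basis_tuples E n \<Longrightarrow> mset es = mset es' \<Longrightarrow> f es = f es'"
  shows "chaos_approx I" (is ?A)
    and "es \<in> basis_tuples E n \<Longrightarrow> coef I (mset es) = fact n * f es" (is "?t \<Longrightarrow> ?B")
    and "\<alpha> \<in> indices \<Longrightarrow> size \<alpha> \<noteq> n \<Longrightarrow> coef I \<alpha> = 0" (is "?i \<Longrightarrow> ?s \<Longrightarrow> ?C")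
proof -
  let ?F = "finite_subsets_at_top (basis_tuples E n)"
  let ?Y = "\<lambda>T \<omega>. \<Sum>es\<in>T. f es * basis_integral W es \<omega>"
  have lim: "L2_lim M ?Y I ?F" using I by (simp add: multiple_wiener_integral_def)
  have h: "chaos_approx (herm \<alpha>)" if "\<alpha> \<in> indices" for \<alpha>
    using chaos_approx_herm_sum[of "{\<alpha>}" "\<lambda>_. 1"] that by (simp add: herm_sum_def[abs_def])
  have Y: "\<forall>\<^sub>F T in ?F. chaos_approx (?Y T)"
    unfolding eventually_finite_subsets_at_top basis_integral_eq_herm
    by (intro exI[of _ "{}"]) (auto intro!: chaos_approx_sum h mset_basis_tuples)
  show ?A by (rule L2_lim_chaos(1)[OF lim _ Y]) simp
  have cY: "coef (?Y T) \<alpha> = (\<Sum>es | es \<in> T \<and> mset es = \<alpha>. f es * mset_fact \<alpha>)"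
    if T: "finite T" "T \<subseteq> basis_tuples E n" and \<alpha>: "\<alpha> \<in> indices" for T \<alpha>
  proof -
    have "coef (?Y T) \<alpha> = (\<Sum>es\<in>T. f es * coef (herm (mset es)) \<alpha>)"
      unfolding basis_integral_eq_herm
      by (intro coef_sum \<alpha>) (use T h mset_basis_tuples in \<open>auto simp: chaos_approx_def subset_eq\<close>)
    also have "\<dots> = (\<Sum>es\<in>T. if mset es = \<alpha> then f es * mset_fact \<alpha> else 0)"
      using T \<alpha> mset_basis_tuples by (intro sum.cong refl) (auto simp: coef_herm subset_eq)
    also have "\<dots> = (\<Sum>es | es \<in> T \<and> mset es = \<alpha>. f es * mset_fact \<alpha>)"
      using T by (simp add: sum.inter_filter)
    finally show ?thesis .
  qed
  have lc: "((\<lambda>T. coef (?Y T) \<alpha>) \<longlongrightarrow> coef I \<alpha>) ?F" if "\<alpha> \<in> indices" for \<alpha>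
    by (rule L2_lim_chaos(2)[OF lim _ Y that]) simp
  show ?B if es: ?t
  proof -
    let ?\<alpha> = "mset es"
    have sub: "permutations_of_multiset ?\<alpha> \<subseteq> basis_tuples E n"
      using es by (auto simp: permutations_of_multiset_def basis_tuples_def
          dest: mset_eq_setD mset_eq_length)
    have "\<forall>\<^sub>F T in ?F. coef (?Y T) ?\<alpha> = fact n * f es"
      unfolding eventually_finite_subsets_at_top
    proof (intro exI[of _ "permutations_of_multiset ?\<alpha>"] conjI allI impI)
      fix T assume T: "finite T \<and> permutations_of_multiset ?\<alpha> \<subseteq> T \<and> T \<subseteq> basis_tuples E n"
      then have "{es'. es' \<in> T \<and> mset es' = ?\<alpha>} = permutations_of_multiset ?\<alpha>"
        by (auto simp: permutations_of_multiset_def)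
      then have "coef (?Y T) ?\<alpha> = (\<Sum>es'\<in>permutations_of_multiset ?\<alpha>. f es' * mset_fact ?\<alpha>)"
        using cY[of T ?\<alpha>] T es mset_basis_tuples by auto
      also have "\<dots> = (\<Sum>es'\<in>permutations_of_multiset ?\<alpha>. f es * mset_fact ?\<alpha>)"
        using sub es by (intro sum.cong refl arg_cong2[where f = "(*)"] sym)
          (auto simp: permutations_of_multiset_def)
      also have "\<dots> = real (card (permutations_of_multiset ?\<alpha>) * (\<Prod>x\<in>set_mset ?\<alpha>. fact (count ?\<alpha> x))) * f es"
        by (simp add: mset_fact_def)
      also have "\<dots> = fact n * f es"
        using es by (simp only: card_permutations_of_multiset_aux) (simp add: basis_tuples_def)
      finally show "coef (?Y T) ?\<alpha> = fact n * f es" .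
    qed (use sub in auto)
    then have "((\<lambda>T. coef (?Y T) ?\<alpha>) \<longlongrightarrow> fact n * f es) ?F" by (rule tendsto_eventually)
    then show ?thesis using lc[OF mset_basis_tuples[OF es]] tendsto_unique by force
  qed
  show ?C if ?i ?s
  proof -
    have "\<forall>\<^sub>F T in ?F. coef (?Y T) \<alpha> = 0"
      unfolding eventually_finite_subsets_at_top
    proof (intro exI[of _ "{}"] conjI allI impI)
      fix T assume T: "finite T \<and> {} \<subseteq> T \<and> T \<subseteq> basis_tuples E n"
      then have "{es. es \<in> T \<and> mset es = \<alpha>} = {}" using that by (auto simp: basis_tuples_def)
      then show "coef (?Y T) \<alpha> = 0" using cY[of T \<alpha>] T that by (simp only: sum.empty)
    qed auto
    then have "((\<lambda>T. coef (?Y T) \<alpha>) \<longlongrightarrow> 0) ?F" by (rule tendsto_eventually)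
    then show ?thesis using lc[OF that(1)] tendsto_unique by force
  qed
qed

lemma indicesE:
  assumes "\<alpha> \<in> indices"
  obtains es where "mset es = \<alpha>" "es \<in> basis_tuples E (size \<alpha>)"
proof -
  obtain es where "mset es = \<alpha>" using ex_mset by blast
  then show ?thesis using that[of es] assms by (auto simp: indices_def basis_tuples_def)
qed

text \<open>Each relational definition asserts the existence of an expansion of its own. Expressing
  kernels and chaos components through \<open>coef X\<close> makes these expansions
  interchangeable.\<close>

lemma chaos_expansion_coef:
  assumes X: "chaos_expansion M W E X f J"
  shows "chaos_approx (J n)" "chaos_approx X"
    and "es \<in> basis_tuples E n \<Longrightarrow> coef X (mset es) = fact n * f n es"
    and "\<alpha> \<in> indices \<Longrightarrow> coef (J n) \<alpha> = (if size \<alpha> = n then coef X \<alpha> else 0)"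
proof -
  have J: "multiple_wiener_integral M W E n (f n) (J n)"
    and lim: "L2_lim M (\<lambda>N \<omega>. \<Sum>n\<le>N. J n \<omega>) X sequentially" for n
    using X unfolding chaos_expansion_def by blast+
  have sym: "f n es = f n es'"
    if "es \<in> basis_tuples E n" "es' \<in> basis_tuples E n" "mset es = mset es'" for n es es'
    using X that unfolding chaos_expansion_def symmetric_kernel_def by blast
  have c: "chaos_approx (J n)" "es \<in> basis_tuples E n \<Longrightarrow> coef (J n) (mset es) = fact n * f n es"
    "\<alpha> \<in> indices \<Longrightarrow> size \<alpha> \<noteq> n \<Longrightarrow> coef (J n) \<alpha> = 0" for n es \<alpha>
    using multiple_wiener_integral_coef[OF J, of n] sym[of _ n] by blast+
  show J': "chaos_approx (J n)" for n by (rule c(1))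
  have a: "\<forall>\<^sub>F N in sequentially. chaos_approx (\<lambda>\<omega>. \<Sum>n\<le>N. J n \<omega>)"
    using chaos_approx_sum[of _ J "\<lambda>_. 1"] J' by (intro always_eventually) auto
  show "chaos_approx X" by (rule L2_lim_chaos(1)[OF lim _ a]) simp
  have X_J: "coef X \<alpha> = coef (J (size \<alpha>)) \<alpha>" if \<alpha>: "\<alpha> \<in> indices" for \<alpha>
  proof -
    have "\<forall>\<^sub>F N in sequentially. coef (\<lambda>\<omega>. \<Sum>n\<le>N. J n \<omega>) \<alpha> = coef (J (size \<alpha>)) \<alpha>"
      using eventually_ge_at_top[of "size \<alpha>"]
    proof eventually_elim
      case (elim N)
      have "coef (\<lambda>\<omega>. \<Sum>n\<le>N. J n \<omega>) \<alpha> = (\<Sum>n\<le>N. coef (J n) \<alpha>)"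
        using coef_sum[of "{..N}" J \<alpha> "\<lambda>_. 1"] J' \<alpha> by (auto simp: chaos_approx_def)
      also have "\<dots> = (\<Sum>n\<le>N. if n = size \<alpha> then coef (J n) \<alpha> else 0)"
        using c(3)[OF \<alpha>] by (intro sum.cong) auto
      finally show ?case using elim by simp
    qed
    then have "((\<lambda>N. coef (\<lambda>\<omega>. \<Sum>n\<le>N. J n \<omega>) \<alpha>) \<longlongrightarrow> coef (J (size \<alpha>)) \<alpha>) sequentially"
      by (rule tendsto_eventually)
    moreover have "((\<lambda>N. coef (\<lambda>\<omega>. \<Sum>n\<le>N. J n \<omega>) \<alpha>) \<longlongrightarrow> coef X \<alpha>) sequentially"
      by (rule L2_lim_chaos(2)[OF lim _ a \<alpha>]) simp
    ultimately show ?thesis using tendsto_unique by force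
  qed
  show "coef X (mset es) = fact n * f n es" if "es \<in> basis_tuples E n"
    using X_J[OF mset_basis_tuples[OF that]] c(2)[OF that] that
    by (simp add: basis_tuples_def)
  show "coef (J n) \<alpha> = (if size \<alpha> = n then coef X \<alpha> else 0)" if "\<alpha> \<in> indices"
    using X_J[OF that] c(3)[OF that, of n] by auto
qed

text \<open>At the empty index division by zero returns 0, which is the correct value because the
  series starts at n = 1.\<close>

lemma neg_OU_pseudo_inverse_coef:
  assumes Y: "neg_OU_pseudo_inverse M W E X Y" and \<alpha>: "\<alpha> \<in> indices"
  shows "coef Y \<alpha> = coef X \<alpha> / real (size \<alpha>)"
proof -
  obtain f J where X: "chaos_expansion M W E X f J"
    and lim: "L2_lim M (\<lambda>N \<omega>. \<Sum>n=1..N. (1 / real n) * J n \<omega>) Y sequentially"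
    using Y by (auto simp: neg_OU_pseudo_inverse_def)
  note c = chaos_expansion_coef[OF X]
  have a: "\<forall>\<^sub>F N in sequentially. chaos_approx (\<lambda>\<omega>. \<Sum>n=1..N. (1 / real n) * J n \<omega>)"
    by (intro always_eventually allI chaos_approx_sum c(1))
  have "\<forall>\<^sub>F N in sequentially. coef (\<lambda>\<omega>. \<Sum>n=1..N. (1 / real n) * J n \<omega>) \<alpha> = coef X \<alpha> / real (size \<alpha>)"
    using eventually_ge_at_top[of "size \<alpha>"]
  proof eventually_elim
    case (elim N)
    have "coef (\<lambda>\<omega>. \<Sum>n=1..N. (1 / real n) * J n \<omega>) \<alpha> = (\<Sum>n=1..N. (1 / real n) * coef (J n) \<alpha>)"
      by (intro coef_sum \<alpha>) (use c(1) in \<open>auto simp: chaos_approx_def\<close>)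
    also have "\<dots> = (\<Sum>n=1..N. if n = size \<alpha> then coef X \<alpha> / real n else 0)"
      using c(4)[OF \<alpha>] by (intro sum.cong) auto
    finally show ?case using elim by (cases "size \<alpha> = 0") auto
  qed
  then have "((\<lambda>N. coef (\<lambda>\<omega>. \<Sum>n=1..N. (1 / real n) * J n \<omega>) \<alpha>) \<longlongrightarrow> coef X \<alpha> / real (size \<alpha>)) sequentially"
    by (rule tendsto_eventually)
  moreover have "((\<lambda>N. coef (\<lambda>\<omega>. \<Sum>n=1..N. (1 / real n) * J n \<omega>) \<alpha>) \<longlongrightarrow> coef Y \<alpha>) sequentially"
    by (rule L2_lim_chaos(2)[OF lim _ a \<alpha>]) simp
  ultimately show ?thesis using tendsto_unique by force
qed

end

subsection \<open>The Malliavin derivative as a limit of gradients\<close>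

lemma orthonormal_basis_inner:
  assumes "orthonormal_basis E" "e \<in> E" "e' \<in> E"
  shows "e \<bullet> e' = (if e = e' then 1 else 0)"
  using assms by (auto simp: orthonormal_basis_def pairwise_def orthogonal_def norm_eq_1)

text \<open>Distinct basis vectors are at distance sqrt 2, so no point of a countable dense set is
  within 1/2 of two of them.\<close>

lemma orthonormal_basis_countable:
  fixes E :: "'h::{real_inner, second_countable_topology} set"
  assumes "orthonormal_basis E"
  shows "countable E"
proof -
  obtain D :: "'h set" where D: "countable D" "\<And>X. open X \<Longrightarrow> X \<noteq> {} \<Longrightarrow> \<exists>d\<in>D. d \<in> X"
    using countable_dense_setE by blast
  have "\<exists>d\<in>D. d \<in> ball e (1/2)" for e by (rule D(2)) auto
  then obtain d where d: "\<And>e. d e \<in> D" "\<And>e. dist e (d e) < 1/2" by (metis mem_ball)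
  have "inj_on d E"
  proof (rule inj_onI, rule ccontr)
    fix x y assume xy: "x \<in> E" "y \<in> E" "d x = d y" "x \<noteq> y"
    have "dist x y < 1" using d(2)[of x] d(2)[of y] xy(3) dist_triangle_half_r[of "d x" x 1 y]
      by (simp add: dist_commute)
    moreover have "(dist x y)\<^sup>2 = 2"
      using orthonormal_basis_inner[OF assms] xy
      by (simp add: dist_norm power2_norm_eq_inner inner_diff inner_commute)
    ultimately show False using power_strict_mono[of "dist x y" 1 2] by simp
  qed
  moreover have "countable (d ` E)" using D(1) d(1) by (auto intro: countable_subset)
  ultimately show ?thesis by (rule countable_image_inj_on[rotated])
qed

text \<open>The counterpart in H of \<open>projection_error\<close>.\<close>

lemma orthonormal_diff_norm:
  assumes E: "orthonormal_basis E" and F: "finite F" "F \<subseteq> E"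
  shows "(norm (v - (\<Sum>e\<in>F. r e *\<^sub>R e)))\<^sup>2 =
    (norm v)\<^sup>2 - (\<Sum>e\<in>F. (v \<bullet> e)\<^sup>2) + (\<Sum>e\<in>F. (r e - v \<bullet> e)\<^sup>2)"
proof -
  let ?w = "\<Sum>e\<in>F. r e *\<^sub>R e"
  have vw: "v \<bullet> ?w = (\<Sum>e\<in>F. r e * (v \<bullet> e))" by (simp add: inner_sum_right)
  have "?w \<bullet> ?w = (\<Sum>e\<in>F. \<Sum>e'\<in>F. if e' = e then r e * r e else 0)"
    unfolding inner_sum_left inner_sum_right
    using F orthonormal_basis_inner[OF E] by (intro sum.cong refl) (auto simp: subset_eq)
  then have ww: "?w \<bullet> ?w = (\<Sum>e\<in>F. r e * r e)" using F by simp
  have "(norm (v - ?w))\<^sup>2 = (norm v)\<^sup>2 + (\<Sum>e\<in>F. r e * r e - 2 * (r e * (v \<bullet> e)))"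
    unfolding power2_norm_eq_inner
    by (simp add: inner_diff inner_commute[of ?w v] ww vw sum_subtractf sum_distrib_left sum_negf)
  also have "(\<Sum>e\<in>F. r e * r e - 2 * (r e * (v \<bullet> e))) =
      (\<Sum>e\<in>F. (r e - v \<bullet> e)\<^sup>2 - (v \<bullet> e)\<^sup>2)"
    by (intro sum.cong) (auto simp: power2_eq_square algebra_simps)
  finally show ?thesis by (simp add: sum_subtractf)
qed

lemma bessel:
  assumes E: "orthonormal_basis E" and F: "finite F" "F \<subseteq> E"
  shows "(\<Sum>e\<in>F. (v \<bullet> e)\<^sup>2) \<le> (norm v)\<^sup>2"
proof -
  have "0 \<le> (norm (v - (\<Sum>e\<in>F. (v \<bullet> e) *\<^sub>R e)))\<^sup>2" by simp
  also have "\<dots> = (norm v)\<^sup>2 - (\<Sum>e\<in>F. (v \<bullet> e)\<^sup>2)"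
    by (subst orthonormal_diff_norm[OF assms]) simp
  finally show ?thesis by simp
qed

text \<open>Some finite combination of basis vectors is close to v; the projection onto the same
  vectors is at least as close, and more vectors only help.\<close>

lemma parseval_approx:
  assumes E: "orthonormal_basis E" and "\<epsilon> > 0"
  shows "\<exists>F0. finite F0 \<and> F0 \<subseteq> E \<and> (\<forall>F. finite F \<and> F0 \<subseteq> F \<and> F \<subseteq> E \<longrightarrow> (norm v)\<^sup>2 - \<epsilon> < (\<Sum>e\<in>F. (v \<bullet> e)\<^sup>2))"
proof -
  have "v \<in> closure (span E)" using E by (simp add: orthonormal_basis_def)
  then obtain w where w: "w \<in> span E" "dist w v < sqrt \<epsilon>"
    using \<open>\<epsilon> > 0\<close> unfolding closure_approachable by (meson real_sqrt_gt_zero)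
  obtain F0 r where F0: "finite F0" "F0 \<subseteq> E" "w = (\<Sum>e\<in>F0. r e *\<^sub>R e)"
    using w(1) unfolding span_explicit by auto
  have "(norm (v - w))\<^sup>2 < (sqrt \<epsilon>)\<^sup>2"
    using w(2) by (intro power_strict_mono) (auto simp: dist_norm norm_minus_commute)
  then have wless: "(norm (v - w))\<^sup>2 < \<epsilon>" using \<open>\<epsilon> > 0\<close> by simp
  have "(norm v)\<^sup>2 - \<epsilon> < (\<Sum>e\<in>F. (v \<bullet> e)\<^sup>2)" if F: "finite F" "F0 \<subseteq> F" for F
  proof -
    have "(norm v)\<^sup>2 - (\<Sum>e\<in>F0. (v \<bullet> e)\<^sup>2) \<le> (norm (v - w))\<^sup>2"
      unfolding F0(3) orthonormal_diff_norm[OF E F0(1,2)] by (simp add: sum_nonneg)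
    moreover have "(\<Sum>e\<in>F0. (v \<bullet> e)\<^sup>2) \<le> (\<Sum>e\<in>F. (v \<bullet> e)\<^sup>2)"
      using F by (intro sum_mono2) auto
    ultimately show ?thesis using wless by linarith
  qed
  then show ?thesis using F0 by blast
qed

text \<open>Turns a bound that is uniform over finite sets of coordinates into a bound for the norm.
  Monotone convergence needs an increasing sequence of such sets, which is what countability of the
  basis provides.\<close>

lemma nn_integral_norm_le_parseval:
  fixes V :: "'a \<Rightarrow> 'h::{real_inner, second_countable_topology}"
  assumes E: "orthonormal_basis E" and [measurable]: "V \<in> borel_measurable M"
    and si: "\<And>e. e \<in> E \<Longrightarrow> square_integrable M (\<lambda>x. V x \<bullet> e)"
    and le: "\<And>F. finite F \<Longrightarrow> F \<subseteq> E \<Longrightarrow> (\<Sum>e\<in>F. \<integral>x. (V x \<bullet> e)\<^sup>2 \<partial>M) \<le> C"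
  shows "(\<integral>\<^sup>+x. ennreal ((norm (V x))\<^sup>2) \<partial>M) \<le> ennreal C"
proof -
  \<comment> \<open>Intersecting with E discards the arbitrary value of \<open>from_nat_into\<close>
    for an empty basis.\<close>
  define F where "F n = E \<inter> from_nat_into E ` {..n}" for n :: nat
  have F: "finite (F n)" "F n \<subseteq> E" for n by (auto simp: F_def)
  have Fmono: "F m \<subseteq> F n" if "m \<le> n" for m n using that by (auto simp: F_def)
  have cover: "\<forall>\<^sub>F n in sequentially. F0 \<subseteq> F n" if "finite F0" "F0 \<subseteq> E" for F0
    using that
  proof (induction F0 rule: finite_induct)
    case (insert e F0)
    have e: "e \<in> E" using insert.prems by simp
    obtain m where m: "from_nat_into E m = e"
      using from_nat_into_surj[OF orthonormal_basis_countable[OF E] e] by blast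
    have "\<forall>\<^sub>F n in sequentially. e \<in> F n"
      using eventually_ge_at_top[of m]
    proof eventually_elim
      case (elim n)
      have "from_nat_into E m \<in> from_nat_into E ` {..n}" using elim by (intro imageI) simp
      then show ?case unfolding m F_def using e by (rule IntI[rotated])
    qed
    moreover have "\<forall>\<^sub>F n in sequentially. F0 \<subseteq> F n" using insert.IH insert.prems by blast
    ultimately show ?case by eventually_elim blast
  qed simp
  have lim: "(\<lambda>n. \<Sum>e\<in>F n. (v \<bullet> e)\<^sup>2) \<longlonglongrightarrow> (norm v)\<^sup>2" for v
  proof (rule tendstoI)
    fix \<epsilon> :: real assume "\<epsilon> > 0"
    then obtain F0 where F0: "finite F0 \<and> F0 \<subseteq> E \<and>
        (\<forall>F. finite F \<and> F0 \<subseteq> F \<and> F \<subseteq> E \<longrightarrow> (norm v)\<^sup>2 - \<epsilon> < (\<Sum>e\<in>F. (v \<bullet> e)\<^sup>2))"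
      using parseval_approx[OF E] by meson
    show "\<forall>\<^sub>F n in sequentially. dist (\<Sum>e\<in>F n. (v \<bullet> e)\<^sup>2) ((norm v)\<^sup>2) < \<epsilon>"
      using cover[OF conjunct1[OF F0] conjunct1[OF conjunct2[OF F0]]]
    proof eventually_elim
      case (elim n)
      have "(norm v)\<^sup>2 - \<epsilon> < (\<Sum>e\<in>F n. (v \<bullet> e)\<^sup>2)" using F0 F elim by blast
      moreover have "(\<Sum>e\<in>F n. (v \<bullet> e)\<^sup>2) \<le> (norm v)\<^sup>2" by (rule bessel[OF E F])
      ultimately show ?case using \<open>\<epsilon> > 0\<close> unfolding dist_real_def by linarith
    qed
  qed
  have [measurable]: "(\<lambda>x. V x \<bullet> e) \<in> borel_measurable M" for e by measurable
  have "(\<lambda>n. \<integral>\<^sup>+x. ennreal (\<Sum>e\<in>F n. (V x \<bullet> e)\<^sup>2) \<partial>M) \<longlonglongrightarrow> (\<integral>\<^sup>+x. ennreal ((norm (V x))\<^sup>2) \<partial>M)"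
  proof (rule nn_integral_LIMSEQ)
    show "incseq (\<lambda>n x. ennreal (\<Sum>e\<in>F n. (V x \<bullet> e)\<^sup>2))"
      unfolding incseq_def le_fun_def
      by (intro allI impI ennreal_leI sum_mono2 F(1) Fmono) simp_all
    show "(\<lambda>n. ennreal (\<Sum>e\<in>F n. (V x \<bullet> e)\<^sup>2)) \<longlonglongrightarrow> ennreal ((norm (V x))\<^sup>2)" for x
      by (intro tendsto_ennrealI lim)
  qed measurable
  moreover have "(\<integral>\<^sup>+x. ennreal (\<Sum>e\<in>F n. (V x \<bullet> e)\<^sup>2) \<partial>M) \<le> ennreal C" for n
  proof -
    have i: "integrable M (\<lambda>x. (V x \<bullet> e)\<^sup>2)" if "e \<in> F n" for e
      using si[of e] that F(2) by (auto simp: square_integrable_def)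
    have "(\<integral>\<^sup>+x. ennreal (\<Sum>e\<in>F n. (V x \<bullet> e)\<^sup>2) \<partial>M) = ennreal (\<integral>x. (\<Sum>e\<in>F n. (V x \<bullet> e)\<^sup>2) \<partial>M)"
      by (intro nn_integral_eq_integral Bochner_Integration.integrable_sum i AE_I2 sum_nonneg) simp_all
    also have "(\<integral>x. (\<Sum>e\<in>F n. (V x \<bullet> e)\<^sup>2) \<partial>M) = (\<Sum>e\<in>F n. \<integral>x. (V x \<bullet> e)\<^sup>2 \<partial>M)"
      by (intro Bochner_Integration.integral_sum i)
    finally show ?thesis using le[OF F] by (simp add: ennreal_leI)
  qed
  ultimately show ?thesis by (meson LIMSEQ_le_const2)
qed

locale malliavin_family = gaussian_family M W E
  for M :: "'w measure" and W :: "'h::{real_inner, polish_space} \<Rightarrow> 'w \<Rightarrow> real" and E +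
  assumes basis: "orthonormal_basis E"
begin

lemma add_mset_indices: "\<alpha> \<in> indices \<Longrightarrow> e \<in> E \<Longrightarrow> add_mset e \<alpha> \<in> indices"
  by (auto simp: indices_def)

text \<open>Only the chaos of order n = \<open>size \<alpha> + 1\<close> contributes. Its contracted
  kernel yields (n - 1)! f, and the factor n in the series of \<open>DX\<close> completes this to n!
  f, the coefficient of X with e added.\<close>

lemma malliavin_derivative_coef:
  assumes DX: "malliavin_derivative M W E X DX" and e: "e \<in> E"
  shows "chaos_approx (\<lambda>\<omega>. DX \<omega> \<bullet> e)"
    and "\<alpha> \<in> indices \<Longrightarrow> coef (\<lambda>\<omega>. DX \<omega> \<bullet> e) \<alpha> = coef X (add_mset e \<alpha>)"
proof -
  obtain f J U where X: "chaos_expansion M W E X f J"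
    and U: "\<And>n. n \<ge> 1 \<Longrightarrow> multiple_wiener_integral M W E (n - 1) (\<lambda>es. f n (e # es)) (\<lambda>\<omega>. U n \<omega> \<bullet> e)"
    and lim: "L2_lim M (\<lambda>N \<omega>. \<Sum>n=1..N. real n *\<^sub>R U n \<omega>) DX sequentially"
    using DX e unfolding malliavin_derivative_def by blast
  note c = chaos_expansion_coef[OF X]
  have sym: "f n (e # es) = f n (e # es')"
    if "n \<ge> 1" "es \<in> basis_tuples E (n - 1)" "es' \<in> basis_tuples E (n - 1)" "mset es = mset es'" for n es es'
  proof -
    have "symmetric_kernel E n (f n)" using X by (simp add: chaos_expansion_def)
    moreover have "e # es \<in> basis_tuples E n" "e # es' \<in> basis_tuples E n"
      using that e by (auto simp: basis_tuples_def)
    ultimately show ?thesis using that(4) unfolding symmetric_kernel_def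
      by (metis mset.simps(2))
  qed
  have Uc: "chaos_approx (\<lambda>\<omega>. U n \<omega> \<bullet> e)"
    "es \<in> basis_tuples E (n - 1) \<Longrightarrow> coef (\<lambda>\<omega>. U n \<omega> \<bullet> e) (mset es) = fact (n - 1) * f n (e # es)"
    "\<alpha> \<in> indices \<Longrightarrow> size \<alpha> \<noteq> n - 1 \<Longrightarrow> coef (\<lambda>\<omega>. U n \<omega> \<bullet> e) \<alpha> = 0" if n: "n \<ge> 1" for n es \<alpha>
    using multiple_wiener_integral_coef[OF U[OF n]] sym[OF n] by blast+
  \<comment> \<open>Convergence in H passes to the coordinate along e, as e is a unit
    vector.\<close>
  have lim_e: "L2_lim M (\<lambda>N \<omega>. \<Sum>n=1..N. real n * (U n \<omega> \<bullet> e)) (\<lambda>\<omega>. DX \<omega> \<bullet> e) sequentially"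
  proof -
    have [measurable]: "\<And>N. (\<lambda>\<omega>. \<Sum>n=1..N. real n *\<^sub>R U n \<omega>) \<in> borel_measurable M" "DX \<in> borel_measurable M"
      and l: "(\<lambda>N. \<integral>\<^sup>+\<omega>. ennreal ((norm ((\<Sum>n=1..N. real n *\<^sub>R U n \<omega>) - DX \<omega>))\<^sup>2) \<partial>M) \<longlonglongrightarrow> 0"
      using lim by (auto simp: L2_lim_def)
    have eq: "(\<Sum>n=1..N. real n * (U n \<omega> \<bullet> e)) = (\<Sum>n=1..N. real n *\<^sub>R U n \<omega>) \<bullet> e" for N \<omega>
      by (simp add: inner_sum_left)
    have ne: "norm e = 1" using basis e by (simp add: orthonormal_basis_def)
    show ?thesis unfolding eq L2_lim_def
    proof (intro conjI allI)
      show "(\<lambda>N. \<integral>\<^sup>+\<omega>. ennreal ((norm ((\<Sum>n=1..N. real n *\<^sub>R U n \<omega>) \<bullet> e - DX \<omega> \<bullet> e))\<^sup>2) \<partial>M) \<longlonglongrightarrow> 0"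
      proof (rule tendsto_sandwich[OF _ _ tendsto_const l])
        have "norm (x \<bullet> e - y \<bullet> e) \<le> norm (x - y)" for x y :: 'h
          using Cauchy_Schwarz_ineq2[of "x - y" e] ne by (simp add: inner_diff_left)
        then show "\<forall>\<^sub>F N in sequentially.
            (\<integral>\<^sup>+\<omega>. ennreal ((norm ((\<Sum>n=1..N. real n *\<^sub>R U n \<omega>) \<bullet> e - DX \<omega> \<bullet> e))\<^sup>2) \<partial>M) \<le>
            (\<integral>\<^sup>+\<omega>. ennreal ((norm ((\<Sum>n=1..N. real n *\<^sub>R U n \<omega>) - DX \<omega>))\<^sup>2) \<partial>M)"
          by (intro always_eventually allI nn_integral_mono ennreal_leI power_mono) auto
      qed simp
    qed measurable
  qed
  have a: "\<forall>\<^sub>F N in sequentially. chaos_approx (\<lambda>\<omega>. \<Sum>n=1..N. real n * (U n \<omega> \<bullet> e))"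
    by (intro always_eventually allI chaos_approx_sum Uc) auto
  show "chaos_approx (\<lambda>\<omega>. DX \<omega> \<bullet> e)" by (rule L2_lim_chaos(1)[OF lim_e _ a]) simp
  show "coef (\<lambda>\<omega>. DX \<omega> \<bullet> e) \<alpha> = coef X (add_mset e \<alpha>)" if \<alpha>: "\<alpha> \<in> indices"
  proof -
    obtain es where es: "mset es = \<alpha>" "es \<in> basis_tuples E (size \<alpha>)" using indicesE[OF \<alpha>] .
    let ?n = "Suc (size \<alpha>)"
    have X1: "coef X (add_mset e \<alpha>) = fact ?n * f ?n (e # es)"
      using c(3)[of "e # es" ?n] es e by (auto simp: basis_tuples_def)
    have U1: "coef (\<lambda>\<omega>. U ?n \<omega> \<bullet> e) \<alpha> = fact (size \<alpha>) * f ?n (e # es)"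
      using Uc(2)[of ?n es] es by simp
    have "\<forall>\<^sub>F N in sequentially. coef (\<lambda>\<omega>. \<Sum>n=1..N. real n * (U n \<omega> \<bullet> e)) \<alpha> = coef X (add_mset e \<alpha>)"
      using eventually_ge_at_top[of ?n]
    proof eventually_elim
      case (elim N)
      have "coef (\<lambda>\<omega>. \<Sum>n=1..N. real n * (U n \<omega> \<bullet> e)) \<alpha> = (\<Sum>n=1..N. real n * coef (\<lambda>\<omega>. U n \<omega> \<bullet> e) \<alpha>)"
        by (intro coef_sum \<alpha>) (use Uc(1) in \<open>auto simp: chaos_approx_def\<close>)
      also have "\<dots> = (\<Sum>n=1..N. if n = ?n then real n * coef (\<lambda>\<omega>. U n \<omega> \<bullet> e) \<alpha> else 0)"
        using Uc(3)[OF _ \<alpha>] by (intro sum.cong) auto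
      also have "\<dots> = real ?n * coef (\<lambda>\<omega>. U ?n \<omega> \<bullet> e) \<alpha>" using elim by simp
      finally show ?case by (simp add: U1 X1 algebra_simps)
    qed
    then have "(\<lambda>N. coef (\<lambda>\<omega>. \<Sum>n=1..N. real n * (U n \<omega> \<bullet> e)) \<alpha>) \<longlonglongrightarrow> coef X (add_mset e \<alpha>)"
      by (rule tendsto_eventually)
    moreover have "(\<lambda>N. coef (\<lambda>\<omega>. \<Sum>n=1..N. real n * (U n \<omega> \<bullet> e)) \<alpha>) \<longlonglongrightarrow> coef (\<lambda>\<omega>. DX \<omega> \<bullet> e) \<alpha>"
      by (rule L2_lim_chaos(2)[OF lim_e _ a \<alpha>]) simp
    ultimately show ?thesis using LIMSEQ_unique by blast
  qed
qed

text \<open>The defining series of the Sobolev norm, regrouped from orders n to multi-indices of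
  size n. Finite families of indices suffice, since the terms are nonnegative.\<close>

lemma malliavin_D12_weights:
  assumes "X \<in> malliavin_D12 M W E"
  shows "(\<lambda>\<alpha>. real (size \<alpha>) * (coef X \<alpha>)\<^sup>2 / mset_fact \<alpha>) summable_on indices"
proof -
  obtain f J where X: "chaos_expansion M W E X f J"
    and sm: "summable (\<lambda>n. real n * fact n * kernel_norm2 E n (f n))"
    using assms by (auto simp: malliavin_D12_def)
  note c = chaos_expansion_coef[OF X]
  let ?w = "\<lambda>\<alpha>. (coef X \<alpha>)\<^sup>2 / mset_fact \<alpha>"
  have kn: "kernel E n (f n)" for n using X by (simp add: chaos_expansion_def symmetric_kernel_def)
  have level: "(\<Sum>\<alpha> | \<alpha> \<in> T \<and> size \<alpha> = n. ?w \<alpha>) \<le> fact n * kernel_norm2 E n (f n)"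
    if T: "finite T" "T \<subseteq> indices" for T n
  proof -
    let ?T = "{\<alpha> \<in> T. size \<alpha> = n}"
    let ?L = "\<Union>\<alpha>\<in>?T. permutations_of_multiset \<alpha>"
    have sub: "permutations_of_multiset \<alpha> \<subseteq> basis_tuples E n" if "\<alpha> \<in> ?T" for \<alpha>
    proof
      fix es assume "es \<in> permutations_of_multiset \<alpha>"
      then have "mset es = \<alpha>" by (simp add: permutations_of_multiset_def)
      moreover have "set_mset \<alpha> \<subseteq> E" "size \<alpha> = n" using that T by (auto simp: indices_def)
      ultimately show "es \<in> basis_tuples E n" by (auto simp: basis_tuples_def)
    qed
    \<comment> \<open>There are n! / \<alpha>! orderings of \<alpha>, and on each of them the kernel
      equals \<open>coef X \<alpha> / fact n\<close>.\<close>
    have perm: "fact n * (\<Sum>es\<in>permutations_of_multiset \<alpha>. (f n es)\<^sup>2) = ?w \<alpha>" if \<alpha>: "\<alpha> \<in> ?T" for \<alpha>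
    proof -
      have card: "real (card (permutations_of_multiset \<alpha>)) * mset_fact \<alpha> = fact n"
      proof -
        have "real (card (permutations_of_multiset \<alpha>) * (\<Prod>x\<in>set_mset \<alpha>. fact (count \<alpha> x))) = fact n"
          using \<alpha> by (simp only: card_permutations_of_multiset_aux) simp
        then show ?thesis by (simp add: mset_fact_def)
      qed
      have "(\<Sum>es\<in>permutations_of_multiset \<alpha>. (f n es)\<^sup>2) =
          (\<Sum>es\<in>permutations_of_multiset \<alpha>. (coef X \<alpha> / fact n)\<^sup>2)"
      proof (intro sum.cong refl)
        fix es assume es: "es \<in> permutations_of_multiset \<alpha>"
        then have "coef X \<alpha> = fact n * f n es"
          using c(3)[of es n] sub[OF \<alpha>] by (auto simp: permutations_of_multiset_def)
        then show "(f n es)\<^sup>2 = (coef X \<alpha> / fact n)\<^sup>2" by simp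
      qed
      then have "fact n * (\<Sum>es\<in>permutations_of_multiset \<alpha>. (f n es)\<^sup>2) =
          real (card (permutations_of_multiset \<alpha>)) * (coef X \<alpha>)\<^sup>2 / fact n"
        by (simp add: power2_eq_square field_simps)
      also have "\<dots> = ?w \<alpha>" unfolding card[symmetric] using mset_fact_nonzero[of \<alpha>]
        by (auto simp: field_simps)
      finally show ?thesis .
    qed
    have "(\<Sum>\<alpha>\<in>?T. ?w \<alpha>) = (\<Sum>\<alpha>\<in>?T. fact n * (\<Sum>es\<in>permutations_of_multiset \<alpha>. (f n es)\<^sup>2))"
      using perm by (intro sum.cong) auto
    also have "\<dots> = fact n * (\<Sum>\<alpha>\<in>?T. \<Sum>es\<in>permutations_of_multiset \<alpha>. (f n es)\<^sup>2)"
      by (simp add: sum_distrib_left)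
    also have "(\<Sum>\<alpha>\<in>?T. \<Sum>es\<in>permutations_of_multiset \<alpha>. (f n es)\<^sup>2) = (\<Sum>es\<in>?L. (f n es)\<^sup>2)"
      by (intro sum.UNION_disjoint[symmetric])
        (use T in simp, simp, auto simp: permutations_of_multiset_def)
    also have "\<dots> \<le> kernel_norm2 E n (f n)"
      unfolding kernel_norm2_def
      using kn[of n] T sub by (intro finite_sum_le_infsum) (auto simp: kernel_def)
    finally show ?thesis by simp
  qed
  have kn0: "0 \<le> kernel_norm2 E n (f n)" for n
    unfolding kernel_norm2_def by (rule infsum_nonneg) simp
  show ?thesis
  proof (rule nonneg_bounded_partial_sums_imp_summable_on)
    show "\<forall>\<^sub>F T in finite_subsets_at_top indices. (\<Sum>\<alpha>\<in>T. real (size \<alpha>) * (coef X \<alpha>)\<^sup>2 / mset_fact \<alpha>) \<le>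
        (\<Sum>n. real n * fact n * kernel_norm2 E n (f n))"
      unfolding eventually_finite_subsets_at_top
    proof (intro exI[of _ "{}"] conjI allI impI)
      fix T assume "finite T \<and> {} \<subseteq> T \<and> T \<subseteq> indices"
      then have T: "finite T" "T \<subseteq> indices" by auto
      have "(\<Sum>\<alpha>\<in>T. real (size \<alpha>) * (coef X \<alpha>)\<^sup>2 / mset_fact \<alpha>) =
          (\<Sum>n\<in>size ` T. \<Sum>\<alpha> | \<alpha> \<in> T \<and> size \<alpha> = n. real (size \<alpha>) * ?w \<alpha>)"
        using T by (subst sum.group) auto
      also have "\<dots> = (\<Sum>n\<in>size ` T. real n * (\<Sum>\<alpha> | \<alpha> \<in> T \<and> size \<alpha> = n. ?w \<alpha>))"
        by (intro sum.cong refl) (auto simp: sum_distrib_left intro!: sum.cong)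
      also have "\<dots> \<le> (\<Sum>n\<in>size ` T. real n * (fact n * kernel_norm2 E n (f n)))"
        by (intro sum_mono mult_left_mono level T) auto
      also have "\<dots> \<le> (\<Sum>n. real n * fact n * kernel_norm2 E n (f n))"
        using T kn0 by (subst mult.assoc[symmetric]) (intro sum_le_suminf sm, auto)
      finally show "(\<Sum>\<alpha>\<in>T. real (size \<alpha>) * (coef X \<alpha>)\<^sup>2 / mset_fact \<alpha>) \<le>
          (\<Sum>n. real n * fact n * kernel_norm2 E n (f n))" .
    qed auto
  qed (auto intro!: divide_nonneg_pos mset_fact_pos)
qed

end

lemma square_integrable_norm_le:
  fixes V :: "'a \<Rightarrow> 'b::{real_normed_vector, second_countable_topology}"
  assumes [measurable]: "V \<in> borel_measurable M"
    and le: "(\<integral>\<^sup>+x. ennreal ((norm (V x))\<^sup>2) \<partial>M) \<le> ennreal C" and C: "0 \<le> C"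
  shows "square_integrable M (\<lambda>x. norm (V x))" "(\<integral>x. (norm (V x))\<^sup>2 \<partial>M) \<le> C"
proof -
  have i: "integrable M (\<lambda>x. (norm (V x))\<^sup>2)"
    by (rule integrableI_bounded) (use le in \<open>auto intro: le_less_trans\<close>)
  then show "square_integrable M (\<lambda>x. norm (V x))" by (simp add: square_integrable_def)
  show "(\<integral>x. (norm (V x))\<^sup>2 \<partial>M) \<le> C"
    using le i C by (subst (asm) nn_integral_eq_integral) auto
qed

section \<open>Gradients of finite Hermite sums and their convergence to \<open>DX\<close>\<close>

context malliavin_family
begin

text \<open>The partial derivative in direction e of the polynomial \<open>herm_sum c D\<close>,
  evaluated at the coordinates \<open>W\<close>.\<close>

definition grad_sum :: "('h multiset \<Rightarrow> real) \<Rightarrow> 'h multiset set \<Rightarrow> 'h \<Rightarrow> 'w \<Rightarrow> real" where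
  "grad_sum c D e \<omega> = (\<Sum>\<alpha>\<in>D. c \<alpha> * (real (count \<alpha> e) * herm (\<alpha> - {#e#}) \<omega>))"

definition gradient :: "('h multiset \<Rightarrow> real) \<Rightarrow> 'h multiset set \<Rightarrow> 'w \<Rightarrow> 'h" where
  "gradient c D \<omega> = (\<Sum>e\<in>(\<Union>\<alpha>\<in>D. set_mset \<alpha>). grad_sum c D e \<omega> *\<^sub>R e)"

definition chaos_coef :: "('w \<Rightarrow> real) \<Rightarrow> 'h multiset \<Rightarrow> real" where
  "chaos_coef X \<alpha> = coef X \<alpha> / mset_fact \<alpha>"

lemma finite_add_mset_vimage: "finite D \<Longrightarrow> finite {\<beta>. add_mset e \<beta> \<in> D}"
  using finite_vimageI[of D "add_mset e"] by (simp add: vimage_def inj_def)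

lemma add_mset_vimage_indices: "D \<subseteq> indices \<Longrightarrow> {\<beta>. add_mset e \<beta> \<in> D} \<subseteq> indices"
  unfolding indices_def by fastforce

text \<open>Only indices containing e survive differentiation, and these are written uniquely as
  \<open>add_mset e \<beta>\<close>.\<close>

lemma sum_add_mset_vimage:
  assumes "finite D" "\<And>\<alpha>. e \<notin># \<alpha> \<Longrightarrow> G \<alpha> = 0"
  shows "(\<Sum>\<alpha>\<in>D. G \<alpha>) = (\<Sum>\<beta> | add_mset e \<beta> \<in> D. G (add_mset e \<beta>) :: real)"
proof -
  have "(\<Sum>\<alpha>\<in>D. G \<alpha>) = (\<Sum>\<alpha>\<in>add_mset e ` {\<beta>. add_mset e \<beta> \<in> D}. G \<alpha>)"
  proof (rule sum.mono_neutral_right[OF assms(1)])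
    show "\<forall>\<alpha>\<in>D - add_mset e ` {\<beta>. add_mset e \<beta> \<in> D}. G \<alpha> = 0"
    proof
      fix \<alpha> assume \<alpha>: "\<alpha> \<in> D - add_mset e ` {\<beta>. add_mset e \<beta> \<in> D}"
      have "e \<notin># \<alpha>"
      proof
        assume "e \<in># \<alpha>"
        then obtain \<beta> where "\<alpha> = add_mset e \<beta>" by (metis insert_DiffM)
        then show False using \<alpha> by auto
      qed
      then show "G \<alpha> = 0" by (rule assms(2))
    qed
  qed auto
  then show ?thesis by (simp add: sum.reindex inj_on_def)
qed

lemma grad_sum_eq_herm_sum:
  assumes "finite D"
  shows "grad_sum c D e = herm_sum (\<lambda>\<beta>. c (add_mset e \<beta>) * real (Suc (count \<beta> e))) {\<beta>. add_mset e \<beta> \<in> D}"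
  unfolding grad_sum_def[abs_def] herm_sum_def[abs_def]
  by (subst sum_add_mset_vimage[OF assms]) (auto simp: not_in_iff mult.assoc)

lemma square_integrable_grad_sum: "finite D \<Longrightarrow> D \<subseteq> indices \<Longrightarrow> square_integrable M (grad_sum c D e)"
  by (simp add: grad_sum_eq_herm_sum square_integrable_herm_sum add_mset_vimage_indices)

lemma inner_gradient:
  assumes D: "finite D" "D \<subseteq> indices" and e: "e \<in> E"
  shows "gradient c D \<omega> \<bullet> e = grad_sum c D e \<omega>"
proof -
  let ?S = "\<Union>\<alpha>\<in>D. set_mset \<alpha>"
  have S: "finite ?S" "?S \<subseteq> E" using D by (auto simp: indices_def)
  have "gradient c D \<omega> \<bullet> e = (\<Sum>e'\<in>?S. if e' = e then grad_sum c D e \<omega> else 0)"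
    unfolding gradient_def inner_sum_left
    using S orthonormal_basis_inner[OF basis] e by (intro sum.cong) (auto simp: subset_eq)
  also have "\<dots> = (if e \<in> ?S then grad_sum c D e \<omega> else 0)" using S by simp
  also have "\<dots> = grad_sum c D e \<omega>"
    by (auto simp: grad_sum_def not_in_iff intro!: sum.neutral)
  finally show ?thesis .
qed

lemma borel_measurable_gradient [measurable]:
  assumes "finite D" "D \<subseteq> indices"
  shows "gradient c D \<in> borel_measurable M"
proof -
  have [measurable]: "grad_sum c D e \<in> borel_measurable M" for e
    using square_integrable_grad_sum[OF assms] by (rule square_integrable_measurable)
  show ?thesis unfolding gradient_def[abs_def] by measurable
qed

lemma inner_gradients:
  assumes "finite D" "D \<subseteq> indices"
  shows "gradient c D \<omega> \<bullet> gradient c' D \<omega> = (\<Sum>e\<in>(\<Union>\<alpha>\<in>D. set_mset \<alpha>). grad_sum c D e \<omega> * grad_sum c' D e \<omega>)"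
  unfolding gradient_def[of c] inner_sum_left
  using assms by (intro sum.cong) (auto simp: inner_gradient[OF assms] inner_commute[of _ "gradient c' D \<omega>"] indices_def subset_eq)

context
  fixes X :: "'w \<Rightarrow> real" and DX :: "'w \<Rightarrow> 'h"
  assumes DX: "malliavin_derivative M W E X DX"
begin

lemma borel_measurable_malliavin_derivative [measurable]: "DX \<in> borel_measurable M"
  using DX by (auto simp: malliavin_derivative_def L2_lim_def)

text \<open>Differentiation brings down the multiplicity of e in \<open>add_mset e \<beta>\<close>,
  and this cancels the factor by which \<open>mset_fact\<close> grows when e is added to \<beta>.
  What is left is the shift rule of \<open>malliavin_derivative_coef\<close>.\<close>

lemma grad_sum_eq_partial_sum:
  assumes D: "finite D" "D \<subseteq> indices" and e: "e \<in> E"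
  shows "grad_sum (chaos_coef X) D e = partial_sum (\<lambda>\<omega>. DX \<omega> \<bullet> e) {\<beta>. add_mset e \<beta> \<in> D}"
  unfolding grad_sum_eq_herm_sum[OF D(1)] partial_sum_def herm_sum_def[abs_def]
proof (intro ext sum.cong refl)
  fix \<omega> \<beta> assume "\<beta> \<in> {\<beta>. add_mset e \<beta> \<in> D}"
  then have "\<beta> \<in> indices" using add_mset_vimage_indices[OF D(2)] by blast
  then show "chaos_coef X (add_mset e \<beta>) * real (Suc (count \<beta> e)) * herm \<beta> \<omega> =
      coef (\<lambda>\<omega>. DX \<omega> \<bullet> e) \<beta> / mset_fact \<beta> * herm \<beta> \<omega>"
    using malliavin_derivative_coef(2)[OF DX e]
    by (simp add: chaos_coef_def mset_fact_add_mset del: of_nat_Suc)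
qed

text \<open>This concerns a single direction and carries no uniformity in e. The uniform statement
  is obtained below by means of the D12 weights.\<close>

lemma gradient_error_tendsto:
  assumes e: "e \<in> E"
  shows "((\<lambda>D. \<integral>\<omega>. (grad_sum (chaos_coef X) D e \<omega> - DX \<omega> \<bullet> e)\<^sup>2 \<partial>M) \<longlongrightarrow> 0) (finite_subsets_at_top indices)"
proof -
  let ?F = "finite_subsets_at_top indices"
  have "filterlim (\<lambda>D. {\<beta>. add_mset e \<beta> \<in> D}) ?F ?F"
    unfolding filterlim_finite_subsets_at_top
  proof (intro allI impI)
    fix T assume T: "finite T \<and> T \<subseteq> indices"
    show "\<forall>\<^sub>F D in ?F. finite {\<beta>. add_mset e \<beta> \<in> D} \<and> T \<subseteq> {\<beta>. add_mset e \<beta> \<in> D} \<and>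
        {\<beta>. add_mset e \<beta> \<in> D} \<subseteq> indices"
      unfolding eventually_finite_subsets_at_top
      using T e add_mset_indices
      by (intro exI[of _ "add_mset e ` T"])
        (auto intro!: finite_add_mset_vimage dest: subsetD[OF add_mset_vimage_indices])
  qed
  from filterlim_compose[OF partial_sum_tendsto[OF malliavin_derivative_coef(1)[OF DX e]] this]
  show ?thesis
    by (rule Lim_transform_eventually)
      (auto simp: eventually_finite_subsets_at_top grad_sum_eq_partial_sum[OF _ _ e] intro!: exI[of _ "{}"])
qed

text \<open>Both errors equal the second moment of \<open>DX \<omega> \<bullet> e\<close> minus a
  sum of squared coefficients. In terms of the indices of X, the term at \<alpha> carries the weight
  \<open>count \<alpha> e\<close>, which sums to the size of \<alpha> over all directions.\<close>

lemma gradient_error_diff: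
  assumes D: "finite D'" "D \<subseteq> D'" "D' \<subseteq> indices" and e: "e \<in> E"
  shows "(\<integral>\<omega>. (grad_sum (chaos_coef X) D e \<omega> - DX \<omega> \<bullet> e)\<^sup>2 \<partial>M) =
    (\<integral>\<omega>. (grad_sum (chaos_coef X) D' e \<omega> - DX \<omega> \<bullet> e)\<^sup>2 \<partial>M) +
    (\<Sum>\<alpha>\<in>D' - D. real (count \<alpha> e) * (coef X \<alpha>)\<^sup>2 / mset_fact \<alpha>)"
proof -
  let ?V = "\<lambda>\<omega>. DX \<omega> \<bullet> e"
  let ?G = "\<lambda>\<alpha>. real (count \<alpha> e) * (coef X \<alpha>)\<^sup>2 / mset_fact \<alpha>"
  have V: "square_integrable M ?V" using malliavin_derivative_coef(1)[OF DX e] by (simp add: chaos_approx_def)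
  have *: "(\<integral>\<omega>. (grad_sum (chaos_coef X) T e \<omega> - DX \<omega> \<bullet> e)\<^sup>2 \<partial>M) =
      (\<integral>\<omega>. (?V \<omega>)\<^sup>2 \<partial>M) - (\<Sum>\<alpha>\<in>T. ?G \<alpha>)" if T: "finite T" "T \<subseteq> indices" for T
  proof -
    have "(\<Sum>\<alpha>\<in>T. ?G \<alpha>) = (\<Sum>\<beta> | add_mset e \<beta> \<in> T. ?G (add_mset e \<beta>))"
      by (rule sum_add_mset_vimage[OF T(1)]) (simp add: not_in_iff)
    also have "\<dots> = (\<Sum>\<beta> | add_mset e \<beta> \<in> T. (coef ?V \<beta>)\<^sup>2 / mset_fact \<beta>)"
    proof (intro sum.cong refl)
      fix \<beta> assume "\<beta> \<in> {\<beta>. add_mset e \<beta> \<in> T}"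
      then have "\<beta> \<in> indices" using add_mset_vimage_indices[OF T(2)] by blast
      then show "?G (add_mset e \<beta>) = (coef ?V \<beta>)\<^sup>2 / mset_fact \<beta>"
        using malliavin_derivative_coef(2)[OF DX e]
        by (simp add: mset_fact_add_mset del: of_nat_Suc)
    qed
    finally show ?thesis
      unfolding grad_sum_eq_partial_sum[OF T e] partial_sum_def
      by (subst projection_error[OF finite_add_mset_vimage[OF T(1)] add_mset_vimage_indices[OF T(2)] V]) simp
  qed
  have "(\<Sum>\<alpha>\<in>D'. ?G \<alpha>) = (\<Sum>\<alpha>\<in>D' - D. ?G \<alpha>) + (\<Sum>\<alpha>\<in>D. ?G \<alpha>)"
    using D by (intro sum.subset_diff) auto
  then show ?thesis
    using *[of D] *[of D'] D finite_subset[OF D(2,1)] by auto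
qed

text \<open>By the previous lemma the error at \<open>D\<close> is the error at \<open>D' \<supseteq> D\<close>, which vanishes in the limit, plus
  a part of the tail of the weights.\<close>

lemma gradient_error_le:
  assumes D: "finite D" "D \<subseteq> indices"
    and C: "\<And>T. finite T \<Longrightarrow> T \<subseteq> indices - D \<Longrightarrow> (\<Sum>\<alpha>\<in>T. real (size \<alpha>) * (coef X \<alpha>)\<^sup>2 / mset_fact \<alpha>) \<le> C"
  shows "(\<integral>\<^sup>+\<omega>. ennreal ((norm (gradient (chaos_coef X) D \<omega> - DX \<omega>))\<^sup>2) \<partial>M) \<le> ennreal C"
proof (rule nn_integral_norm_le_parseval[OF basis])
  show "(\<lambda>\<omega>. gradient (chaos_coef X) D \<omega> - DX \<omega>) \<in> borel_measurable M"
    using D by measurable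
  have eq: "(gradient (chaos_coef X) D \<omega> - DX \<omega>) \<bullet> e = grad_sum (chaos_coef X) D e \<omega> - DX \<omega> \<bullet> e"
    if "e \<in> E" for e \<omega> using that by (simp add: inner_diff_left inner_gradient[OF D])
  show "square_integrable M (\<lambda>\<omega>. (gradient (chaos_coef X) D \<omega> - DX \<omega>) \<bullet> e)" if e: "e \<in> E" for e
    unfolding eq[OF e]
    using malliavin_derivative_coef(1)[OF DX e]
    by (intro square_integrable_diff square_integrable_grad_sum D) (simp add: chaos_approx_def)
  fix F assume F: "finite F" "F \<subseteq> E"
  let ?err = "\<lambda>D. \<Sum>e\<in>F. \<integral>\<omega>. (grad_sum (chaos_coef X) D e \<omega> - DX \<omega> \<bullet> e)\<^sup>2 \<partial>M"
  have "?err D \<le> C"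
  proof (rule tendsto_lowerbound)
    show "((\<lambda>D'. ?err D' + C) \<longlongrightarrow> C) (finite_subsets_at_top indices)"
    proof -
      have "(?err \<longlongrightarrow> (\<Sum>e\<in>F. 0)) (finite_subsets_at_top indices)"
        using F by (intro tendsto_sum gradient_error_tendsto) auto
      from tendsto_add[OF this tendsto_const[of C]] show ?thesis by simp
    qed
    have "?err D \<le> ?err D' + C" if D': "finite D'" "D \<subseteq> D'" "D' \<subseteq> indices" for D'
    proof -
      have "?err D = ?err D' + (\<Sum>e\<in>F. \<Sum>\<alpha>\<in>D' - D. real (count \<alpha> e) * (coef X \<alpha>)\<^sup>2 / mset_fact \<alpha>)"
        unfolding sum.distrib[symmetric]
        using F by (intro sum.cong refl gradient_error_diff[OF D']) auto
      also have "(\<Sum>e\<in>F. \<Sum>\<alpha>\<in>D' - D. real (count \<alpha> e) * (coef X \<alpha>)\<^sup>2 / mset_fact \<alpha>) =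
          (\<Sum>\<alpha>\<in>D' - D. (\<Sum>e\<in>F. real (count \<alpha> e)) * ((coef X \<alpha>)\<^sup>2 / mset_fact \<alpha>))"
        by (subst sum.swap) (simp add: sum_distrib_right sum_divide_distrib)
      \<comment> \<open>The directions in F account for at most \<open>size \<alpha>\<close>
        occurrences, and this is where the weight of the Sobolev norm enters, independently of
        F.\<close>
      also have "\<dots> \<le> (\<Sum>\<alpha>\<in>D' - D. real (size \<alpha>) * ((coef X \<alpha>)\<^sup>2 / mset_fact \<alpha>))"
      proof (intro sum_mono mult_right_mono)
        fix \<alpha>
        have "(\<Sum>e\<in>F. count \<alpha> e) = (\<Sum>e\<in>F \<inter> set_mset \<alpha>. count \<alpha> e)"
          using F by (intro sum.mono_neutral_right) (auto simp: not_in_iff)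
        also have "\<dots> \<le> size \<alpha>"
          unfolding size_multiset_overloaded_eq by (intro sum_mono2) auto
        finally show "(\<Sum>e\<in>F. real (count \<alpha> e)) \<le> real (size \<alpha>)"
          by (metis of_nat_le_iff of_nat_sum)
        show "0 \<le> (coef X \<alpha>)\<^sup>2 / mset_fact \<alpha>" by (auto intro: divide_nonneg_pos mset_fact_pos)
      qed
      also have "\<dots> \<le> C" using C[of "D' - D"] D' by auto
      finally show ?thesis by simp
    qed
    then show "\<forall>\<^sub>F D' in finite_subsets_at_top indices. ?err D \<le> ?err D' + C"
      unfolding eventually_finite_subsets_at_top using D by blast
  qed simp
  moreover have "(\<Sum>e\<in>F. \<integral>\<omega>. ((gradient (chaos_coef X) D \<omega> - DX \<omega>) \<bullet> e)\<^sup>2 \<partial>M) = ?err D"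
    using F eq by (intro sum.cong refl) auto
  ultimately show "(\<Sum>e\<in>F. \<integral>\<omega>. ((gradient (chaos_coef X) D \<omega> - DX \<omega>) \<bullet> e)\<^sup>2 \<partial>M) \<le> C" by simp
qed

lemma malliavin_weights_summable:
  "(\<lambda>\<alpha>. real (size \<alpha>) * (coef X \<alpha>)\<^sup>2 / mset_fact \<alpha>) summable_on indices"
  using DX by (intro malliavin_D12_weights) (simp add: malliavin_derivative_def)

lemma malliavin_weights_nonneg: "0 \<le> real (size \<alpha>) * (coef X \<alpha>)\<^sup>2 / mset_fact \<alpha>"
  by (auto intro!: divide_nonneg_pos mset_fact_pos)

lemma square_integrable_malliavin_derivative: "square_integrable M (\<lambda>\<omega>. norm (DX \<omega>))"
proof (rule square_integrable_norm_le(1))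
  let ?C = "\<Sum>\<^sub>\<infinity>\<alpha>\<in>indices. real (size \<alpha>) * (coef X \<alpha>)\<^sup>2 / mset_fact \<alpha>"
  show "0 \<le> ?C" by (intro infsum_nonneg malliavin_weights_nonneg)
  show "(\<integral>\<^sup>+\<omega>. ennreal ((norm (DX \<omega>))\<^sup>2) \<partial>M) \<le> ennreal ?C"
    \<comment> \<open>For the empty index set the gradient is 0, so the error is the norm of
      \<open>DX\<close> itself.\<close>
    using gradient_error_le[of "{}" ?C]
    by (simp add: gradient_def finite_sum_le_infsum malliavin_weights_summable malliavin_weights_nonneg)
qed measurable

lemma gradient_converges:
  assumes "\<epsilon> > 0"
  shows "\<forall>\<^sub>F D in finite_subsets_at_top indices.
    square_integrable M (\<lambda>\<omega>. norm (gradient (chaos_coef X) D \<omega> - DX \<omega>)) \<and>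
    (\<integral>\<omega>. (norm (gradient (chaos_coef X) D \<omega> - DX \<omega>))\<^sup>2 \<partial>M) \<le> \<epsilon>"
proof -
  let ?w = "\<lambda>\<alpha>. real (size \<alpha>) * (coef X \<alpha>)\<^sup>2 / mset_fact \<alpha>"
  let ?F = "finite_subsets_at_top indices"
  have "(sum ?w \<longlongrightarrow> infsum ?w indices) ?F"
    using malliavin_weights_summable by (rule infsum_tendsto)
  then have "\<forall>\<^sub>F D in ?F. dist (sum ?w D) (infsum ?w indices) < \<epsilon>"
    using assms by (rule tendstoD)
  moreover have "\<forall>\<^sub>F D in ?F. finite D \<and> D \<subseteq> indices"
    by (auto simp: eventually_finite_subsets_at_top)
  ultimately show ?thesis
  proof eventually_elim
    case (elim D)
    then have D: "finite D" "D \<subseteq> indices" by auto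
    \<comment> \<open>A set D that captures the total weight up to \<epsilon> leaves at most
      \<epsilon> to any finite T disjoint from it.\<close>
    have "sum ?w T \<le> \<epsilon>" if T: "finite T" "T \<subseteq> indices - D" for T
    proof -
      have "sum ?w T + sum ?w D = sum ?w (T \<union> D)"
        using T D by (intro sum.union_disjoint[symmetric]) auto
      also have "\<dots> \<le> infsum ?w indices"
        using T D by (intro finite_sum_le_infsum malliavin_weights_summable malliavin_weights_nonneg) auto
      finally show ?thesis using elim by (auto simp: dist_real_def)
    qed
    note le = gradient_error_le[OF D this]
    have m: "(\<lambda>\<omega>. gradient (chaos_coef X) D \<omega> - DX \<omega>) \<in> borel_measurable M" using D by measurable
    show ?case using square_integrable_norm_le[OF m le] assms by auto
  qed
qed

end

end

section \<open>Integration by parts for the Malliavin derivative\<close>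

lemma has_real_derivative_continuous_measurable:
  assumes "\<And>x. (\<phi> has_real_derivative \<psi> x) (at x)"
  shows "continuous_on UNIV \<phi>" "\<phi> \<in> borel_measurable borel"
proof -
  show "continuous_on UNIV \<phi>" using assms by (meson DERIV_isCont continuous_at_imp_continuous_on)
  then show "\<phi> \<in> borel_measurable borel" by (rule borel_measurable_continuous_onI)
qed

lemma integral_mult_le_of_square_bounds:
  assumes "square_integrable M f" "square_integrable M g"
    and "(\<integral>x. (f x)\<^sup>2 \<partial>M) \<le> \<epsilon>\<^sup>2" "(\<integral>x. (g x)\<^sup>2 \<partial>M) \<le> K\<^sup>2" "0 \<le> \<epsilon>" "0 \<le> K"
  shows "(\<integral>x. f x * g x \<partial>M) \<le> \<epsilon> * K"
proof -
  have "(\<integral>x. f x * g x \<partial>M)\<^sup>2 \<le> (\<integral>x. (f x)\<^sup>2 \<partial>M) * (\<integral>x. (g x)\<^sup>2 \<partial>M)"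
    by (rule integral_Cauchy_Schwarz[OF assms(1,2)])
  also have "\<dots> \<le> \<epsilon>\<^sup>2 * K\<^sup>2" by (intro mult_mono assms) auto
  finally have "(\<integral>x. f x * g x \<partial>M)\<^sup>2 \<le> (\<epsilon> * K)\<^sup>2" by (simp add: power_mult_distrib)
  then show ?thesis by (rule power2_le_imp_le) (simp add: assms)
qed

lemma abs_integral_le_integral:
  fixes f :: "'a \<Rightarrow> real"
  assumes "integrable M f" "integrable M g" "\<And>x. \<bar>f x\<bar> \<le> g x"
  shows "\<bar>\<integral>x. f x \<partial>M\<bar> \<le> (\<integral>x. g x \<partial>M)"
  using assms by (intro order_trans[OF integral_abs_bound integral_mono]) auto

context malliavin_family
begin

text \<open>The coefficients c' are those of the pseudo-inverse applied to P. Since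
  \<open>size \<alpha>\<close> is the sum of the multiplicities in \<alpha>, each term of P splits
  over the directions e, and integrating by parts in direction e produces the partial derivative of
  P times that of the term with coefficient c'. At the empty index \<open>cc'\<close> makes c
  vanish, that is, P is centered.\<close>

lemma finite_chaos_integration_by_parts:
  assumes D: "finite D" "D \<subseteq> indices"
    and cc': "\<And>\<alpha>. \<alpha> \<in> D \<Longrightarrow> c \<alpha> = real (size \<alpha>) * c' \<alpha>"
    and deriv: "\<And>x. (\<phi> has_real_derivative \<psi> x) (at x)" and cont: "continuous_on UNIV \<psi>"
    and bound: "\<And>x. \<bar>\<phi> x\<bar> \<le> K" "\<And>x. \<bar>\<psi> x\<bar> \<le> L"
  defines "P \<equiv> herm_sum c D"
  shows "(\<integral>\<omega>. \<phi> (P \<omega>) * P \<omega> \<partial>M) = (\<integral>\<omega>. \<psi> (P \<omega>) * (gradient c D \<omega> \<bullet> gradient c' D \<omega>) \<partial>M)"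
proof -
  let ?S = "\<Union>\<alpha>\<in>D. set_mset \<alpha>"
  have S: "finite ?S" using D by auto
  have DE: "set_mset \<alpha> \<subseteq> E" if "\<alpha> \<in> D" for \<alpha> using that D by (auto simp: indices_def)
  have [measurable]: "\<phi> \<in> borel_measurable borel" "\<psi> \<in> borel_measurable borel"
    using has_real_derivative_continuous_measurable[OF deriv] cont by (auto intro: borel_measurable_continuous_onI)
  have [measurable]: "P \<in> borel_measurable M"
    unfolding P_def by (rule square_integrable_measurable[OF square_integrable_herm_sum[OF D(2)]])
  have one: "square_integrable M (\<lambda>_. 1::real)" by (simp add: square_integrable_def)
  have i\<phi>: "integrable M (\<lambda>\<omega>. \<phi> (P \<omega>) * herm \<alpha> \<omega>)" if "set_mset \<alpha> \<subseteq> E" for \<alpha>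
    using square_integrable_mult_integrable[OF one square_integrable_bounded_mult[OF square_integrable_herm[OF that], of "\<lambda>\<omega>. \<phi> (P \<omega>)" K]] bound(1)
    by simp
  have s\<psi>: "square_integrable M (\<lambda>\<omega>. \<psi> (P \<omega>) * grad_sum c D e \<omega>)" for e
    by (rule square_integrable_bounded_mult[OF square_integrable_grad_sum[OF D]]) (use bound(2) in auto)
  have i\<psi>: "integrable M (\<lambda>\<omega>. \<psi> (P \<omega>) * grad_sum c D e \<omega> * herm \<alpha> \<omega>)" if "set_mset \<alpha> \<subseteq> E" for e \<alpha>
    by (rule square_integrable_mult_integrable[OF s\<psi> square_integrable_herm[OF that]])
  \<comment> \<open>Keeping the multiplicity on both sides makes the identity valid, as 0 = 0, for
    directions that do not occur in \<alpha>.\<close>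
  have ibp: "real (count \<alpha> e) * (\<integral>\<omega>. \<phi> (P \<omega>) * herm \<alpha> \<omega> \<partial>M) =
      (\<integral>\<omega>. \<psi> (P \<omega>) * grad_sum c D e \<omega> * (real (count \<alpha> e) * herm (\<alpha> - {#e#}) \<omega>) \<partial>M)" if \<alpha>: "\<alpha> \<in> D" for \<alpha> e
  proof (cases "e \<in># \<alpha>")
    case True
    have "(\<integral>\<omega>. \<phi> (P \<omega>) * herm \<alpha> \<omega> \<partial>M) = (\<integral>\<omega>. \<psi> (P \<omega>) * grad_sum c D e \<omega> * herm (\<alpha> - {#e#}) \<omega> \<partial>M)"
      unfolding P_def herm_sum_def grad_sum_def
      by (rule herm_integration_by_parts[OF D(1) DE DE[OF \<alpha>] True deriv cont])
        (use i\<phi>[OF DE[OF \<alpha>]] i\<phi>[OF remove_subset[OF DE[OF \<alpha>]]] i\<psi>[OF remove_subset[OF DE[OF \<alpha>]]]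
          in \<open>simp_all add: P_def herm_sum_def grad_sum_def\<close>)
    then show ?thesis
      by (simp only: integral_mult_right_zero[symmetric]) (simp only: mult_ac)
  next
    case False
    then show ?thesis by (simp add: not_in_iff)
  qed
  have "(\<integral>\<omega>. \<phi> (P \<omega>) * P \<omega> \<partial>M) = (\<integral>\<omega>. (\<Sum>\<alpha>\<in>D. c \<alpha> * (\<phi> (P \<omega>) * herm \<alpha> \<omega>)) \<partial>M)"
    unfolding P_def herm_sum_def by (simp add: sum_distrib_left mult.left_commute)
  also have "\<dots> = (\<Sum>\<alpha>\<in>D. c \<alpha> * (\<integral>\<omega>. \<phi> (P \<omega>) * herm \<alpha> \<omega> \<partial>M))"
    using i\<phi>[OF DE] by (subst Bochner_Integration.integral_sum) auto
  also have "\<dots> = (\<Sum>\<alpha>\<in>D. \<Sum>e\<in>?S. c' \<alpha> * (real (count \<alpha> e) * (\<integral>\<omega>. \<phi> (P \<omega>) * herm \<alpha> \<omega> \<partial>M)))"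
  proof (intro sum.cong refl)
    fix \<alpha> assume \<alpha>: "\<alpha> \<in> D"
    have "size \<alpha> = (\<Sum>e\<in>?S. count \<alpha> e)"
      unfolding size_multiset_overloaded_eq
      using S \<alpha> by (intro sum.mono_neutral_left) (auto simp: not_in_iff)
    then have "real (size \<alpha>) = (\<Sum>e\<in>?S. real (count \<alpha> e))" by simp
    then show "c \<alpha> * (\<integral>\<omega>. \<phi> (P \<omega>) * herm \<alpha> \<omega> \<partial>M) =
        (\<Sum>e\<in>?S. c' \<alpha> * (real (count \<alpha> e) * (\<integral>\<omega>. \<phi> (P \<omega>) * herm \<alpha> \<omega> \<partial>M)))"
      unfolding cc'[OF \<alpha>] by (simp add: sum_distrib_left sum_distrib_right mult_ac)
  qed
  also have "\<dots> = (\<Sum>e\<in>?S. \<Sum>\<alpha>\<in>D. c' \<alpha> *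
      (\<integral>\<omega>. \<psi> (P \<omega>) * grad_sum c D e \<omega> * (real (count \<alpha> e) * herm (\<alpha> - {#e#}) \<omega>) \<partial>M))"
    by (subst sum.swap) (simp add: ibp)
  also have "\<dots> = (\<Sum>e\<in>?S. \<integral>\<omega>. (\<Sum>\<alpha>\<in>D. c' \<alpha> *
      (\<psi> (P \<omega>) * grad_sum c D e \<omega> * (real (count \<alpha> e) * herm (\<alpha> - {#e#}) \<omega>))) \<partial>M)"
  proof (intro sum.cong refl)
    fix e
    have i: "integrable M (\<lambda>\<omega>. \<psi> (P \<omega>) * grad_sum c D e \<omega> * (real (count \<alpha> e) * herm (\<alpha> - {#e#}) \<omega>))"
      if "\<alpha> \<in> D" for \<alpha>
      using integrable_mult_right[OF i\<psi>[OF remove_subset[OF DE[OF that]]], of "real (count \<alpha> e)"]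
      by (simp add: mult_ac)
    show "(\<Sum>\<alpha>\<in>D. c' \<alpha> * (\<integral>\<omega>. \<psi> (P \<omega>) * grad_sum c D e \<omega> * (real (count \<alpha> e) * herm (\<alpha> - {#e#}) \<omega>) \<partial>M)) =
      (\<integral>\<omega>. (\<Sum>\<alpha>\<in>D. c' \<alpha> * (\<psi> (P \<omega>) * grad_sum c D e \<omega> * (real (count \<alpha> e) * herm (\<alpha> - {#e#}) \<omega>))) \<partial>M)"
      using i by (subst Bochner_Integration.integral_sum) auto
  qed
  also have "\<dots> = (\<Sum>e\<in>?S. \<integral>\<omega>. \<psi> (P \<omega>) * grad_sum c D e \<omega> * grad_sum c' D e \<omega> \<partial>M)"
    unfolding grad_sum_def[of c'] sum_distrib_left
    by (intro sum.cong refl Bochner_Integration.integral_cong) (auto intro!: sum.cong simp: mult_ac)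
  also have "\<dots> = (\<integral>\<omega>. (\<Sum>e\<in>?S. \<psi> (P \<omega>) * grad_sum c D e \<omega> * grad_sum c' D e \<omega>) \<partial>M)"
    by (rule Bochner_Integration.integral_sum[symmetric])
      (rule square_integrable_mult_integrable[OF s\<psi> square_integrable_grad_sum[OF D]])
  also have "\<dots> = (\<integral>\<omega>. \<psi> (P \<omega>) * (gradient c D \<omega> \<bullet> gradient c' D \<omega>) \<partial>M)"
    by (simp add: inner_gradients[OF D] sum_distrib_left mult.assoc)
  finally show ?thesis .
qed

text \<open>The finite formula is taken to the limit along sets D that serve X, \<open>DX\<close>
  and \<open>DY\<close> at once. Boundedness of \<phi> and \<psi> gives dominated convergence with
  the limit variables as majorants, and it reduces the remaining errors to mean-square
  errors.\<close>

theorem malliavin_integration_by_parts: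
  assumes DX: "malliavin_derivative M W E X DX" and mean: "(\<integral>\<omega>. X \<omega> \<partial>M) = 0"
    and Y: "neg_OU_pseudo_inverse M W E X Y" and DY: "malliavin_derivative M W E Y DY"
    and deriv: "\<And>x. (\<phi> has_real_derivative \<psi> x) (at x)" and cont: "continuous_on UNIV \<psi>"
    and bound: "\<And>x. \<bar>\<phi> x\<bar> \<le> K" "\<And>x. \<bar>\<psi> x\<bar> \<le> L"
  shows "integrable M (\<lambda>\<omega>. DX \<omega> \<bullet> DY \<omega>)"
    and "(\<integral>\<omega>. \<phi> (X \<omega>) * X \<omega> \<partial>M) = (\<integral>\<omega>. \<psi> (X \<omega>) * (DX \<omega> \<bullet> DY \<omega>) \<partial>M)"
proof -
  let ?F = "finite_subsets_at_top indices"
  have [measurable]: "DX \<in> borel_measurable M" "DY \<in> borel_measurable M"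
    using borel_measurable_malliavin_derivative DX DY by auto
  obtain f J where chX: "chaos_expansion M W E X f J" using DX by (auto simp: malliavin_derivative_def)
  have Xap: "chaos_approx X" by (rule chaos_expansion_coef(2)[OF chX])
  have X2: "square_integrable M X" using Xap by (simp add: chaos_approx_def)
  have [measurable]: "X \<in> borel_measurable M" using X2 by (rule square_integrable_measurable)
  have c\<phi>: "continuous_on UNIV \<phi>" and [measurable]: "\<phi> \<in> borel_measurable borel"
    using has_real_derivative_continuous_measurable[OF deriv] by auto
  have [measurable]: "\<psi> \<in> borel_measurable borel" using cont by (rule borel_measurable_continuous_onI)
  have isq: "integrable M f" if "square_integrable M f" for f
    using square_integrable_mult_integrable[OF that, of "\<lambda>_. 1"] by (simp add: square_integrable_def)
  have nX: "square_integrable M (\<lambda>\<omega>. norm (DX \<omega>))" and nY: "square_integrable M (\<lambda>\<omega>. norm (DY \<omega>))"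
    using square_integrable_malliavin_derivative DX DY by auto
  show iXY: "integrable M (\<lambda>\<omega>. DX \<omega> \<bullet> DY \<omega>)"
    by (rule Bochner_Integration.integrable_bound[OF square_integrable_mult_integrable[OF nX nY]])
      (auto simp: Cauchy_Schwarz_ineq2)
  let ?P = "\<lambda>D. partial_sum X D" and ?G = "\<lambda>D. gradient (chaos_coef X) D" and ?H = "\<lambda>D. gradient (chaos_coef Y) D"
  \<comment> \<open>One finite index set has to approximate all three variables, because the finite
    formula uses the same D for P and for both gradients.\<close>
  define good where "good \<epsilon> D \<longleftrightarrow> finite D \<and> D \<subseteq> indices \<and> (\<integral>\<omega>. (?P D \<omega> - X \<omega>)\<^sup>2 \<partial>M) \<le> \<epsilon>\<^sup>2 \<and>
    (square_integrable M (\<lambda>\<omega>. norm (?G D \<omega> - DX \<omega>)) \<and> (\<integral>\<omega>. (norm (?G D \<omega> - DX \<omega>))\<^sup>2 \<partial>M) \<le> \<epsilon>\<^sup>2) \<and>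
    (square_integrable M (\<lambda>\<omega>. norm (?H D \<omega> - DY \<omega>)) \<and> (\<integral>\<omega>. (norm (?H D \<omega> - DY \<omega>))\<^sup>2 \<partial>M) \<le> \<epsilon>\<^sup>2)" for \<epsilon> D
  have "\<exists>D. good \<epsilon> D" if \<epsilon>: "\<epsilon> > 0" for \<epsilon>
  proof -
    have "\<forall>\<^sub>F D in ?F. finite D \<and> D \<subseteq> indices" by (auto simp: eventually_finite_subsets_at_top)
    moreover have "\<forall>\<^sub>F D in ?F. (\<integral>\<omega>. (?P D \<omega> - X \<omega>)\<^sup>2 \<partial>M) < \<epsilon>\<^sup>2"
      by (rule order_tendstoD(2)[OF partial_sum_tendsto[OF Xap]]) (use \<epsilon> in simp)
    moreover have "\<epsilon>\<^sup>2 > 0" using \<epsilon> by simp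
    note gradient_converges[OF DX this] gradient_converges[OF DY this]
    ultimately have "\<forall>\<^sub>F D in ?F. good \<epsilon> D"
      unfolding good_def by eventually_elim auto
    then show ?thesis by (intro eventually_happens'[of ?F]) simp_all
  qed
  then have "\<exists>D. good (1 / real (Suc n)) D" for n by simp
  then obtain D where D: "\<And>n. good (1 / real (Suc n)) (D n)" by metis
  define \<epsilon> where "\<epsilon> n = 1 / real (Suc n)" for n
  have \<epsilon>0: "\<epsilon> \<longlonglongrightarrow> 0" unfolding \<epsilon>_def[abs_def] by (rule LIMSEQ_Suc[OF lim_1_over_n])
  have \<epsilon>pos: "\<epsilon> n > 0" for n by (simp add: \<epsilon>_def)
  have fin: "finite (D n)" "D n \<subseteq> indices"
    and eX: "(\<integral>\<omega>. (?P (D n) \<omega> - X \<omega>)\<^sup>2 \<partial>M) \<le> (\<epsilon> n)\<^sup>2"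
    and eG: "square_integrable M (\<lambda>\<omega>. norm (?G (D n) \<omega> - DX \<omega>))" "(\<integral>\<omega>. (norm (?G (D n) \<omega> - DX \<omega>))\<^sup>2 \<partial>M) \<le> (\<epsilon> n)\<^sup>2"
    and eH: "square_integrable M (\<lambda>\<omega>. norm (?H (D n) \<omega> - DY \<omega>))" "(\<integral>\<omega>. (norm (?H (D n) \<omega> - DY \<omega>))\<^sup>2 \<partial>M) \<le> (\<epsilon> n)\<^sup>2"
    for n using D[of n] unfolding good_def \<epsilon>_def by auto
  have P2: "square_integrable M (?P (D n))" for n
    unfolding partial_sum_def by (rule square_integrable_herm_sum[OF fin(2)])
  have [measurable]: "?P (D n) \<in> borel_measurable M" "?G (D n) \<in> borel_measurable M" "?H (D n) \<in> borel_measurable M" for n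
    using square_integrable_measurable[OF P2] borel_measurable_gradient[OF fin] by auto
  have PX2: "square_integrable M (\<lambda>\<omega>. \<bar>?P (D n) \<omega> - X \<omega>\<bar>)" for n
    using square_integrable_diff[OF P2[of n] X2] by (simp add: square_integrable_def)
  have one: "square_integrable M (\<lambda>_. 1::real)" by (simp add: square_integrable_def)
  have L1: "(\<integral>\<omega>. \<bar>?P (D n) \<omega> - X \<omega>\<bar> \<partial>M) \<le> \<epsilon> n" for n
    using integral_mult_le_of_square_bounds[OF PX2[of n] one, of "\<epsilon> n" 1] eX[of n] \<epsilon>pos[of n]
    by (simp add: prob_space)
  have "(\<lambda>n. \<integral>\<omega>. norm (?P (D n) \<omega> - X \<omega>) \<partial>M) \<longlonglongrightarrow> 0"
    by (rule tendsto_sandwich[OF _ _ tendsto_const \<epsilon>0]) (use L1 in auto)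
  \<comment> \<open>For the composition with \<phi> and \<psi>, which are merely continuous and
    bounded, convergence almost everywhere is wanted, so a subsequence is chosen.\<close>
  then obtain r where r: "strict_mono r" "AE \<omega> in M. (\<lambda>n. ?P (D (r n)) \<omega> - X \<omega>) \<longlonglongrightarrow> 0"
    using tendsto_L1_AE_subseq[of M "\<lambda>n \<omega>. ?P (D n) \<omega> - X \<omega>"] isq[OF P2] isq[OF X2] by blast
  have conv: "AE \<omega> in M. (\<lambda>n. ?P (D (r n)) \<omega>) \<longlonglongrightarrow> X \<omega>"
    using r(2)
  proof eventually_elim
    case (elim \<omega>)
    from tendsto_add[OF elim tendsto_const[of "X \<omega>"]] show ?case by simp
  qed
  have \<epsilon>r: "(\<lambda>n. \<epsilon> (r n)) \<longlonglongrightarrow> 0" using LIMSEQ_subseq_LIMSEQ[OF \<epsilon>0 r(1)] by (simp add: comp_def)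
  have K0: "0 \<le> K" and L0: "0 \<le> L" using bound[of 0] by auto
  \<comment> \<open>The empty index has size 0, so the relation \<open>cc'\<close> between the
    coefficients of X and Y holds there only because X is centered.\<close>
  have coef0: "coef X {#} = 0" using mean by (simp add: coef_def)
  have cc': "chaos_coef X \<alpha> = real (size \<alpha>) * chaos_coef Y \<alpha>" if "\<alpha> \<in> indices" for \<alpha>
    using neg_OU_pseudo_inverse_coef[OF Y that] coef0
    by (cases "\<alpha> = {#}") (auto simp: chaos_coef_def)
  have ident: "(\<integral>\<omega>. \<phi> (?P (D n) \<omega>) * ?P (D n) \<omega> \<partial>M) =
      (\<integral>\<omega>. \<psi> (?P (D n) \<omega>) * (?G (D n) \<omega> \<bullet> ?H (D n) \<omega>) \<partial>M)" for n
    using finite_chaos_integration_by_parts[OF fin cc' deriv cont bound, of n] fin(2)[of n]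
    by (auto simp: partial_sum_def chaos_coef_def[abs_def])
  have lhs: "(\<lambda>n. \<integral>\<omega>. \<phi> (?P (D (r n)) \<omega>) * ?P (D (r n)) \<omega> \<partial>M) \<longlonglongrightarrow> (\<integral>\<omega>. \<phi> (X \<omega>) * X \<omega> \<partial>M)"
  proof -
    have a: "(\<lambda>n. \<integral>\<omega>. \<phi> (?P (D (r n)) \<omega>) * X \<omega> \<partial>M) \<longlonglongrightarrow> (\<integral>\<omega>. \<phi> (X \<omega>) * X \<omega> \<partial>M)"
    proof (rule integral_dominated_convergence[where w = "\<lambda>\<omega>. K * \<bar>X \<omega>\<bar>"])
      show "AE \<omega> in M. (\<lambda>n. \<phi> (?P (D (r n)) \<omega>) * X \<omega>) \<longlonglongrightarrow> \<phi> (X \<omega>) * X \<omega>"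
        using conv
      proof eventually_elim
        case (elim \<omega>)
        then show ?case
          using c\<phi> by (intro tendsto_mult tendsto_const continuous_on_tendsto_compose[OF c\<phi>]) auto
      qed
      show "AE \<omega> in M. norm (\<phi> (?P (D (r n)) \<omega>) * X \<omega>) \<le> K * \<bar>X \<omega>\<bar>" for n
        using bound(1) by (auto simp: abs_mult intro!: mult_right_mono)
    qed (use isq[OF X2] in auto)
    have ib: "integrable M (\<lambda>\<omega>. \<phi> (?P (D n) \<omega>) * f \<omega>)" if f: "square_integrable M f" for f n
    proof (rule isq)
      have [measurable]: "f \<in> borel_measurable M" using f by (rule square_integrable_measurable)
      show "square_integrable M (\<lambda>\<omega>. \<phi> (?P (D n) \<omega>) * f \<omega>)"
        by (rule square_integrable_bounded_mult[OF f, of _ K]) (use bound(1) in auto)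
    qed
    have b: "(\<lambda>n. \<integral>\<omega>. \<phi> (?P (D (r n)) \<omega>) * (?P (D (r n)) \<omega> - X \<omega>) \<partial>M) \<longlonglongrightarrow> 0"
    proof (rule Lim_null_comparison)
      show "(\<lambda>n. K * \<epsilon> (r n)) \<longlonglongrightarrow> 0" using tendsto_mult_left[OF \<epsilon>r, of K] by simp
      have "norm (\<integral>\<omega>. \<phi> (?P (D n) \<omega>) * (?P (D n) \<omega> - X \<omega>) \<partial>M) \<le> K * \<epsilon> n" for n
      proof -
        have "norm (\<integral>\<omega>. \<phi> (?P (D n) \<omega>) * (?P (D n) \<omega> - X \<omega>) \<partial>M) \<le> (\<integral>\<omega>. K * \<bar>?P (D n) \<omega> - X \<omega>\<bar> \<partial>M)"
          using isq[OF PX2[of n]] bound(1) ib[OF square_integrable_diff[OF P2[of n] X2], of n]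
          unfolding real_norm_def
          by (intro abs_integral_le_integral) (auto simp: abs_mult intro!: mult_right_mono)
        also have "\<dots> \<le> K * \<epsilon> n" using L1[of n] K0 by (simp add: mult_left_mono)
        finally show ?thesis .
      qed
      then show "\<forall>\<^sub>F n in sequentially. norm (\<integral>\<omega>. \<phi> (?P (D (r n)) \<omega>) * (?P (D (r n)) \<omega> - X \<omega>) \<partial>M) \<le> K * \<epsilon> (r n)"
        by auto
    qed
    have "(\<integral>\<omega>. \<phi> (?P (D n) \<omega>) * (?P (D n) \<omega> - X \<omega>) \<partial>M) + (\<integral>\<omega>. \<phi> (?P (D n) \<omega>) * X \<omega> \<partial>M) =
      (\<integral>\<omega>. \<phi> (?P (D n) \<omega>) * ?P (D n) \<omega> \<partial>M)" for n
      using ib[OF P2, of n n] ib[OF X2, of n] by (simp add: right_diff_distrib)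
    then show ?thesis using tendsto_add[OF b a] by simp
  qed
  have rhs: "(\<lambda>n. \<integral>\<omega>. \<psi> (?P (D (r n)) \<omega>) * (?G (D (r n)) \<omega> \<bullet> ?H (D (r n)) \<omega>) \<partial>M) \<longlonglongrightarrow>
      (\<integral>\<omega>. \<psi> (X \<omega>) * (DX \<omega> \<bullet> DY \<omega>) \<partial>M)"
  proof -
    have a: "(\<lambda>n. \<integral>\<omega>. \<psi> (?P (D (r n)) \<omega>) * (DX \<omega> \<bullet> DY \<omega>) \<partial>M) \<longlonglongrightarrow> (\<integral>\<omega>. \<psi> (X \<omega>) * (DX \<omega> \<bullet> DY \<omega>) \<partial>M)"
    proof (rule integral_dominated_convergence[where w = "\<lambda>\<omega>. L * \<bar>DX \<omega> \<bullet> DY \<omega>\<bar>"])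
      show "AE \<omega> in M. (\<lambda>n. \<psi> (?P (D (r n)) \<omega>) * (DX \<omega> \<bullet> DY \<omega>)) \<longlonglongrightarrow> \<psi> (X \<omega>) * (DX \<omega> \<bullet> DY \<omega>)"
        using conv
      proof eventually_elim
        case (elim \<omega>)
        then show ?case
          by (intro tendsto_mult tendsto_const continuous_on_tendsto_compose[OF cont]) auto
      qed
      show "AE \<omega> in M. norm (\<psi> (?P (D (r n)) \<omega>) * (DX \<omega> \<bullet> DY \<omega>)) \<le> L * \<bar>DX \<omega> \<bullet> DY \<omega>\<bar>" for n
        using bound(2) by (auto simp: abs_mult intro!: mult_right_mono)
    qed (use iXY in auto)
    define B where "B = sqrt (\<integral>\<omega>. (norm (DX \<omega>))\<^sup>2 \<partial>M) + sqrt (\<integral>\<omega>. (norm (DY \<omega>))\<^sup>2 \<partial>M)"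
    have B0: "0 \<le> B" by (simp add: B_def)
    have BX: "(\<integral>\<omega>. (norm (DX \<omega>))\<^sup>2 \<partial>M) \<le> B\<^sup>2" and BY: "(\<integral>\<omega>. (norm (DY \<omega>))\<^sup>2 \<partial>M) \<le> B\<^sup>2"
    proof -
      have "sqrt (\<integral>\<omega>. (norm (DX \<omega>))\<^sup>2 \<partial>M) \<le> B" "sqrt (\<integral>\<omega>. (norm (DY \<omega>))\<^sup>2 \<partial>M) \<le> B"
        by (simp_all add: B_def)
      then show "(\<integral>\<omega>. (norm (DX \<omega>))\<^sup>2 \<partial>M) \<le> B\<^sup>2" "(\<integral>\<omega>. (norm (DY \<omega>))\<^sup>2 \<partial>M) \<le> B\<^sup>2"
        using real_sqrt_le_iff[of _ "B\<^sup>2"] B0 by (metis real_sqrt_abs abs_of_nonneg)+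
    qed
    let ?a = "\<lambda>n \<omega>. norm (?G (D n) \<omega> - DX \<omega>)" and ?b = "\<lambda>n \<omega>. norm (?H (D n) \<omega> - DY \<omega>)"
    let ?E = "\<lambda>n \<omega>. L * (?a n \<omega> * ?b n \<omega> + ?a n \<omega> * norm (DY \<omega>) + ?b n \<omega> * norm (DX \<omega>))"
    have iE: "integrable M (?E n)" and vE: "(\<integral>\<omega>. ?E n \<omega> \<partial>M) \<le> L * (\<epsilon> n * \<epsilon> n + \<epsilon> n * B + \<epsilon> n * B)" for n
    proof -
      have i: "integrable M (\<lambda>\<omega>. ?a n \<omega> * ?b n \<omega>)" "integrable M (\<lambda>\<omega>. ?a n \<omega> * norm (DY \<omega>))"
        "integrable M (\<lambda>\<omega>. ?b n \<omega> * norm (DX \<omega>))"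
        using square_integrable_mult_integrable eG(1) eH(1) nX nY by blast+
      then show "integrable M (?E n)" by simp
      have "(\<integral>\<omega>. ?E n \<omega> \<partial>M) = L * ((\<integral>\<omega>. ?a n \<omega> * ?b n \<omega> \<partial>M) + (\<integral>\<omega>. ?a n \<omega> * norm (DY \<omega>) \<partial>M) +
          (\<integral>\<omega>. ?b n \<omega> * norm (DX \<omega>) \<partial>M))" using i by simp
      also have "\<dots> \<le> L * (\<epsilon> n * \<epsilon> n + \<epsilon> n * B + \<epsilon> n * B)"
        by (intro mult_left_mono add_mono integral_mult_le_of_square_bounds eG eH nX nY BX BY L0 B0 less_imp_le[OF \<epsilon>pos])
      finally show "(\<integral>\<omega>. ?E n \<omega> \<partial>M) \<le> L * (\<epsilon> n * \<epsilon> n + \<epsilon> n * B + \<epsilon> n * B)" .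
    qed
    \<comment> \<open>The error of an inner product, split so that each summand has a factor that is
      small in mean square and another that is bounded in mean square.\<close>
    have pw: "\<bar>\<psi> x * (g \<bullet> h - u \<bullet> v)\<bar> \<le> L * (norm (g - u) * norm (h - v) + norm (g - u) * norm v + norm (h - v) * norm u)"
      for x and g h u v :: 'h
    proof -
      have "g \<bullet> h - u \<bullet> v = (g - u) \<bullet> (h - v) + (g - u) \<bullet> v + (h - v) \<bullet> u"
        by (simp add: inner_diff inner_commute)
      also have "\<bar>\<dots>\<bar> \<le> \<bar>(g - u) \<bullet> (h - v)\<bar> + \<bar>(g - u) \<bullet> v\<bar> + \<bar>(h - v) \<bullet> u\<bar>" by linarith
      also have "\<dots> \<le> norm (g - u) * norm (h - v) + norm (g - u) * norm v + norm (h - v) * norm u"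
        by (intro add_mono Cauchy_Schwarz_ineq2)
      finally show ?thesis unfolding abs_mult by (intro mult_mono bound(2) L0) auto
    qed
    have iGH: "integrable M (\<lambda>\<omega>. \<psi> (?P (D n) \<omega>) * (?G (D n) \<omega> \<bullet> ?H (D n) \<omega> - DX \<omega> \<bullet> DY \<omega>))" for n
    proof (rule Bochner_Integration.integrable_bound[OF iE[of n]])
      show "AE \<omega> in M. norm (\<psi> (?P (D n) \<omega>) * (?G (D n) \<omega> \<bullet> ?H (D n) \<omega> - DX \<omega> \<bullet> DY \<omega>)) \<le> norm (?E n \<omega>)"
        unfolding real_norm_def by (intro AE_I2 order_trans[OF pw abs_ge_self])
    qed measurable
    have b: "(\<lambda>n. \<integral>\<omega>. \<psi> (?P (D (r n)) \<omega>) * (?G (D (r n)) \<omega> \<bullet> ?H (D (r n)) \<omega> - DX \<omega> \<bullet> DY \<omega>) \<partial>M) \<longlonglongrightarrow> 0"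
    proof (rule Lim_null_comparison)
      have "(\<lambda>n. L * (\<epsilon> (r n) * \<epsilon> (r n) + \<epsilon> (r n) * B + \<epsilon> (r n) * B)) \<longlonglongrightarrow> L * (0 * 0 + 0 * B + 0 * B)"
        by (intro tendsto_intros \<epsilon>r)
      then show "(\<lambda>n. L * (\<epsilon> (r n) * \<epsilon> (r n) + \<epsilon> (r n) * B + \<epsilon> (r n) * B)) \<longlonglongrightarrow> 0" by simp
      have "norm (\<integral>\<omega>. \<psi> (?P (D n) \<omega>) * (?G (D n) \<omega> \<bullet> ?H (D n) \<omega> - DX \<omega> \<bullet> DY \<omega>) \<partial>M) \<le>
          L * (\<epsilon> n * \<epsilon> n + \<epsilon> n * B + \<epsilon> n * B)" for n
      proof (rule order_trans[OF _ vE])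
        show "norm (\<integral>\<omega>. \<psi> (?P (D n) \<omega>) * (?G (D n) \<omega> \<bullet> ?H (D n) \<omega> - DX \<omega> \<bullet> DY \<omega>) \<partial>M) \<le> (\<integral>\<omega>. ?E n \<omega> \<partial>M)"
          unfolding real_norm_def by (rule abs_integral_le_integral[OF iGH iE pw])
      qed
      then show "\<forall>\<^sub>F n in sequentially. norm (\<integral>\<omega>. \<psi> (?P (D (r n)) \<omega>) * (?G (D (r n)) \<omega> \<bullet> ?H (D (r n)) \<omega> - DX \<omega> \<bullet> DY \<omega>) \<partial>M) \<le>
          L * (\<epsilon> (r n) * \<epsilon> (r n) + \<epsilon> (r n) * B + \<epsilon> (r n) * B)" by auto
    qed
    have i0: "integrable M (\<lambda>\<omega>. \<psi> (?P (D n) \<omega>) * (DX \<omega> \<bullet> DY \<omega>))" for n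
      by (rule Bochner_Integration.integrable_bound[OF integrable_mult_right[OF integrable_abs[OF iXY], of L]])
        (use bound(2) L0 in \<open>auto simp: abs_mult intro!: mult_right_mono\<close>)
    have "(\<integral>\<omega>. \<psi> (?P (D n) \<omega>) * (?G (D n) \<omega> \<bullet> ?H (D n) \<omega> - DX \<omega> \<bullet> DY \<omega>) \<partial>M) +
        (\<integral>\<omega>. \<psi> (?P (D n) \<omega>) * (DX \<omega> \<bullet> DY \<omega>) \<partial>M) =
      (\<integral>\<omega>. \<psi> (?P (D n) \<omega>) * (?G (D n) \<omega> \<bullet> ?H (D n) \<omega>) \<partial>M)" for n
      by (subst Bochner_Integration.integral_add[OF iGH i0, symmetric]) (simp add: right_diff_distrib)
    then show ?thesis using tendsto_add[OF b a] by simp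
  qed
  show "(\<integral>\<omega>. \<phi> (X \<omega>) * X \<omega> \<partial>M) = (\<integral>\<omega>. \<psi> (X \<omega>) * (DX \<omega> \<bullet> DY \<omega>) \<partial>M)"
    using LIMSEQ_unique[OF lhs rhs[folded ident]] .
qed

end

section \<open>From an isonormal process to independent coordinates along the basis\<close>

text \<open>The degenerate law is the case \<sigma> = 0. Having variance and characteristic function
  share one \<sigma> lets the covariance of the process determine the latter.\<close>

lemma (in prob_space) centered_gaussian_moments:
  assumes Y: "centered_gaussian M Y"
  shows "\<exists>\<sigma>. square_integrable M Y \<and> (\<integral>\<omega>. (Y \<omega>)\<^sup>2 \<partial>M) = \<sigma>\<^sup>2 \<and>
    (\<integral>\<omega>. iexp (Y \<omega>) \<partial>M) = complex_of_real (exp (- \<sigma>\<^sup>2 / 2))"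
proof -
  have [measurable]: "Y \<in> borel_measurable M" using Y by (simp add: centered_gaussian_def)
  consider "AE \<omega> in M. Y \<omega> = 0"
    | \<sigma> where "\<sigma> > 0" "distributed M lborel Y (\<lambda>x. ennreal (normal_density 0 \<sigma> x))"
    using Y by (auto simp: centered_gaussian_def)
  then show ?thesis
  proof cases
    case 1
    then have a: "AE \<omega> in M. (Y \<omega>)\<^sup>2 = 0" "AE \<omega> in M. iexp (Y \<omega>) = 1"
      by (eventually_elim, simp)+
    have "integrable M (\<lambda>\<omega>. (Y \<omega>)\<^sup>2)" using a(1) by (subst integrable_cong_AE[where g = "\<lambda>_. 0"]) auto
    moreover have "(\<integral>\<omega>. (Y \<omega>)\<^sup>2 \<partial>M) = 0" using a(1) by (subst integral_cong_AE[where g = "\<lambda>_. 0"]) auto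
    moreover have "(\<integral>\<omega>. iexp (Y \<omega>) \<partial>M) = 1"
      using a(2) by (subst integral_cong_AE[where g = "\<lambda>_. 1"]) (auto simp: prob_space)
    ultimately show ?thesis by (intro exI[of _ 0]) (simp add: square_integrable_def)
  next
    case 2
    let ?\<gamma> = "std_normal_distribution"
    define U where "U \<omega> = Y \<omega> / \<sigma>" for \<omega>
    have Um [measurable]: "U \<in> borel_measurable M" unfolding U_def[abs_def] by measurable
    have YU: "Y \<omega> = \<sigma> * U \<omega>" for \<omega> using 2(1) by (simp add: U_def)
    have "distributed M lborel U (\<lambda>x. ennreal (std_normal_density x))"
      using 2 normal_standard_normal_convert[of \<sigma> Y 0] by (simp add: U_def[abs_def])
    then have "distr M lborel U = ?\<gamma>" by (simp add: distributed_def)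
    then have d: "distr M borel U = ?\<gamma>" by (metis distr_cong sets_lborel)
    have i2: "integrable ?\<gamma> (\<lambda>x. x\<^sup>2)" and v2: "(\<integral>x. x\<^sup>2 \<partial>?\<gamma>) = 1"
      using std_normal_moment_even[of 1]
      by (auto simp: integrable_density integral_density normal_density_nonneg has_bochner_integral_iff fact_2)
    have iU: "integrable M (\<lambda>\<omega>. (U \<omega>)\<^sup>2)" using i2 by (subst (asm) d[symmetric], subst (asm) integrable_distr_eq) auto
    have vU: "(\<integral>\<omega>. (U \<omega>)\<^sup>2 \<partial>M) = 1" using v2 by (subst (asm) d[symmetric], subst (asm) integral_distr) auto
    have "(\<integral>\<omega>. iexp (Y \<omega>) \<partial>M) = (\<integral>x. iexp (\<sigma> * x) \<partial>distr M borel U)"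
      by (subst integral_distr) (auto simp: YU)
    also have "\<dots> = char ?\<gamma> \<sigma>" by (simp add: d char_def)
    finally have "(\<integral>\<omega>. iexp (Y \<omega>) \<partial>M) = complex_of_real (exp (- \<sigma>\<^sup>2 / 2))"
      by (simp add: char_std_normal_distribution)
    then show ?thesis using iU vU
      by (intro exI[of _ \<sigma>]) (simp add: square_integrable_def YU power_mult_distrib)
  qed
qed

text \<open>By orthonormality the variance of a linear combination of the \<open>W e\<close> is the
  sum of the squared coefficients, so the exponential factorises over the directions.\<close>

lemma isonormal_process_malliavin_family:
  fixes W :: "'h::{real_inner, polish_space} \<Rightarrow> 'w \<Rightarrow> real"
  assumes W: "isonormal_process M W" and E: "orthonormal_basis E"
  shows "malliavin_family M W E"
proof -
  interpret prob_space M using W by (simp add: isonormal_process_def)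
  have g: "finite S \<Longrightarrow> centered_gaussian M (\<lambda>\<omega>. \<Sum>h\<in>S. c h * W h \<omega>)"
    and cov: "(\<integral>\<omega>. W h \<omega> * W k \<omega> \<partial>M) = h \<bullet> k" for S c h k
    using W by (auto simp: isonormal_process_def)
  have W1: "centered_gaussian M (W h)" for h using g[of "{h}" "\<lambda>_. 1"] by simp
  have W2: "square_integrable M (W h)" for h using centered_gaussian_moments[OF W1[of h]] by auto
  show ?thesis
  proof
    show "W e \<in> borel_measurable M" for e using W1[of e] by (simp add: centered_gaussian_def)
    show "orthonormal_basis E" by (rule E)
    fix S t assume S: "finite S" "S \<subseteq> E"
    let ?Y = "\<lambda>\<omega>. \<Sum>e\<in>S. t e * W e \<omega>"
    obtain \<sigma> where \<sigma>: "(\<integral>\<omega>. (?Y \<omega>)\<^sup>2 \<partial>M) = \<sigma>\<^sup>2" "(\<integral>\<omega>. iexp (?Y \<omega>) \<partial>M) = complex_of_real (exp (- \<sigma>\<^sup>2 / 2))"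
      using centered_gaussian_moments[OF g[OF S(1)]] by blast
    have i: "integrable M (\<lambda>\<omega>. W e \<omega> * W e' \<omega>)" for e e'
      by (rule square_integrable_mult_integrable[OF W2 W2])
    have "(\<integral>\<omega>. (?Y \<omega>)\<^sup>2 \<partial>M) = (\<integral>\<omega>. (\<Sum>e\<in>S. \<Sum>e'\<in>S. t e * t e' * (W e \<omega> * W e' \<omega>)) \<partial>M)"
      by (simp add: power2_eq_square sum_product mult_ac)
    also have "\<dots> = (\<Sum>e\<in>S. \<Sum>e'\<in>S. t e * t e' * (e \<bullet> e'))"
      using i by (simp add: Bochner_Integration.integral_sum cov)
    also have "\<dots> = (\<Sum>e\<in>S. \<Sum>e'\<in>S. if e' = e then (t e)\<^sup>2 else 0)"
      using S orthonormal_basis_inner[OF E] by (intro sum.cong refl) (auto simp: subset_eq power2_eq_square)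
    also have "\<dots> = (\<Sum>e\<in>S. (t e)\<^sup>2)" using S by simp
    finally have "- \<sigma>\<^sup>2 / 2 = (\<Sum>e\<in>S. - (t e)\<^sup>2 / 2)"
      using \<sigma>(1) by (simp add: sum_negf sum_divide_distrib)
    then show "(\<integral>\<omega>. iexp (?Y \<omega>) \<partial>M) = complex_of_real (\<Prod>e\<in>S. exp (- (t e)\<^sup>2 / 2))"
      using \<sigma>(2) S by (simp only: exp_sum)
  qed
qed

subsection \<open>Stein's equation for the reference law\<close>

lemma set_integral_atMost_has_real_derivative:
  fixes h :: "real \<Rightarrow> real"
  assumes cont: "continuous_on UNIV h" and int: "integrable lborel h"
  shows "((\<lambda>x. LBINT y:{..x}. h y) has_real_derivative h x) (at x)"
proof -
  have si: "set_integrable lborel S h" if "S \<in> sets borel" for S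
    using integrable_mult_indicator[OF _ int, of S] that by (simp add: set_integrable_def)
  \<comment> \<open>Starting at x - 1 makes the domain compact, with x in its interior; the part of
    the integral up to x - 1 is constant in u.\<close>
  have "((\<lambda>u. LBINT y=ereal (x - 1)..ereal u. h y) has_vector_derivative h x) (at x within {x - 1..x + 1})"
    by (rule interval_integral_FTC2) (simp_all add: continuous_on_subset[OF cont])
  then have "((\<lambda>u. LBINT y=ereal (x - 1)..ereal u. h y) has_vector_derivative h x) (at x)"
    by (subst (asm) at_within_interior) auto
  then have "((\<lambda>u. LBINT y=ereal (x - 1)..ereal u. h y) has_real_derivative h x) (at x)"
    unfolding has_real_derivative_iff_has_vector_derivative .
  from DERIV_add[OF DERIV_const this]
  have d: "((\<lambda>u. (LBINT y:{..x - 1}. h y) + (LBINT y=ereal (x - 1)..ereal u. h y)) has_real_derivative h x) (at x)"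
    by simp
  have ev: "\<forall>\<^sub>F u in nhds x. (LBINT y:{..x - 1}. h y) + (LBINT y=ereal (x - 1)..ereal u. h y) = (LBINT y:{..u}. h y)"
  proof -
    have "\<forall>\<^sub>F u in nhds x. x - 1 < u" by (rule order_tendstoD(1)[OF filterlim_ident]) simp
    then show ?thesis
    proof eventually_elim
      case (elim u)
      have "(LBINT y=ereal (x - 1)..ereal u. h y) = (LBINT y:{x - 1<..u}. h y)"
        using elim by (subst interval_integral_Ioc) auto
      moreover have "{..u} = {..x - 1} \<union> {x - 1<..u}" using elim by auto
      moreover have "(LBINT y:({..x - 1} \<union> {x - 1<..u}). h y) = (LBINT y:{..x - 1}. h y) + (LBINT y:{x - 1<..u}. h y)"
        by (intro set_integral_Un si) auto
      ultimately show ?case by simp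
    qed
  qed
  show ?thesis by (rule iffD1[OF DERIV_cong_ev[OF refl ev refl] d])
qed

lemma set_integral_atLeast_eq:
  fixes h :: "real \<Rightarrow> real"
  assumes int: "integrable lborel h"
  shows "(LBINT y:{x..}. h y) = (\<integral>y. h y \<partial>lborel) - (LBINT y:{..x}. h y)"
proof -
  have si: "set_integrable lborel S h" if "S \<in> sets borel" for S
    using integrable_mult_indicator[OF _ int, of S] that by (simp add: set_integrable_def)
  have "(\<integral>y. h y \<partial>lborel) = (LBINT y:({..x} \<union> {x<..}). h y)"
  proof -
    have "{..x} \<union> {x<..} = UNIV" by auto
    then show ?thesis by (simp add: set_lebesgue_integral_def)
  qed
  also have "\<dots> = (LBINT y:{..x}. h y) + (LBINT y:{x<..}. h y)"
    by (intro set_integral_Un si) auto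
  also have "(LBINT y:{x<..}. h y) = (LBINT y:{x..}. h y)"
    unfolding set_lebesgue_integral_def
  proof (rule integral_cong_AE)
    show "AE y in lborel. indicat_real {x<..} y *\<^sub>R h y = indicat_real {x..} y *\<^sub>R h y"
      using AE_lborel_singleton[of x] by eventually_elim (auto simp: indicator_def)
  qed (use int in auto)
  finally show ?thesis by simp
qed

locale centered_density =
  fixes a b :: ereal and \<rho> :: "real \<Rightarrow> real"
  assumes pos: "\<And>x. x \<in> open_interval a b \<Longrightarrow> \<rho> x > 0"
    and zero: "\<And>x. x \<notin> open_interval a b \<Longrightarrow> \<rho> x = 0"
    and cont: "continuous_on UNIV \<rho>"
    and int: "integrable lborel \<rho>" and total: "(\<integral>x. \<rho> x \<partial>lborel) = 1"
    and int1: "integrable lborel (\<lambda>x. x * \<rho> x)" and mean: "(\<integral>x. x * \<rho> x \<partial>lborel) = 0"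
    and ab: "a < b"
begin

text \<open>\<open>tail_mean\<close> is \<open>A\<close> of the overview, and
  \<open>mass_below\<close> below is \<open>1 - \<Phi>\<close>.\<close>

definition tail_mean :: "real \<Rightarrow> real" where "tail_mean x = (LBINT y:{x..}. y * \<rho> y)"
definition mass_below :: "real \<Rightarrow> real" where "mass_below x = (LBINT y:{..x}. \<rho> y)"

lemma nonneg: "\<rho> x \<ge> 0" using pos[of x] zero[of x] by (cases "x \<in> open_interval a b") auto

lemma set_integrables: "S \<in> sets borel \<Longrightarrow> set_integrable lborel S \<rho>"
  "S \<in> sets borel \<Longrightarrow> set_integrable lborel S (\<lambda>x. x * \<rho> x)"
  using integrable_mult_indicator[OF _ int, of S] integrable_mult_indicator[OF _ int1, of S]
  by (auto simp: set_integrable_def)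

lemma tail_mean_eq: "tail_mean x = - (LBINT y:{..x}. y * \<rho> y)"
  unfolding tail_mean_def by (subst set_integral_atLeast_eq[OF int1]) (simp add: mean)

lemma mass_below_eq: "1 - mass_below x = (LBINT y:{x..}. \<rho> y)"
  unfolding mass_below_def by (subst set_integral_atLeast_eq[OF int]) (simp add: total)

lemma tail_mean_deriv: "(tail_mean has_real_derivative - (x * \<rho> x)) (at x)"
  unfolding tail_mean_eq[abs_def]
  by (intro DERIV_minus set_integral_atMost_has_real_derivative int1 continuous_intros cont)

lemma mass_below_deriv: "(mass_below has_real_derivative \<rho> x) (at x)"
  unfolding mass_below_def[abs_def] by (intro set_integral_atMost_has_real_derivative int cont)

text \<open>On each half line y is compared with the endpoint x; for the lower half line
  \<open>tail_mean\<close> is first rewritten by means of the zero mean. The two bounds give the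
  signs of the derivatives of \<Phi> / A and of (1 - \<Phi>) / A.\<close>

lemma tail_mean_ge: "x * (1 - mass_below x) \<le> tail_mean x" "- (x * mass_below x) \<le> tail_mean x"
proof -
  have "x * (1 - mass_below x) = (LBINT y:{x..}. x * \<rho> y)" by (simp add: mass_below_eq)
  also have "\<dots> \<le> tail_mean x" unfolding tail_mean_def
    by (rule set_integral_mono) (use set_integrables nonneg in \<open>auto intro!: mult_right_mono\<close>)
  finally show "x * (1 - mass_below x) \<le> tail_mean x" .
  have "(LBINT y:{..x}. y * \<rho> y) \<le> (LBINT y:{..x}. x * \<rho> y)"
    by (rule set_integral_mono) (use set_integrables nonneg in \<open>auto intro!: mult_right_mono\<close>)
  also have "\<dots> = x * mass_below x" by (simp add: mass_below_def)
  finally show "- (x * mass_below x) \<le> tail_mean x" by (simp add: tail_mean_eq)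
qed

lemma mass_below_bounds: "0 \<le> mass_below x" "mass_below x \<le> 1"
proof -
  show "0 \<le> mass_below x" unfolding mass_below_def set_lebesgue_integral_def by (simp add: nonneg)
  have "0 \<le> 1 - mass_below x" unfolding mass_below_eq set_lebesgue_integral_def by (simp add: nonneg)
  then show "mass_below x \<le> 1" by simp
qed

text \<open>The derivative - x \<rho>(x) is negative for positive x and positive for negative x. So
  from a nonnegative x the function strictly decreases to a nonnegative value at v, and to a
  negative x it strictly increases from a nonnegative value at u.\<close>

lemma tail_mean_pos:
  assumes "x \<in> open_interval a b"
  shows "0 < tail_mean x"
proof -
  have ax: "a < ereal x" "ereal x < b" using assms by (auto simp: open_interval_def)
  obtain u where u: "a < ereal u" "ereal u < ereal x" using ereal_dense2[OF ax(1)] by blast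
  obtain v where v: "ereal x < ereal v" "ereal v < b" using ereal_dense2[OF ax(2)] by blast
  have in_I: "y \<in> open_interval a b" if "u < y" "y < v" for y
    using that u v less_trans[of a "ereal u" "ereal y"] less_trans[of "ereal y" "ereal v" b]
    by (simp add: open_interval_def)
  show ?thesis
  proof (cases "x \<ge> 0")
    case True
    obtain \<eta> where \<eta>: "x < \<eta>" "\<eta> < v" "tail_mean v - tail_mean x = (v - x) * (- (\<eta> * \<rho> \<eta>))"
      using MVT2[of x v tail_mean "\<lambda>x. - (x * \<rho> x)"] v tail_mean_deriv by auto
    have "0 < (v - x) * (\<eta> * \<rho> \<eta>)" using \<eta>(1,2) u v True by (intro mult_pos_pos pos in_I) auto
    moreover have "0 \<le> tail_mean v"
      unfolding tail_mean_def set_lebesgue_integral_def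
    proof (intro integral_nonneg_AE AE_I2)
      fix y
      show "0 \<le> indicat_real {v..} y *\<^sub>R (y * \<rho> y)"
        using True v nonneg[of y] by (cases "y \<ge> v") simp_all
    qed
    moreover have "tail_mean v = tail_mean x - (v - x) * (\<eta> * \<rho> \<eta>)" using \<eta>(3) by (simp add: algebra_simps)
    ultimately show ?thesis by linarith
  next
    case False
    obtain \<eta> where \<eta>: "u < \<eta>" "\<eta> < x" "tail_mean x - tail_mean u = (x - u) * (- (\<eta> * \<rho> \<eta>))"
      using MVT2[of u x tail_mean "\<lambda>x. - (x * \<rho> x)"] u tail_mean_deriv by auto
    have "0 < (x - u) * (- \<eta> * \<rho> \<eta>)" using \<eta>(1,2) u v False by (intro mult_pos_pos pos in_I) auto
    moreover have "0 \<le> (\<integral>y. - (indicat_real {..u} y *\<^sub>R (y * \<rho> y)) \<partial>lborel)"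
    proof (intro integral_nonneg_AE AE_I2)
      fix y
      show "0 \<le> - (indicat_real {..u} y *\<^sub>R (y * \<rho> y))"
        using False u nonneg[of y] by (cases "y \<le> u") (simp_all add: mult_nonpos_nonneg)
    qed
    then have "0 \<le> tail_mean u" unfolding tail_mean_eq set_lebesgue_integral_def by simp
    moreover have "tail_mean x = tail_mean u + (x - u) * (- \<eta> * \<rho> \<eta>)" using \<eta>(3) by (simp add: algebra_simps)
    ultimately show ?thesis by linarith
  qed
qed

text \<open>Otherwise y \<rho>(y) would have a constant sign, and one of the two expressions for
  \<open>tail_mean\<close> would contradict its positivity. The point 0 is the starting point for
  the monotonicity of \<open>Qstar\<close>.\<close>

lemma zero_in_interval: "0 \<in> open_interval a b"
proof -
  obtain x where x: "a < ereal x" "ereal x < b" using ereal_dense2[OF ab] by blast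
  then have Ax: "0 < tail_mean x" by (intro tail_mean_pos) (simp add: open_interval_def)
  have "a < ereal 0"
  proof (rule ccontr)
    assume "\<not> a < ereal 0"
    then have a: "ereal 0 \<le> a" by (rule leI)
    have "0 \<le> y * \<rho> y" for y
    proof (cases "y > 0")
      case False
      then have "ereal y \<le> ereal 0" by simp
      then have "ereal y \<le> a" using a by (rule order_trans)
      then have "y \<notin> open_interval a b" unfolding open_interval_def by (auto dest: leD)
      then show ?thesis using zero[of y] by simp
    qed (intro mult_nonneg_nonneg nonneg, simp)
    then have "0 \<le> (LBINT y:{..x}. y * \<rho> y)" unfolding set_lebesgue_integral_def
      by (intro integral_nonneg_AE AE_I2 scaleR_nonneg_nonneg) simp_all
    then show False using Ax by (simp add: tail_mean_eq)
  qed
  moreover have "ereal 0 < b"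
  proof (rule ccontr)
    assume "\<not> ereal 0 < b"
    then have b: "b \<le> ereal 0" by (rule leI)
    have "y * \<rho> y \<le> 0" for y
    proof (cases "y < 0")
      case False
      then have "ereal 0 \<le> ereal y" by simp
      then have "b \<le> ereal y" using order_trans[OF b] by blast
      then have "y \<notin> open_interval a b" unfolding open_interval_def by (auto dest: leD)
      then show ?thesis using zero[of y] by simp
    qed (intro mult_nonpos_nonneg nonneg, simp)
    then have "0 \<le> (\<integral>y. - (indicat_real {x..} y *\<^sub>R (y * \<rho> y)) \<partial>lborel)"
      by (intro integral_nonneg_AE AE_I2) (simp add: mult_nonneg_nonpos)
    then show False using Ax unfolding tail_mean_def set_lebesgue_integral_def by simp
  qed
  ultimately show ?thesis unfolding open_interval_def by simp
qed

end

lemma open_open_interval: "open (open_interval a b)"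
proof -
  have "open {x::real. a < ereal x}" "open {x::real. ereal x < b}"
    by (intro open_Collect_less continuous_intros)+
  then show ?thesis unfolding open_interval_def by (rule open_Collect_conj)
qed

lemma open_interval_convex:
  "u \<in> open_interval a b \<Longrightarrow> v \<in> open_interval a b \<Longrightarrow> u \<le> x \<Longrightarrow> x \<le> v \<Longrightarrow> x \<in> open_interval a b"
  using less_le_trans[of a "ereal u" "ereal x"] le_less_trans[of "ereal x" "ereal v" b]
  by (simp add: open_interval_def)

context centered_density
begin

lemma gstar_eq: "x \<in> open_interval a b \<Longrightarrow> gstar a b \<rho> x = tail_mean x / \<rho> x"
  by (simp add: gstar_def tail_mean_def)

lemma gstar_pos: "x \<in> open_interval a b \<Longrightarrow> 0 < gstar a b \<rho> x"
  by (simp add: gstar_eq tail_mean_pos pos)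

lemma gstar_mult: "x \<in> open_interval a b \<Longrightarrow> gstar a b \<rho> x * \<rho> x = tail_mean x"
  using pos[of x] by (simp add: gstar_eq)

text \<open>Limits at b are taken in the extended reals, since b may be infinite. A real sequence
  inside the interval is used to evaluate them.\<close>

lemma left_limit_sequence:
  obtains y :: "nat \<Rightarrow> real" where "\<And>n. y n \<in> open_interval a b" "\<And>n. 0 < y n"
    "filterlim (\<lambda>n. ereal (y n)) (at_left b) sequentially" "(\<lambda>n. ereal (y n)) \<longlonglongrightarrow> b"
proof -
  have "ereal 0 < b" using zero_in_interval by (simp add: open_interval_def)
  then obtain y :: "nat \<Rightarrow> real" where y: "\<And>n. ereal 0 < ereal (y n)" "\<And>n. ereal (y n) < b"
    "(\<lambda>n. ereal (y n)) \<longlonglongrightarrow> b"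
    by (rule ereal_incseq_approx) blast
  have "filterlim (\<lambda>n. ereal (y n)) (at_left b) sequentially"
    using y by (auto simp: filterlim_at intro!: always_eventually less_imp_neq)
  moreover have "\<And>n. y n \<in> open_interval a b"
    using zero_in_interval y less_trans[of a "ereal 0"] by (simp add: open_interval_def)
  moreover have "\<And>n. 0 < y n" using y(1) by simp
  ultimately show ?thesis using y(3) by (intro that[of y])
qed

lemma tail_mean_tendsto_0:
  assumes y: "(\<lambda>n. ereal (y n)) \<longlonglongrightarrow> b"
  shows "(\<lambda>n. tail_mean (y n)) \<longlonglongrightarrow> 0"
proof -
  have "(\<lambda>n. \<integral>x. indicator {y n..} x *\<^sub>R (x * \<rho> x) \<partial>lborel) \<longlonglongrightarrow> integral\<^sup>L lborel (\<lambda>x::real. 0)"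
  proof (rule integral_dominated_convergence[where w = "\<lambda>x. \<bar>x * \<rho> x\<bar>"])
    have [measurable]: "\<rho> \<in> borel_measurable borel" using cont by (rule borel_measurable_continuous_onI)
    show "(\<lambda>x. indicator {y n..} x *\<^sub>R (x * \<rho> x)) \<in> borel_measurable lborel" for n by measurable
    show "AE x in lborel. (\<lambda>n. indicator {y n..} x *\<^sub>R (x * \<rho> x)) \<longlonglongrightarrow> 0"
    proof (rule AE_I2)
      fix x
      show "(\<lambda>n. indicator {y n..} x *\<^sub>R (x * \<rho> x)) \<longlonglongrightarrow> 0"
      proof (cases "ereal x < b")
        case True
        have "\<forall>\<^sub>F n in sequentially. ereal x < ereal (y n)" by (rule order_tendstoD(1)[OF y True])
        then have "\<forall>\<^sub>F n in sequentially. indicator {y n..} x *\<^sub>R (x * \<rho> x) = 0"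
          by eventually_elim (simp add: indicator_def)
        then show ?thesis by (rule tendsto_eventually)
      next
        case False
        then have "x \<notin> open_interval a b" by (simp add: open_interval_def)
        then show ?thesis using zero by simp
      qed
    qed
    show "AE x in lborel. norm (indicator {y n..} x *\<^sub>R (x * \<rho> x)) \<le> \<bar>x * \<rho> x\<bar>" for n
      by (rule AE_I2) (simp add: indicator_def)
  qed (use int1 in auto)
  then show ?thesis by (simp add: tail_mean_def set_lebesgue_integral_def)
qed

section \<open>The function Q and the lower bound for the tail of Z\<close>

context
  assumes d1: "\<And>x. x \<in> open_interval a b \<Longrightarrow> \<rho> differentiable (at x)"
    and d2: "\<And>x. x \<in> open_interval a b \<Longrightarrow> deriv \<rho> differentiable (at x)"
    and g2: "\<And>x. x \<in> open_interval a b \<Longrightarrow> deriv (deriv (gstar a b \<rho>)) x < 2"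
begin

lemma gstar_deriv:
  assumes x: "x \<in> open_interval a b"
  shows "(gstar a b \<rho> has_real_derivative - x - tail_mean x * deriv \<rho> x / (\<rho> x)\<^sup>2) (at x)"
proof -
  have ev: "\<forall>\<^sub>F y in nhds x. tail_mean y / \<rho> y = gstar a b \<rho> y"
    using eventually_nhds_in_open[OF open_open_interval x] by eventually_elim (simp add: gstar_eq)
  have r: "(\<rho> has_real_derivative deriv \<rho> x) (at x)"
    using d1[OF x] by (simp add: DERIV_deriv_iff_real_differentiable)
  have "((\<lambda>y. tail_mean y / \<rho> y) has_real_derivative (- (x * \<rho> x) * \<rho> x - tail_mean x * deriv \<rho> x) / (\<rho> x * \<rho> x)) (at x)"
    using pos[OF x] by (intro DERIV_divide tail_mean_deriv r) simp
  also have "(- (x * \<rho> x) * \<rho> x - tail_mean x * deriv \<rho> x) / (\<rho> x * \<rho> x) = - x - tail_mean x * deriv \<rho> x / (\<rho> x)\<^sup>2"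
    using pos[OF x] by (simp add: power2_eq_square diff_divide_distrib)
  finally show ?thesis by (rule iffD1[OF DERIV_cong_ev[OF refl ev refl]])
qed

lemma gstar_has_deriv:
  "x \<in> open_interval a b \<Longrightarrow> (gstar a b \<rho> has_real_derivative deriv (gstar a b \<rho>) x) (at x)"
  using gstar_deriv by (metis DERIV_imp_deriv)

lemma deriv_gstar_has_deriv:
  assumes x: "x \<in> open_interval a b"
  shows "(deriv (gstar a b \<rho>) has_real_derivative deriv (deriv (gstar a b \<rho>)) x) (at x)"
proof -
  have ev: "\<forall>\<^sub>F y in nhds x. - y - tail_mean y * deriv \<rho> y / (\<rho> y)\<^sup>2 = deriv (gstar a b \<rho>) y"
    using eventually_nhds_in_open[OF open_open_interval x]
    by eventually_elim (simp add: DERIV_imp_deriv[OF gstar_deriv])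
  have r: "(\<rho> has_real_derivative deriv \<rho> x) (at x)" "(deriv \<rho> has_real_derivative deriv (deriv \<rho>) x) (at x)"
    using d1[OF x] d2[OF x] by (simp_all add: DERIV_deriv_iff_real_differentiable)
  have "\<exists>D. ((\<lambda>y. - y - tail_mean y * deriv \<rho> y / (\<rho> y)\<^sup>2) has_real_derivative D) (at x)"
    using pos[OF x] by (intro exI) (rule derivative_eq_intros tail_mean_deriv r refl | simp)+
  then obtain D where "(deriv (gstar a b \<rho>) has_real_derivative D) (at x)"
    using iffD1[OF DERIV_cong_ev[OF refl ev refl]] by blast
  then show ?thesis by (metis DERIV_imp_deriv)
qed

text \<open>The two first-order terms in g' cancel. This explains the hypothesis on g'': it makes
  \<open>Qstar\<close> increase to the right of 0.\<close>

lemma Qstar_deriv: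
  assumes x: "x \<in> open_interval a b"
  shows "(Qstar a b \<rho> has_real_derivative x * (2 - deriv (deriv (gstar a b \<rho>)) x)) (at x)"
proof -
  have "((\<lambda>z. z\<^sup>2 - z * deriv (gstar a b \<rho>) z + gstar a b \<rho> z) has_real_derivative
      x * (2 - deriv (deriv (gstar a b \<rho>)) x)) (at x)"
    by (rule derivative_eq_intros gstar_has_deriv[OF x] deriv_gstar_has_deriv[OF x] refl)+
      (simp add: algebra_simps)
  then show ?thesis by (simp add: Qstar_def[abs_def])
qed

text \<open>At 0 \<open>Qstar\<close> agrees with \<open>gstar\<close>, which is positive, and from
  there it does not decrease.\<close>

lemma Qstar_pos:
  assumes x: "x \<in> open_interval a b" "0 \<le> x"
  shows "0 < Qstar a b \<rho> x"
proof -
  have "Qstar a b \<rho> 0 \<le> Qstar a b \<rho> x"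
  proof (rule DERIV_nonneg_imp_nondecreasing[OF x(2)])
    fix y assume y: "0 \<le> y" "y \<le> x"
    then have "y \<in> open_interval a b" using open_interval_convex[OF zero_in_interval x(1)] by blast
    then show "\<exists>D. (Qstar a b \<rho> has_real_derivative D) (at y) \<and> 0 \<le> D"
      using Qstar_deriv[of y] g2[of y] y(1)
      by (intro exI[of _ "y * (2 - deriv (deriv (gstar a b \<rho>)) y)"]) simp
  qed
  moreover have "Qstar a b \<rho> 0 = gstar a b \<rho> 0" by (simp add: Qstar_def)
  ultimately show ?thesis using gstar_pos[OF zero_in_interval] by linarith
qed

text \<open>In the standard Gaussian case g = 1, and this is the classical lower bound with the
  factor z / (z * z + 1). In general the derivative of \<open>D\<close> collapses to a nonpositive
  multiple of 2 - g'', so \<open>D\<close> is bounded below by its limiting behaviour at b.\<close>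

lemma tail_lower_bound:
  assumes lim: "(((\<lambda>x. (x - deriv (gstar a b \<rho>) x) / Qstar a b \<rho> x) \<circ> real_of_ereal) \<longlongrightarrow> l) (at_left b)"
    and x: "x \<in> open_interval a b" "0 \<le> x"
  shows "(x - deriv (gstar a b \<rho>) x) / Qstar a b \<rho> x * tail_mean x \<le> 1 - mass_below x"
proof -
  define k where "k z = (z - deriv (gstar a b \<rho>) z) / Qstar a b \<rho> z" for z
  define D where "D z = (1 - mass_below z) - k z * tail_mean z" for z
  obtain y :: "nat \<Rightarrow> real" where y: "\<And>n. y n \<in> open_interval a b"
    "filterlim (\<lambda>n. ereal (y n)) (at_left b) sequentially" and yb: "(\<lambda>n. ereal (y n)) \<longlonglongrightarrow> b"
    using left_limit_sequence by metis
  have D_mono: "D v \<le> D u" if uv: "u \<in> open_interval a b" "0 \<le> u" "u \<le> v" "v \<in> open_interval a b" for u v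
  proof (rule DERIV_nonpos_imp_nonincreasing[OF uv(3)])
    fix z assume z: "u \<le> z" "z \<le> v"
    then have zI: "z \<in> open_interval a b" using open_interval_convex[OF uv(1,4)] by blast
    define g g1 g2' q where "g = gstar a b \<rho> z" and "g1 = deriv (gstar a b \<rho>) z"
      and "g2' = deriv (deriv (gstar a b \<rho>)) z" and "q = Qstar a b \<rho> z"
    have q: "q > 0" "q = z\<^sup>2 - z * g1 + g" using Qstar_pos[OF zI] z uv(2)
      by (auto simp: q_def g_def g1_def Qstar_def)
    have g: "g > 0" "g2' < 2" "tail_mean z = g * \<rho> z" using gstar_pos[OF zI] g2[OF zI] gstar_mult[OF zI]
      by (auto simp: g_def g2'_def)
    let ?k' = "((1 - g2') * q - (z - g1) * (z * (2 - g2'))) / (q * q)"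
    have dk: "(k has_real_derivative ?k') (at z)"
      unfolding k_def[abs_def] q_def g1_def g2'_def
      using q(1) unfolding q_def
      by (intro DERIV_divide DERIV_diff DERIV_ident deriv_gstar_has_deriv[OF zI] Qstar_deriv[OF zI]) simp
    have "(D has_real_derivative (0 - \<rho> z) - (?k' * tail_mean z + - (z * \<rho> z) * k z)) (at z)"
      unfolding D_def[abs_def]
      by (intro DERIV_diff DERIV_const mass_below_deriv DERIV_mult dk tail_mean_deriv)
    moreover have "(0 - \<rho> z) - (?k' * tail_mean z + - (z * \<rho> z) * k z) = - (\<rho> z * g\<^sup>2 * (2 - g2')) / (q * q)"
    proof -
      have kz: "k z = (z - g1) / q" by (simp add: k_def q_def g1_def)
      \<comment> \<open>Both identities rest on z (z - g') = Q - g.\<close>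
      have t: "(z - g1) * (z * (2 - g2')) = (q - g) * (2 - g2')" "z * \<rho> z * (z - g1) * q = \<rho> z * (q - g) * q"
        unfolding q(2) by (simp_all add: power2_eq_square algebra_simps)
      have kq: "k z * q = z - g1" "?k' * (q * q) = (1 - g2') * q - (z - g1) * (z * (2 - g2'))"
        using q(1) by (simp_all add: kz)
      have key: "((0 - \<rho> z) - (K * (g * \<rho> z) + - (z * \<rho> z) * k z)) * (q * q) =
          - \<rho> z * q * q - (K * (q * q)) * (g * \<rho> z) + z * \<rho> z * (k z * q) * q" for K
        by (simp add: algebra_simps)
      have "((0 - \<rho> z) - (?k' * tail_mean z + - (z * \<rho> z) * k z)) * (q * q) =
          - \<rho> z * q * q - (?k' * (q * q)) * (g * \<rho> z) + z * \<rho> z * (k z * q) * q"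
        unfolding g(3) by (rule key)
      also have "\<dots> = - \<rho> z * q * q - ((1 - g2') * q - (q - g) * (2 - g2')) * (g * \<rho> z) + \<rho> z * (q - g) * q"
        unfolding kq t using q(1) by simp
      also have "\<dots> = - (\<rho> z * g\<^sup>2 * (2 - g2'))"
        by (simp add: power2_eq_square algebra_simps)
      finally show ?thesis using q(1) by (subst eq_divide_eq) simp
    qed
    moreover have "- (\<rho> z * g\<^sup>2 * (2 - g2')) / (q * q) \<le> 0"
      using g pos[OF zI] q(1) by (intro divide_nonpos_pos mult_pos_pos) (simp_all add: less_imp_le)
    ultimately show "\<exists>d. (D has_real_derivative d) (at z) \<and> d \<le> 0" by metis
  qed
  \<comment> \<open>A finite limit of k makes k A vanish at b along with A; the remaining part of
    \<open>D\<close> is a probability and hence nonnegative.\<close>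
  have klim: "(\<lambda>n. k (y n)) \<longlonglongrightarrow> l"
    using filterlim_compose[OF lim y(2)] by (simp add: k_def comp_def)
  have "(\<lambda>n. - (k (y n) * tail_mean (y n))) \<longlonglongrightarrow> - (l * 0)"
    by (intro tendsto_intros klim tail_mean_tendsto_0[OF yb])
  moreover have "\<forall>\<^sub>F n in sequentially. - (k (y n) * tail_mean (y n)) \<le> D x"
  proof -
    have "\<forall>\<^sub>F n in sequentially. ereal x < ereal (y n)"
      using x(1) by (intro order_tendstoD(1)[OF yb]) (simp add: open_interval_def)
    then show ?thesis
    proof eventually_elim
      case (elim n)
      have "D (y n) \<le> D x" using elim by (intro D_mono x y(1)) simp
      then show ?case using mass_below_bounds(2)[of "y n"] unfolding D_def[of "y n"] by linarith
    qed
  qed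
  ultimately have "- (l * 0) \<le> D x" by (intro tendsto_upperbound[OF _ _ sequentially_bot])
  then show ?thesis by (simp add: D_def k_def)
qed

end

end

subsection \<open>Comparison of the tails\<close>

text \<open>F stopped at u and v has kinks, so it is not an admissible test function. Its derivative
  is cut off continuously to \<psi>, whose primitive \<phi> is admissible. The right side is bounded
  uniformly in n by the claimed integral, so only the left side has to be taken to the
  limit.\<close>

lemma (in prob_space) clamp_integration_by_parts:
  fixes X G :: "'a \<Rightarrow> real" and F F' g :: "real \<Rightarrow> real"
  assumes ibp: "\<And>\<phi> \<psi> K L. (\<And>x. (\<phi> has_real_derivative \<psi> x) (at x)) \<Longrightarrow> continuous_on UNIV \<psi> \<Longrightarrow>
      (\<And>x. \<bar>\<phi> x\<bar> \<le> K) \<Longrightarrow> (\<And>x. \<bar>\<psi> x\<bar> \<le> L) \<Longrightarrow>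
      (\<integral>\<omega>. \<phi> (X \<omega>) * X \<omega> \<partial>M) = (\<integral>\<omega>. \<psi> (X \<omega>) * G \<omega> \<partial>M)"
    and X: "integrable M X" and G: "integrable M G" and le: "AE \<omega> in M. G \<omega> \<le> g (X \<omega>)"
    and uv: "u < v" and deriv: "\<And>x. u \<le> x \<Longrightarrow> x \<le> v \<Longrightarrow> (F has_real_derivative F' x) (at x)"
    and cont: "continuous_on {u..v} F'" and F'0: "\<And>x. u \<le> x \<Longrightarrow> x \<le> v \<Longrightarrow> 0 \<le> F' x"
    and g0: "\<And>x. u \<le> x \<Longrightarrow> x \<le> v \<Longrightarrow> 0 \<le> g x"
    and int: "integrable M (\<lambda>\<omega>. indicator {u..v} (X \<omega>) * (F' (X \<omega>) * g (X \<omega>)))"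
  shows "(\<integral>\<omega>. F (max u (min v (X \<omega>))) * X \<omega> \<partial>M) \<le>
    (\<integral>\<omega>. indicator {u..v} (X \<omega>) * (F' (X \<omega>) * g (X \<omega>)) \<partial>M)"
proof -
  define cl where "cl x = max u (min v x)" for x
  have cl: "u \<le> cl x" "cl x \<le> v" for x using uv by (auto simp: cl_def)
  have cl_cont: "continuous_on S cl" for S unfolding cl_def[abs_def] by (intro continuous_intros)
  \<comment> \<open>Composition with the clamp extends F' continuously from [u, v] to the
    line.\<close>
  have F'cl: "continuous_on UNIV (\<lambda>x. F' (cl x))"
    by (rule continuous_on_compose2[OF cont cl_cont]) (use cl in auto)
  have "compact (F' ` {u..v})" by (intro compact_continuous_image cont) simp
  then obtain L where L: "\<And>x. u \<le> x \<Longrightarrow> x \<le> v \<Longrightarrow> \<bar>F' x\<bar> \<le> L"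
    using compact_imp_bounded bounded_real by (metis atLeastAtMost_iff image_eqI)
  have L0: "0 \<le> L" using L[of u] uv by auto
  \<comment> \<open>a continuous cut-off, increasing to the indicator of the open interval from \<open>u\<close> to \<open>v\<close>\<close>
  define \<tau> where "\<tau> n x = min 1 (real n * max 0 (min (x - u) (v - x)))" for n x
  have \<tau>: "0 \<le> \<tau> n x" "\<tau> n x \<le> 1" "x \<notin> {u..v} \<Longrightarrow> \<tau> n x = 0" for n x by (auto simp: \<tau>_def)
  define \<psi> where "\<psi> n x = F' (cl x) * \<tau> n x" for n x
  have \<psi>_cont: "continuous_on UNIV (\<psi> n)" for n
    unfolding \<psi>_def[abs_def] \<tau>_def by (intro continuous_intros F'cl)
  have \<psi>_0: "\<psi> n x = 0" if "x \<notin> {u..v}" for n x using \<tau>(3)[OF that] by (simp add: \<psi>_def)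
  have \<psi>_le: "0 \<le> \<psi> n x" "\<psi> n x \<le> indicator {u..v} x * F' x" "\<bar>\<psi> n x\<bar> \<le> L * indicator {u..v} x" for n x
  proof -
    have "0 \<le> \<psi> n x \<and> \<psi> n x \<le> indicator {u..v} x * F' x \<and> \<bar>\<psi> n x\<bar> \<le> L * indicator {u..v} x"
    proof (cases "x \<in> {u..v}")
      case True
      then have "cl x = x" by (simp add: cl_def)
      then have "0 \<le> \<psi> n x" "\<psi> n x \<le> F' x"
        using F'0[of x] True \<tau>(1,2)[of n x] mult_left_mono[of "\<tau> n x" 1 "F' x"] by (auto simp: \<psi>_def)
      then show ?thesis using True L[of x] by simp
    qed (simp add: \<psi>_0)
    then show "0 \<le> \<psi> n x" "\<psi> n x \<le> indicator {u..v} x * F' x" "\<bar>\<psi> n x\<bar> \<le> L * indicator {u..v} x" by auto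
  qed
  have [measurable]: "\<psi> n \<in> borel_measurable borel" for n
    using \<psi>_cont by (rule borel_measurable_continuous_onI)
  have [measurable]: "X \<in> borel_measurable M" "G \<in> borel_measurable M" using X G by auto
  have iL: "integrable lborel (\<lambda>x. L * indicator {u..v} x)"
    by (intro integrable_mult_right integrable_real_indicator) (simp_all add: emeasure_lborel_Icc_eq)
  have \<psi>_int: "integrable lborel (\<psi> n)" for n
    by (rule Bochner_Integration.integrable_bound[OF iL]) (use \<psi>_le(3) L0 in \<open>auto simp: abs_mult\<close>)
  define \<phi> where "\<phi> n x = F u + (LBINT y:{..x}. \<psi> n y)" for n x
  have \<phi>_deriv: "(\<phi> n has_real_derivative \<psi> n x) (at x)" for n x
    using DERIV_add[OF DERIV_const[of "F u"] set_integral_atMost_has_real_derivative[OF \<psi>_cont[of n] \<psi>_int[of n], of x]]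
    unfolding \<phi>_def[abs_def] by simp
  define K where "K = \<bar>F u\<bar> + L * (v - u)"
  have \<phi>_bound: "\<bar>\<phi> n x\<bar> \<le> K" for n x
  proof -
    have "\<bar>LBINT y:{..x}. \<psi> n y\<bar> \<le> (\<integral>y. L * indicator {u..v} y \<partial>lborel)"
      unfolding set_lebesgue_integral_def
    proof (rule abs_integral_le_integral[OF _ iL])
      show "integrable lborel (\<lambda>y. indicator {..x} y *\<^sub>R \<psi> n y)"
        by (rule integrable_mult_indicator[OF _ \<psi>_int]) simp
      show "\<bar>indicator {..x} y *\<^sub>R \<psi> n y\<bar> \<le> L * indicator {u..v} y" for y
        using \<psi>_le(3)[of n y] L0 by (cases "y \<le> x") simp_all
    qed
    also have "\<dots> = L * (v - u)" using uv by simp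
    finally show ?thesis unfolding \<phi>_def K_def by linarith
  qed
  have \<psi>_bound: "\<bar>\<psi> n x\<bar> \<le> L" for n x
    using \<psi>_le(3)[of n x] L0 by (cases "x \<in> {u..v}") simp_all
  have \<psi>_lim: "(\<lambda>n. \<psi> n x) \<longlonglongrightarrow> F' (cl x) * indicator {u<..<v} x" for x
  proof (cases "x \<in> {u<..<v}")
    case True
    define d where "d = min (x - u) (v - x)"
    have d: "d > 0" using True by (simp add: d_def)
    obtain m where m: "1 / d < real m" using reals_Archimedean2 by blast
    have "\<forall>\<^sub>F n in sequentially. \<psi> n x = F' (cl x) * indicator {u<..<v} x"
      using eventually_ge_at_top[of m]
    proof eventually_elim
      case (elim n)
      then have "1 / d < real n" using m by linarith
      then have "1 \<le> real n * d" using d by (simp add: divide_less_eq)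
      then have "\<tau> n x = 1" using d by (simp add: \<tau>_def d_def)
      then show ?case using True by (simp add: \<psi>_def)
    qed
    then show ?thesis by (rule tendsto_eventually)
  next
    case False
    then have "min (x - u) (v - x) \<le> 0" by auto
    then have "\<tau> n x = 0" for n by (simp add: \<tau>_def max_absorb1)
    then show ?thesis using False by (simp add: \<psi>_def)
  qed
  have [measurable]: "(\<lambda>x. F' (cl x)) \<in> borel_measurable borel"
    using F'cl by (rule borel_measurable_continuous_onI)
  have \<phi>_lim: "(\<lambda>n. \<phi> n x) \<longlonglongrightarrow> F (cl x)" for x
  proof -
    have "(\<lambda>n. LBINT y:{..x}. \<psi> n y) \<longlonglongrightarrow> (\<integral>y. indicator {..x} y *\<^sub>R (F' (cl y) * indicator {u<..<v} y) \<partial>lborel)"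
      unfolding set_lebesgue_integral_def
    proof (rule integral_dominated_convergence[where w = "\<lambda>y. L * indicator {u..v} y"])
      show "AE y in lborel. (\<lambda>n. indicat_real {..x} y *\<^sub>R \<psi> n y) \<longlonglongrightarrow> indicat_real {..x} y *\<^sub>R (F' (cl y) * indicator {u<..<v} y)"
        by (intro AE_I2 tendsto_intros \<psi>_lim)
      show "AE y in lborel. norm (indicat_real {..x} y *\<^sub>R \<psi> n y) \<le> L * indicator {u..v} y" for n
      proof (rule AE_I2)
        fix y show "norm (indicat_real {..x} y *\<^sub>R \<psi> n y) \<le> L * indicator {u..v} y"
          using \<psi>_le(3)[of n y] L0 by (cases "y \<le> x") simp_all
      qed
    qed (use iL in auto)
    \<comment> \<open>The limit of the cut-offs lives on the open interval, the fundamental theorem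
      on a closed one; the difference is confined to the endpoints.\<close>
    also have "(\<integral>y. indicator {..x} y *\<^sub>R (F' (cl y) * indicator {u<..<v} y) \<partial>lborel) =
        (\<integral>y. F' (cl y) * indicator {u..cl x} y \<partial>lborel)"
    proof (rule integral_cong_AE)
      show "AE y in lborel. indicator {..x} y *\<^sub>R (F' (cl y) * indicator {u<..<v} y) = F' (cl y) * indicator {u..cl x} y"
        using AE_lborel_singleton[of u] AE_lborel_singleton[of v]
      proof eventually_elim
        case (elim y)
        show ?case
        proof (cases "u < y \<and> y < v")
          case True
          have "y \<le> cl x \<longleftrightarrow> y \<le> x" using True by (auto simp: cl_def)
          then show ?thesis using True by (auto simp: indicator_def)
        next
          case False
          then have "\<not> (u \<le> y \<and> y \<le> cl x)" using elim cl(2)[of x] by auto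
          then show ?thesis using False by (auto simp: indicator_def)
        qed
      qed
    qed measurable
    also have "\<dots> = F (cl x) - F u"
    proof (rule integral_FTC_Icc_real)
      fix y assume y: "u \<le> y" "y \<le> cl x"
      then have "y \<le> v" using cl(2)[of x] by simp
      then show "(F has_real_derivative F' (cl y)) (at y)" using deriv[of y] y by (simp add: cl_def)
      show "isCont (\<lambda>y. F' (cl y)) y" using F'cl by (simp add: continuous_on_eq_continuous_at)
    qed (rule cl)
    finally have "(\<lambda>n. F u + (LBINT y:{..x}. \<psi> n y)) \<longlonglongrightarrow> F u + (F (cl x) - F u)"
      by (intro tendsto_intros)
    then show ?thesis by (simp add: \<phi>_def)
  qed
  have "continuous_on UNIV (\<phi> n)" for n
    using \<phi>_deriv by (meson DERIV_isCont continuous_at_imp_continuous_on)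
  then have [measurable]: "\<phi> n \<in> borel_measurable borel" for n by (rule borel_measurable_continuous_onI)
  have "(\<lambda>n. \<integral>\<omega>. \<phi> n (X \<omega>) * X \<omega> \<partial>M) \<longlonglongrightarrow> (\<integral>\<omega>. F (cl (X \<omega>)) * X \<omega> \<partial>M)"
  proof (rule integral_dominated_convergence[where w = "\<lambda>\<omega>. K * \<bar>X \<omega>\<bar>"])
    have "(\<lambda>x. F (cl x)) \<in> borel_measurable borel"
      by (rule borel_measurable_LIMSEQ_real[OF \<phi>_lim]) measurable
    then show "(\<lambda>\<omega>. F (cl (X \<omega>)) * X \<omega>) \<in> borel_measurable M" by measurable
    show "AE \<omega> in M. (\<lambda>n. \<phi> n (X \<omega>) * X \<omega>) \<longlonglongrightarrow> F (cl (X \<omega>)) * X \<omega>"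
      by (intro AE_I2 tendsto_intros \<phi>_lim)
    show "AE \<omega> in M. norm (\<phi> n (X \<omega>) * X \<omega>) \<le> K * \<bar>X \<omega>\<bar>" for n
      using \<phi>_bound by (auto simp: abs_mult intro!: mult_right_mono)
  qed (use X in auto)
  moreover have "(\<integral>\<omega>. \<phi> n (X \<omega>) * X \<omega> \<partial>M) \<le> (\<integral>\<omega>. indicator {u..v} (X \<omega>) * (F' (X \<omega>) * g (X \<omega>)) \<partial>M)" for n
  proof -
    have "(\<integral>\<omega>. \<phi> n (X \<omega>) * X \<omega> \<partial>M) = (\<integral>\<omega>. \<psi> n (X \<omega>) * G \<omega> \<partial>M)"
      by (rule ibp[OF \<phi>_deriv \<psi>_cont \<phi>_bound \<psi>_bound])
    also have "\<dots> \<le> (\<integral>\<omega>. indicator {u..v} (X \<omega>) * (F' (X \<omega>) * g (X \<omega>)) \<partial>M)"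
    proof (rule integral_mono_AE[OF _ int])
      show "integrable M (\<lambda>\<omega>. \<psi> n (X \<omega>) * G \<omega>)"
        by (rule Bochner_Integration.integrable_bound[OF integrable_mult_right[OF integrable_abs[OF G], of L]])
          (use \<psi>_bound L0 in \<open>auto simp: abs_mult intro!: mult_right_mono\<close>)
      show "AE \<omega> in M. \<psi> n (X \<omega>) * G \<omega> \<le> indicator {u..v} (X \<omega>) * (F' (X \<omega>) * g (X \<omega>))"
        using le
      proof eventually_elim
        case (elim \<omega>)
        show ?case
        proof (cases "X \<omega> \<in> {u..v}")
          case True
          \<comment> \<open>The sign of \<psi>, inherited from F', is what allows G to be replaced
            by g.\<close>
          have "\<psi> n (X \<omega>) * G \<omega> \<le> \<psi> n (X \<omega>) * g (X \<omega>)" by (rule mult_left_mono[OF elim \<psi>_le(1)])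
          also have "\<dots> \<le> F' (X \<omega>) * g (X \<omega>)"
            using \<psi>_le(2)[of n "X \<omega>"] True g0[of "X \<omega>"] by (intro mult_right_mono) auto
          finally show ?thesis using True by simp
        qed (simp add: \<psi>_0)
      qed
    qed
    finally show ?thesis .
  qed
  ultimately have "(\<integral>\<omega>. F (cl (X \<omega>)) * X \<omega> \<partial>M) \<le> (\<integral>\<omega>. indicator {u..v} (X \<omega>) * (F' (X \<omega>) * g (X \<omega>)) \<partial>M)"
    by (meson LIMSEQ_le_const2)
  then show ?thesis by (simp only: cl_def)
qed

section \<open>Monotone ratios and the two comparison inequalities\<close>

context centered_density
begin

lemma borel_measurable_density [measurable]: "\<rho> \<in> borel_measurable borel"
  using cont by (rule borel_measurable_continuous_onI)

lemma continuous_tail_mean_mass_below: "continuous_on S tail_mean" "continuous_on S mass_below"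
  using tail_mean_deriv mass_below_deriv by (meson DERIV_isCont continuous_at_imp_continuous_on)+

lemma borel_measurable_tail_mean_mass_below [measurable]: "tail_mean \<in> borel_measurable borel" "mass_below \<in> borel_measurable borel"
  using continuous_tail_mean_mass_below by (auto intro: borel_measurable_continuous_onI)

lemma ratio_deriv:
  assumes "x \<in> open_interval a b"
  shows "((\<lambda>x. mass_below x / tail_mean x) has_real_derivative \<rho> x * (tail_mean x + x * mass_below x) / (tail_mean x * tail_mean x)) (at x)"
proof -
  have "((\<lambda>x. mass_below x / tail_mean x) has_real_derivative (\<rho> x * tail_mean x - mass_below x * - (x * \<rho> x)) / (tail_mean x * tail_mean x)) (at x)"
    using tail_mean_pos[OF assms] by (intro DERIV_divide mass_below_deriv tail_mean_deriv) simp
  then show ?thesis by (simp add: algebra_simps)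
qed

lemma tail_ratio_antimono:
  assumes x: "x \<in> open_interval a b" "0 \<le> x" and y: "y \<in> open_interval a b" and xy: "x \<le> y"
  shows "(1 - mass_below y) / tail_mean y \<le> (1 - mass_below x) / tail_mean x"
proof (rule DERIV_nonpos_imp_nonincreasing[OF xy])
  fix t assume t: "x \<le> t" "t \<le> y"
  then have tI: "t \<in> open_interval a b" using open_interval_convex[OF x(1) y] by blast
  have "((\<lambda>x. (1 - mass_below x) / tail_mean x) has_real_derivative
      ((0 - \<rho> t) * tail_mean t - (1 - mass_below t) * - (t * \<rho> t)) / (tail_mean t * tail_mean t)) (at t)"
    using tail_mean_pos[OF tI] by (intro DERIV_divide DERIV_diff DERIV_const mass_below_deriv tail_mean_deriv) simp
  moreover have "((0 - \<rho> t) * tail_mean t - (1 - mass_below t) * - (t * \<rho> t)) = - (\<rho> t * (tail_mean t - t * (1 - mass_below t)))"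
    by (simp add: algebra_simps)
  moreover have "- (\<rho> t * (tail_mean t - t * (1 - mass_below t))) / (tail_mean t * tail_mean t) \<le> 0"
    using tail_mean_ge(1)[of t] nonneg[of t] tail_mean_pos[OF tI] by (intro divide_nonpos_pos) simp_all
  ultimately show "\<exists>d. ((\<lambda>x. (1 - mass_below x) / tail_mean x) has_real_derivative d) (at t) \<and> d \<le> 0" by metis
qed

lemma ratio_mono:
  assumes x: "x \<in> open_interval a b" and y: "y \<in> open_interval a b" and xy: "x \<le> y"
  shows "mass_below x / tail_mean x \<le> mass_below y / tail_mean y"
proof (rule DERIV_nonneg_imp_nondecreasing[OF xy])
  fix t assume t: "x \<le> t" "t \<le> y"
  then have tI: "t \<in> open_interval a b" using open_interval_convex[OF x y] by blast
  have "0 \<le> \<rho> t * (tail_mean t + t * mass_below t) / (tail_mean t * tail_mean t)"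
    using tail_mean_ge(2)[of t] nonneg[of t] tail_mean_pos[OF tI] by (intro divide_nonneg_pos mult_nonneg_nonneg) simp_all
  then show "\<exists>d. ((\<lambda>x. mass_below x / tail_mean x) has_real_derivative d) (at t) \<and> 0 \<le> d"
    using ratio_deriv[OF tI] by blast
qed

lemma ratio_nonneg: "x \<in> open_interval a b \<Longrightarrow> 0 \<le> mass_below x / tail_mean x"
  using mass_below_bounds(1) tail_mean_pos by (simp add: less_imp_le)

text \<open>F is stopped at z and also at some u < z, since the test function must be controlled
  near a as well. On [u, z] the terms X F(X) cancel by Stein's equation, leaving F(z) E[X; X > z] +
  F(u) E[X; X < u] on the left and at most P[X \<le> z] on the right. Monotonicity of F bounds the
  second term by F(z) E[|X|; X < u], which vanishes as u tends to a.\<close>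

lemma stein_left_comparison:
  fixes M :: "'w measure" and X G :: "'w \<Rightarrow> real"
  assumes M: "prob_space M"
    and ibp: "\<And>\<phi> \<psi> K L. (\<And>x. (\<phi> has_real_derivative \<psi> x) (at x)) \<Longrightarrow> continuous_on UNIV \<psi> \<Longrightarrow>
      (\<And>x. \<bar>\<phi> x\<bar> \<le> K) \<Longrightarrow> (\<And>x. \<bar>\<psi> x\<bar> \<le> L) \<Longrightarrow>
      (\<integral>\<omega>. \<phi> (X \<omega>) * X \<omega> \<partial>M) = (\<integral>\<omega>. \<psi> (X \<omega>) * G \<omega> \<partial>M)"
    and X: "integrable M X" and XI: "AE \<omega> in M. X \<omega> \<in> open_interval a b"
    and G: "integrable M G" and le: "AE \<omega> in M. G \<omega> \<le> gstar a b \<rho> (X \<omega>)"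
    and z: "z \<in> open_interval a b"
  shows "mass_below z / tail_mean z * (\<integral>\<omega>. indicator {z<..} (X \<omega>) * X \<omega> \<partial>M) \<le> measure M {\<omega>\<in>space M. X \<omega> \<le> z}"
proof -
  interpret prob_space M by (rule M)
  define F where "F x = mass_below x / tail_mean x" for x
  have [measurable]: "X \<in> borel_measurable M" using X by auto
  have [measurable]: "F \<in> borel_measurable borel" unfolding F_def[abs_def] by measurable
  have iX: "integrable M (\<lambda>\<omega>. \<bar>X \<omega>\<bar>)" using X by simp
  have iXz: "integrable M (\<lambda>\<omega>. indicator {z<..} (X \<omega>) * X \<omega>)"
    by (rule Bochner_Integration.integrable_bound[OF X]) (auto simp: indicator_def)
  have iXu: "integrable M (\<lambda>\<omega>. indicator {..<u} (X \<omega>) * \<bar>X \<omega>\<bar>)" for u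
    by (rule Bochner_Integration.integrable_bound[OF X]) (auto simp: indicator_def)
  have Fz: "0 \<le> F z" using ratio_nonneg[OF z] by (simp add: F_def)
  have step: "F z * (\<integral>\<omega>. indicator {z<..} (X \<omega>) * X \<omega> \<partial>M) \<le>
      measure M {\<omega>\<in>space M. X \<omega> \<le> z} + F z * (\<integral>\<omega>. indicator {..<u} (X \<omega>) * \<bar>X \<omega>\<bar> \<partial>M)"
    if u: "u \<in> open_interval a b" "u < z" for u
  proof -
    let ?F' = "\<lambda>x. \<rho> x * (tail_mean x + x * mass_below x) / (tail_mean x * tail_mean x)"
    let ?I = "\<lambda>\<omega>. indicator {u..z} (X \<omega>) :: real"
    have in_I: "x \<in> open_interval a b" if "u \<le> x" "x \<le> z" for x
      using open_interval_convex[OF u(1) z] that by blast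
    have F: "0 \<le> F x" "F x \<le> F z" if "u \<le> x" "x \<le> z" for x
      using ratio_nonneg[OF in_I[OF that]] ratio_mono[OF in_I[OF that] z that(2)] by (auto simp: F_def)
    \<comment> \<open>Stein's equation for F.\<close>
    have F'g: "?F' x * gstar a b \<rho> x = 1 + x * F x" if "u \<le> x" "x \<le> z" for x
      using tail_mean_pos[OF in_I[OF that]] pos[OF in_I[OF that]]
      by (simp add: gstar_eq[OF in_I[OF that]] F_def field_simps)
    have eq: "?I \<omega> * (?F' (X \<omega>) * gstar a b \<rho> (X \<omega>)) = ?I \<omega> + ?I \<omega> * (X \<omega> * F (X \<omega>))" for \<omega>
      using F'g[of "X \<omega>"] by (cases "X \<omega> \<in> {u..z}") simp_all
    have i1: "integrable M (\<lambda>\<omega>. ?I \<omega> * (X \<omega> * F (X \<omega>)))"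
    proof (rule Bochner_Integration.integrable_bound[OF integrable_mult_right[OF iX, of "F z"]])
      show "AE \<omega> in M. norm (?I \<omega> * (X \<omega> * F (X \<omega>))) \<le> norm (F z * \<bar>X \<omega>\<bar>)"
      proof (rule AE_I2)
        fix \<omega> show "norm (?I \<omega> * (X \<omega> * F (X \<omega>))) \<le> norm (F z * \<bar>X \<omega>\<bar>)"
          using F[of "X \<omega>"] Fz mult_right_mono[of "F (X \<omega>)" "F z" "\<bar>X \<omega>\<bar>"]
          by (cases "X \<omega> \<in> {u..z}") (simp_all add: abs_mult mult.commute)
      qed
    qed measurable
    have iI: "integrable M ?I" by (rule integrable_const_bound[of _ 1]) (auto simp: indicator_def)
    have int: "integrable M (\<lambda>\<omega>. ?I \<omega> * (?F' (X \<omega>) * gstar a b \<rho> (X \<omega>)))"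
      unfolding eq using iI i1 by simp
    have clamp: "(\<integral>\<omega>. F (max u (min z (X \<omega>))) * X \<omega> \<partial>M) \<le>
        (\<integral>\<omega>. ?I \<omega> * (?F' (X \<omega>) * gstar a b \<rho> (X \<omega>)) \<partial>M)"
    proof (rule clamp_integration_by_parts[OF ibp X G le u(2) _ _ _ _ int])
      fix x assume x: "u \<le> x" "x \<le> z"
      note xI = in_I[OF x]
      show "(F has_real_derivative ?F' x) (at x)" using ratio_deriv[OF xI] by (simp add: F_def[abs_def])
      show "0 \<le> ?F' x"
        using tail_mean_ge(2)[of x] nonneg[of x] tail_mean_pos[OF xI] by (intro divide_nonneg_pos mult_nonneg_nonneg) simp_all
      show "0 \<le> gstar a b \<rho> x" using gstar_pos[OF xI] by simp
    next
      have "tail_mean x \<noteq> 0" if "x \<in> {u..z}" for x using tail_mean_pos[OF in_I] that by (simp add: less_imp_neq[THEN not_sym])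
      then show "continuous_on {u..z} ?F'"
        by (intro continuous_intros continuous_tail_mean_mass_below continuous_on_subset[OF cont]) auto
    qed
    have iclamp: "integrable M (\<lambda>\<omega>. F (max u (min z (X \<omega>))) * X \<omega>)"
    proof (rule Bochner_Integration.integrable_bound[OF integrable_mult_right[OF iX, of "F z"]])
      show "AE \<omega> in M. norm (F (max u (min z (X \<omega>))) * X \<omega>) \<le> norm (F z * \<bar>X \<omega>\<bar>)"
      proof (rule AE_I2)
        fix \<omega>
        have "u \<le> max u (min z (X \<omega>))" "max u (min z (X \<omega>)) \<le> z" using u by auto
        from F[OF this] Fz show "norm (F (max u (min z (X \<omega>))) * X \<omega>) \<le> norm (F z * \<bar>X \<omega>\<bar>)"
          by (simp add: abs_mult mult_right_mono)
      qed
    qed measurable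
    have "F z * (\<integral>\<omega>. indicator {z<..} (X \<omega>) * X \<omega> \<partial>M) - F z * (\<integral>\<omega>. indicator {..<u} (X \<omega>) * \<bar>X \<omega>\<bar> \<partial>M) =
        (\<integral>\<omega>. F z * (indicator {z<..} (X \<omega>) * X \<omega>) - F z * (indicator {..<u} (X \<omega>) * \<bar>X \<omega>\<bar>) \<partial>M)"
      using iXz iXu[of u] by simp
    \<comment> \<open>The only loss occurs for X < u, where F(u) is replaced by the larger F(z) and
      X by minus its absolute value; elsewhere the integrands agree.\<close>
    also have "\<dots> \<le> (\<integral>\<omega>. F (max u (min z (X \<omega>))) * X \<omega> - ?I \<omega> * (X \<omega> * F (X \<omega>)) \<partial>M)"
    proof (rule integral_mono)
      fix \<omega>
      consider "X \<omega> < u" | "u \<le> X \<omega>" "X \<omega> \<le> z" | "z < X \<omega>" by linarith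
      then show "F z * (indicator {z<..} (X \<omega>) * X \<omega>) - F z * (indicator {..<u} (X \<omega>) * \<bar>X \<omega>\<bar>)
          \<le> F (max u (min z (X \<omega>))) * X \<omega> - ?I \<omega> * (X \<omega> * F (X \<omega>))"
      proof cases
        case 1
        have "- (F z * \<bar>X \<omega>\<bar>) \<le> - (F u * \<bar>X \<omega>\<bar>)" using F[of u] u by (simp add: mult_right_mono)
        also have "- (F u * \<bar>X \<omega>\<bar>) = F u * - \<bar>X \<omega>\<bar>" by simp
        also have "\<dots> \<le> F u * X \<omega>"
          using F[of u] u by (intro mult_left_mono) simp_all
        finally show ?thesis using 1 u by simp
      qed (use u in simp_all)
    qed (use iXz iXu[of u] iclamp i1 in auto)
    also have "\<dots> = (\<integral>\<omega>. F (max u (min z (X \<omega>))) * X \<omega> \<partial>M) - (\<integral>\<omega>. ?I \<omega> * (X \<omega> * F (X \<omega>)) \<partial>M)"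
      using iclamp i1 by simp
    also have "\<dots> \<le> (\<integral>\<omega>. ?I \<omega> \<partial>M)"
      using clamp iI i1 unfolding eq by simp
    also have "\<dots> \<le> (\<integral>\<omega>. indicator {\<omega>\<in>space M. X \<omega> \<le> z} \<omega> \<partial>M)"
      by (rule integral_mono[OF iI])
        (auto simp: indicator_def intro!: integrable_const_bound[of _ 1])
    also have "\<dots> = measure M {\<omega>\<in>space M. X \<omega> \<le> z}" by simp
    finally show ?thesis by simp
  qed
  \<comment> \<open>A sequence of lower stopping points u that decreases to a, where X puts no
    mass.\<close>
  have az: "a < ereal z" using z by (simp add: open_interval_def)
  then obtain y :: "nat \<Rightarrow> real" where y: "\<And>n. a < ereal (y n)" "\<And>n. ereal (y n) < ereal z" "(\<lambda>n. ereal (y n)) \<longlonglongrightarrow> a"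
    by (rule ereal_decseq_approx) blast
  have yI: "y n \<in> open_interval a b" "y n < z" for n
    using y(1)[of n] y(2)[of n] z less_trans[OF y(2)[of n], of b] by (simp_all add: open_interval_def)
  have "(\<lambda>n. \<integral>\<omega>. indicator {..<y n} (X \<omega>) * \<bar>X \<omega>\<bar> \<partial>M) \<longlonglongrightarrow> (\<integral>\<omega>. 0 \<partial>M)"
  proof (rule integral_dominated_convergence[where w = "\<lambda>\<omega>. \<bar>X \<omega>\<bar>"])
    show "AE \<omega> in M. (\<lambda>n. indicator {..<y n} (X \<omega>) * \<bar>X \<omega>\<bar>) \<longlonglongrightarrow> 0"
      using XI
    proof eventually_elim
      case (elim \<omega>)
      then have "\<forall>\<^sub>F n in sequentially. ereal (y n) < ereal (X \<omega>)"
        by (intro order_tendstoD(2)[OF y(3)]) (simp add: open_interval_def)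
      then have "\<forall>\<^sub>F n in sequentially. indicator {..<y n} (X \<omega>) * \<bar>X \<omega>\<bar> = 0"
        by eventually_elim (simp add: indicator_def)
      then show ?case by (rule tendsto_eventually)
    qed
    show "AE \<omega> in M. norm (indicator {..<y n} (X \<omega>) * \<bar>X \<omega>\<bar>) \<le> \<bar>X \<omega>\<bar>" for n
      by (rule AE_I2) (simp add: indicator_def)
  qed (use iX in auto)
  then have "(\<lambda>n. measure M {\<omega>\<in>space M. X \<omega> \<le> z} + F z * (\<integral>\<omega>. indicator {..<y n} (X \<omega>) * \<bar>X \<omega>\<bar> \<partial>M))
      \<longlonglongrightarrow> measure M {\<omega>\<in>space M. X \<omega> \<le> z} + F z * 0"
    by (intro tendsto_intros) simp
  then have "F z * (\<integral>\<omega>. indicator {z<..} (X \<omega>) * X \<omega> \<partial>M) \<le> measure M {\<omega>\<in>space M. X \<omega> \<le> z} + F z * 0"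
    by (rule LIMSEQ_le_const) (use step[OF yI] in blast)
  then show ?thesis by (simp add: F_def)
qed

text \<open>For X > z the pointwise bound at X is weakened by replacing \<Phi> / A at X with its
  larger value at z. The factor X is positive because z is nonnegative.\<close>

lemma tail_right_comparison:
  fixes M :: "'w measure" and X :: "'w \<Rightarrow> real"
  assumes M: "prob_space M" and X: "integrable M X" and XI: "AE \<omega> in M. X \<omega> \<in> open_interval a b"
    and z: "z \<in> open_interval a b" "0 \<le> z"
    and lower: "\<And>x. x \<in> open_interval a b \<Longrightarrow> z < x \<Longrightarrow> r \<le> x * ((1 - mass_below x) / tail_mean x)"
  shows "r * measure M {\<omega>\<in>space M. z < X \<omega>} \<le>
    (1 - mass_below z) / tail_mean z * (\<integral>\<omega>. indicator {z<..} (X \<omega>) * X \<omega> \<partial>M)"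
proof -
  interpret prob_space M by (rule M)
  have [measurable]: "X \<in> borel_measurable M" using X by auto
  have iXz: "integrable M (\<lambda>\<omega>. indicator {z<..} (X \<omega>) * X \<omega>)"
    by (rule Bochner_Integration.integrable_bound[OF X]) (auto simp: indicator_def)
  have iI: "integrable M (\<lambda>\<omega>. indicator {\<omega>\<in>space M. z < X \<omega>} \<omega> :: real)"
    by (rule integrable_const_bound[of _ 1]) (auto simp: indicator_def)
  have "r * measure M {\<omega>\<in>space M. z < X \<omega>} = (\<integral>\<omega>. r * indicator {\<omega>\<in>space M. z < X \<omega>} \<omega> \<partial>M)" by simp
  also have "\<dots> \<le> (\<integral>\<omega>. (1 - mass_below z) / tail_mean z * (indicator {z<..} (X \<omega>) * X \<omega>) \<partial>M)"
  proof (rule integral_mono_AE)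
    show "AE \<omega> in M. r * indicator {\<omega>\<in>space M. z < X \<omega>} \<omega> \<le> (1 - mass_below z) / tail_mean z * (indicator {z<..} (X \<omega>) * X \<omega>)"
      using XI AE_space
    proof eventually_elim
      case (elim \<omega>)
      show ?case
      proof (cases "z < X \<omega>")
        case True
        have "r \<le> X \<omega> * ((1 - mass_below (X \<omega>)) / tail_mean (X \<omega>))" by (rule lower[OF elim(1) True])
        also have "\<dots> \<le> X \<omega> * ((1 - mass_below z) / tail_mean z)"
          using True z by (intro mult_left_mono tail_ratio_antimono z elim(1)) simp_all
        finally show ?thesis using True elim(2) by (simp add: mult.commute)
      qed simp
    qed
  qed (use iXz iI in auto)
  finally show ?thesis by simp
qed

end

section \<open>Comparison near b and elimination of E[X; X > z]\<close>

theorem theorem13: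
  fixes M :: "'w measure" and W :: "'h::{real_inner, polish_space} \<Rightarrow> 'w \<Rightarrow> real"
    and E :: "'h set"
    and N :: "'z measure" and Z :: "'z \<Rightarrow> real"
    and a b :: ereal and \<rho> :: "real \<Rightarrow> real" and c :: real
    and X Y :: "'w \<Rightarrow> real" and DX DY :: "'w \<Rightarrow> 'h" and p :: "real \<Rightarrow> real"
  assumes W: "isonormal_process M W" "generated_by M W"
    and E: "orthonormal_basis E"
    and Z: "prob_space N" "distributed N lborel Z (\<lambda>x. ennreal (\<rho> x))"
      "integrable N Z" "(\<integral>\<omega>. Z \<omega> \<partial>N) = 0"
    and ab: "a < b"
    and support: "\<And>x. x \<in> open_interval a b \<Longrightarrow> \<rho> x > 0"
      "\<And>x. x \<notin> open_interval a b \<Longrightarrow> \<rho> x = 0"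
    and smooth: "continuous_on UNIV \<rho>"
      "\<And>x. x \<in> open_interval a b \<Longrightarrow> \<rho> differentiable (at x)"
      "\<And>x. x \<in> open_interval a b \<Longrightarrow> deriv \<rho> differentiable (at x)"
    and g'': "\<And>x. x \<in> open_interval a b \<Longrightarrow> deriv (deriv (gstar a b \<rho>)) x < 2"
    and limits:
      "\<exists>l::real. (((\<lambda>x. (x - deriv (gstar a b \<rho>) x) / Qstar a b \<rho> x) \<circ> real_of_ereal)
          \<longlongrightarrow> l) (at_right a)"
      "\<exists>l::real. (((\<lambda>x. (x - deriv (gstar a b \<rho>) x) / Qstar a b \<rho> x) \<circ> real_of_ereal)
          \<longlongrightarrow> l) (at_left b)"
    and c: "c < 1"
      "Limsup (at_left b)
         ((\<lambda>z. ereal (gstar a b \<rho> z / Qstar a b \<rho> z)) \<circ> real_of_ereal) < ereal c"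
    and X: "X \<in> malliavin_D12 M W E" "(\<integral>\<omega>. X \<omega> \<partial>M) = 0"
      "distributed M lborel X (\<lambda>x. ennreal (p x))" "\<And>x. p x \<ge> 0"
      "\<And>x. x \<notin> open_interval a b \<Longrightarrow> p x = 0"
    and DX: "malliavin_derivative M W E X DX"
    and DY: "neg_OU_pseudo_inverse M W E X Y" "malliavin_derivative M W E Y DY"
    and G: "AE \<omega> in M. DX \<omega> \<bullet> DY \<omega> \<le> gstar a b \<rho> (X \<omega>)"
  shows "\<exists>z0::real. ereal z0 < b \<and> (\<forall>z::real. z0 < z \<and> ereal z < b \<longrightarrow>
    measure M {\<omega>\<in>space M. X \<omega> > z} \<le> 1 / (1 - c) * measure N {\<omega>\<in>space N. Z \<omega> > z})"
proof -
  interpret malliavin_family M W E by (rule isonormal_process_malliavin_family[OF W(1) E])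
  interpret N: prob_space N by (rule Z(1))
  have Zm [measurable]: "Z \<in> borel_measurable N" using Z(3) by auto
  have \<rho>0: "0 \<le> \<rho> x" for x
    using support(1)[of x] support(2)[of x] by (cases "x \<in> open_interval a b") auto
  interpret D: centered_density a b \<rho>
  proof
    show "integrable lborel \<rho>" "(\<integral>x. \<rho> x \<partial>lborel) = 1"
      using distributed_integrable[OF Z(2), of "\<lambda>_. 1"] distributed_integral[OF Z(2), of "\<lambda>_. 1"] \<rho>0
      by (simp_all add: N.prob_space)
    show "integrable lborel (\<lambda>x. x * \<rho> x)" "(\<integral>x. x * \<rho> x \<partial>lborel) = 0"
      using distributed_integrable[OF Z(2), of "\<lambda>x. x"] distributed_integral[OF Z(2), of "\<lambda>x. x"] \<rho>0 Z(3,4)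
      by (simp_all add: mult.commute)
  qed (use support smooth(1) ab in auto)
  have tail_Z: "measure N {\<omega>\<in>space N. Z \<omega> > z} = 1 - D.mass_below z" for z
  proof -
    have "D.mass_below z = (\<integral>\<omega>. indicator {..z} (Z \<omega>) \<partial>N)"
      unfolding D.mass_below_def set_lebesgue_integral_def
      using distributed_integral[OF Z(2), of "indicator {..z}"] \<rho>0 by (simp add: mult.commute)
    also have "\<dots> = (\<integral>\<omega>. indicator {\<omega>\<in>space N. Z \<omega> \<le> z} \<omega> \<partial>N)"
      by (intro Bochner_Integration.integral_cong) (auto simp: indicator_def)
    also have "\<dots> = measure N {\<omega>\<in>space N. Z \<omega> \<le> z}" by simp
    finally show ?thesis using N.prob_neg[of "\<lambda>\<omega>. Z \<omega> \<le> z"] by (simp add: not_le)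
  qed
  have X2: "square_integrable M X" using X(1) by (simp add: malliavin_D12_def square_integrable_def)
  have Xm [measurable]: "X \<in> borel_measurable M" using X2 by (rule square_integrable_measurable)
  have iX: "integrable M X"
    using square_integrable_mult_integrable[OF X2, of "\<lambda>_. 1"] by (simp add: square_integrable_def)
  have XI: "AE \<omega> in M. X \<omega> \<in> open_interval a b"
  proof -
    have "AE x in density lborel (\<lambda>x. ennreal (p x)). x \<in> open_interval a b"
    proof (subst AE_density)
      show "(\<lambda>x. ennreal (p x)) \<in> borel_measurable lborel" using X(3) by (simp add: distributed_def)
      show "AE x in lborel. 0 < ennreal (p x) \<longrightarrow> x \<in> open_interval a b"
      proof (rule AE_I2)
        fix x show "0 < ennreal (p x) \<longrightarrow> x \<in> open_interval a b"
          using X(5)[of x] by (cases "x \<in> open_interval a b") simp_all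
      qed
    qed
    moreover have "distr M lborel X = density lborel (\<lambda>x. ennreal (p x))"
      using X(3) unfolding distributed_def by blast
    ultimately have "AE x in distr M lborel X. x \<in> open_interval a b" by (simp only:)
    then show ?thesis by (rule AE_distrD[rotated]) simp
  qed
  have iG: "integrable M (\<lambda>\<omega>. DX \<omega> \<bullet> DY \<omega>)"
    by (rule malliavin_integration_by_parts(1)[OF DX X(2) DY, of "\<lambda>_. 0" "\<lambda>_. 0" 0 0]) auto
  have ibp: "(\<integral>\<omega>. \<phi> (X \<omega>) * X \<omega> \<partial>M) = (\<integral>\<omega>. \<psi> (X \<omega>) * (DX \<omega> \<bullet> DY \<omega>) \<partial>M)"
    if "\<And>x. (\<phi> has_real_derivative \<psi> x) (at x)" "continuous_on UNIV \<psi>" "\<And>x. \<bar>\<phi> x\<bar> \<le> K" "\<And>x. \<bar>\<psi> x\<bar> \<le> L"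
    for \<phi> \<psi> :: "real \<Rightarrow> real" and K L
    by (rule malliavin_integration_by_parts(2)[OF DX X(2) DY that])
  obtain l where l: "(((\<lambda>x. (x - deriv (gstar a b \<rho>) x) / Qstar a b \<rho> x) \<circ> real_of_ereal) \<longlongrightarrow> l) (at_left b)"
    using limits(2) by blast
  have "\<forall>\<^sub>F x in at_left b. ((\<lambda>z. ereal (gstar a b \<rho> z / Qstar a b \<rho> z)) \<circ> real_of_ereal) x < ereal c"
    by (rule Limsup_lessD[OF c(2)])
  then obtain \<beta> where \<beta>: "\<beta> < b" "\<And>y. \<beta> < y \<Longrightarrow> y < b \<Longrightarrow>
      ((\<lambda>z. ereal (gstar a b \<rho> z / Qstar a b \<rho> z)) \<circ> real_of_ereal) y < ereal c"
    unfolding eventually_at_left[OF ab] by blast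
  have "ereal 0 < b" and a0: "a < ereal 0" using D.zero_in_interval by (simp_all add: open_interval_def)
  then have "max (ereal 0) \<beta> < b" using \<beta>(1) by simp
  \<comment> \<open>Beyond z0 the argument is positive, so that Q is positive, and g / Q stays below
    c.\<close>
  then obtain z0 where z0: "max (ereal 0) \<beta> < ereal z0" "ereal z0 < b" using ereal_dense2 by blast
  have near: "x \<in> open_interval a b" "0 < x" "0 < gstar a b \<rho> x / Qstar a b \<rho> x" "gstar a b \<rho> x / Qstar a b \<rho> x < c"
    if x: "z0 < x" "ereal x < b" for x
  proof -
    have "ereal 0 < ereal x" and \<beta>x: "\<beta> < ereal x"
      using z0(1) x(1) less_trans[of _ "ereal z0" "ereal x"] by simp_all
    then show x0: "0 < x" by simp
    show xI: "x \<in> open_interval a b" using less_trans[OF a0 \<open>ereal 0 < ereal x\<close>] x(2) by (simp add: open_interval_def)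
    show "0 < gstar a b \<rho> x / Qstar a b \<rho> x"
      using x0 by (intro divide_pos_pos D.gstar_pos D.Qstar_pos smooth(2,3) g'' xI) auto
    show "gstar a b \<rho> x / Qstar a b \<rho> x < c" using \<beta>(2)[OF \<beta>x x(2)] by simp
  qed
  have lower: "1 - c \<le> x * ((1 - D.mass_below x) / D.tail_mean x)" if x: "z0 < x" "ereal x < b" for x
  proof -
    note n = near[OF x]
    let ?Q = "Qstar a b \<rho> x" and ?g = "gstar a b \<rho> x" and ?g1 = "deriv (gstar a b \<rho>) x"
    have Q: "0 < ?Q" using n(2) by (intro D.Qstar_pos smooth(2,3) g'' n(1)) auto
    have "(x - ?g1) / ?Q * D.tail_mean x \<le> 1 - D.mass_below x"
      using n(2) by (intro D.tail_lower_bound[OF smooth(2,3) g'' l n(1)]) auto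
    then have "(x - ?g1) / ?Q \<le> (1 - D.mass_below x) / D.tail_mean x" using D.tail_mean_pos[OF n(1)] by (simp add: pos_le_divide_eq)
    then have "x * ((x - ?g1) / ?Q) \<le> x * ((1 - D.mass_below x) / D.tail_mean x)" using n(2) by (intro mult_left_mono) auto
    moreover have "x * ((x - ?g1) / ?Q) = 1 - ?g / ?Q"
    proof -
      have xg: "x * (x - ?g1) = ?Q - ?g" by (simp add: Qstar_def power2_eq_square algebra_simps)
      have "x * ((x - ?g1) / ?Q) = (?Q - ?g) / ?Q" unfolding xg[symmetric] by simp
      also have "\<dots> = 1 - ?g / ?Q" using Q by (simp add: diff_divide_distrib)
      finally show ?thesis .
    qed
    ultimately show ?thesis using n(4) by linarith
  qed
  have "measure M {\<omega>\<in>space M. X \<omega> > z} \<le> 1 / (1 - c) * measure N {\<omega>\<in>space N. Z \<omega> > z}"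
    if z: "z0 < z" "ereal z < b" for z
  proof -
    note n = near[OF z]
    \<comment> \<open>\<open>C\<close> is the tail of Z at z by \<open>tail_Z\<close>. The ratio
      \<open>r\<close> would be 1 if X had the law of Z.\<close>
    define P C r where "P = measure M {\<omega>\<in>space M. X \<omega> > z}" and "C = 1 - D.mass_below z"
      and "r = (\<integral>\<omega>. indicator {z<..} (X \<omega>) * X \<omega> \<partial>M) / D.tail_mean z"
    have "measure M {\<omega>\<in>space M. X \<omega> \<le> z} = 1 - P"
      unfolding P_def using prob_neg[of "\<lambda>\<omega>. z < X \<omega>"] by (simp add: not_less)
    moreover have "D.mass_below z / D.tail_mean z * (\<integral>\<omega>. indicator {z<..} (X \<omega>) * X \<omega> \<partial>M) \<le> measure M {\<omega>\<in>space M. X \<omega> \<le> z}"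
      by (rule D.stein_left_comparison[OF prob_space_axioms _ iX XI iG G n(1)]) (rule ibp; assumption)
    ultimately have left: "(1 - C) * r \<le> 1 - P" by (simp add: C_def r_def)
    have right: "(1 - c) * P \<le> C * r"
    proof -
      have "(1 - c) * measure M {\<omega>\<in>space M. z < X \<omega>} \<le>
          (1 - D.mass_below z) / D.tail_mean z * (\<integral>\<omega>. indicator {z<..} (X \<omega>) * X \<omega> \<partial>M)"
      proof (rule D.tail_right_comparison[OF prob_space_axioms iX XI n(1)])
        show "1 - c \<le> x * ((1 - D.mass_below x) / D.tail_mean x)" if "x \<in> open_interval a b" "z < x" for x
          using that z(1) by (intro lower) (simp_all add: open_interval_def)
      qed (use n(2) in simp)
      then show ?thesis by (simp add: P_def C_def r_def)
    qed
    have C: "0 \<le> C" "0 \<le> 1 - C" using D.mass_below_bounds[of z] by (simp_all add: C_def)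
    have P0: "0 \<le> P" by (simp add: P_def)
    \<comment> \<open>The ratio g / Q is positive and below c at z, so c is positive and the extra
      term in c, C and P below may be dropped.\<close>
    have c0: "0 < c" using n(3,4) by simp
    \<comment> \<open>The bounds \<open>right\<close> and \<open>left\<close>, multiplied by 1 - C
      and C, share the term C (1 - C) r, which eliminates r.\<close>
    have "(1 - C) * ((1 - c) * P) \<le> (1 - C) * (C * r)" by (rule mult_left_mono[OF right C(2)])
    also have "\<dots> = C * ((1 - C) * r)" by simp
    also have "\<dots> \<le> C * (1 - P)" by (rule mult_left_mono[OF left C(1)])
    finally have "(1 - c) * P + c * C * P \<le> C" by (simp add: algebra_simps)
    moreover have "0 \<le> c * C * P" using c0 C(1) P0 by simp
    ultimately have "P * (1 - c) \<le> C" by (simp add: mult.commute)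
    then have "P \<le> C / (1 - c)" using c(1) by (simp add: pos_le_divide_eq)
    then show ?thesis by (simp add: P_def C_def tail_Z)
  qed
  then show ?thesis using z0(2) by blast
qed

end
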